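(* Let $A,B$ be Artin algebras, ${}_AM_B$ a bimodule and $\Lambda=\begin{bmatrix}A&M\\0&B\end{bmatrix}$. The restriction of the duality $\mathrm D:\mathrm{mod}\Lambda\to\Lambda\text{-mod}$ gives a duality $\mathrm D:\mathscr S(A,M,B)_r\to\mathscr F(A,M,B)$.
   Context: All algebras are Artin algebras over a commutative artinian ring $R$ (bimodules are such that $\Lambda$ is again an Artin $R$-algebra); all modules are finitely generated; subcategories are full and closed under isomorphisms. $\mathrm D$ is the standard duality between right modules ($\mathrm{mod}\Lambda$) and left modules ($\Lambda\text{-mod}$). Left $\Lambda$-modules are identified with triples $\begin{bmatrix}X\\ Y\end{bmatrix}_\phi$, with $X\in A\text{-mod}$, $Y\in B\text{-mod}$ and $\phi:M\otimes_BY\to X$ a left $A$-map. Right $\Lambda$-modules are identified with triples $(U,V)_\psi$, with $U\in\mathrm{mod}A$, $V\in\mathrm{mod}B$ and $\psi:U\otimes_AM\to V$ a right $B$-map. $\mathscr S(A,M,B)_r$ is the subcategory of $\mathrm{mod}\Lambda$ of all $(U,V)_\psi$ with $\psi$ monic. The epimorphism category $\mathscr F(A,M,B)$ is the subcategory of $\Lambda\text{-mod}$ of all $\begin{bmatrix}X\\ Y\end{bmatrix}_\phi$ such that the left $B$-map $Y\to\mathrm{Hom}_A(M,X)$ corresponding to $\phi$ under the adjunction $\mathrm{Hom}_A(M\otimes_BY,X)\cong\mathrm{Hom}_B(Y,\mathrm{Hom}_A(M,X))$ is epic. *)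

theory Defs
  imports "HOL-Algebra.Module" "HOL-Algebra.QuotRing" "HOL-Algebra.Free_Abelian_Groups"
begin

section \<open>Modules over noncommutative rings\<close>

text \<open>
  The library locale \<^locale>\<open>module\<close> requires a commutative base ring. Its record type is reused
  here for left and for right modules over an arbitrary ring: in a right module, the
  record field \<open>a \<odot>\<^bsub>N\<^esub> x\<close> stands for the product \<open>x \<cdot> a\<close>. Homomorphisms and finite generation
  then have the same definition on both sides.
\<close>

locale left_module = A?: ring A + N?: abelian_group N
  for A :: "('a, 'c) ring_scheme" (structure) and N :: "('a, 'n, 'd) module_scheme" (structure) +
  assumes smult_closed:
      "\<lbrakk>a \<in> carrier A; x \<in> carrier N\<rbrakk> \<Longrightarrow> a \<odot>\<^bsub>N\<^esub> x \<in> carrier N"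
    and smult_l_distr:
      "\<lbrakk>a \<in> carrier A; b \<in> carrier A; x \<in> carrier N\<rbrakk> \<Longrightarrow>
        (a \<oplus>\<^bsub>A\<^esub> b) \<odot>\<^bsub>N\<^esub> x = a \<odot>\<^bsub>N\<^esub> x \<oplus>\<^bsub>N\<^esub> b \<odot>\<^bsub>N\<^esub> x"
    and smult_r_distr:
      "\<lbrakk>a \<in> carrier A; x \<in> carrier N; y \<in> carrier N\<rbrakk> \<Longrightarrow>
        a \<odot>\<^bsub>N\<^esub> (x \<oplus>\<^bsub>N\<^esub> y) = a \<odot>\<^bsub>N\<^esub> x \<oplus>\<^bsub>N\<^esub> a \<odot>\<^bsub>N\<^esub> y"
    and smult_assoc:
      "\<lbrakk>a \<in> carrier A; b \<in> carrier A; x \<in> carrier N\<rbrakk> \<Longrightarrow>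
        (a \<otimes>\<^bsub>A\<^esub> b) \<odot>\<^bsub>N\<^esub> x = a \<odot>\<^bsub>N\<^esub> (b \<odot>\<^bsub>N\<^esub> x)"
    and smult_one: "x \<in> carrier N \<Longrightarrow> \<one>\<^bsub>A\<^esub> \<odot>\<^bsub>N\<^esub> x = x"

locale right_module = A?: ring A + N?: abelian_group N
  for A :: "('a, 'c) ring_scheme" (structure) and N :: "('a, 'n, 'd) module_scheme" (structure) +
  assumes smult_closed:
      "\<lbrakk>a \<in> carrier A; x \<in> carrier N\<rbrakk> \<Longrightarrow> a \<odot>\<^bsub>N\<^esub> x \<in> carrier N"
    and smult_l_distr:
      "\<lbrakk>a \<in> carrier A; b \<in> carrier A; x \<in> carrier N\<rbrakk> \<Longrightarrow>
        (a \<oplus>\<^bsub>A\<^esub> b) \<odot>\<^bsub>N\<^esub> x = a \<odot>\<^bsub>N\<^esub> x \<oplus>\<^bsub>N\<^esub> b \<odot>\<^bsub>N\<^esub> x"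
    and smult_r_distr:
      "\<lbrakk>a \<in> carrier A; x \<in> carrier N; y \<in> carrier N\<rbrakk> \<Longrightarrow>
        a \<odot>\<^bsub>N\<^esub> (x \<oplus>\<^bsub>N\<^esub> y) = a \<odot>\<^bsub>N\<^esub> x \<oplus>\<^bsub>N\<^esub> a \<odot>\<^bsub>N\<^esub> y"
    and smult_assoc_right: \<comment> \<open>\<open>x \<cdot> (a b) = (x \<cdot> a) \<cdot> b\<close>\<close>
      "\<lbrakk>a \<in> carrier A; b \<in> carrier A; x \<in> carrier N\<rbrakk> \<Longrightarrow>
        (a \<otimes>\<^bsub>A\<^esub> b) \<odot>\<^bsub>N\<^esub> x = b \<odot>\<^bsub>N\<^esub> (a \<odot>\<^bsub>N\<^esub> x)"
    and smult_one: "x \<in> carrier N \<Longrightarrow> \<one>\<^bsub>A\<^esub> \<odot>\<^bsub>N\<^esub> x = x"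

text \<open>Homomorphisms are extensional, so that equality of homomorphisms is equality on the carrier.\<close>

definition mod_hom ::
  "('a, 'c) ring_scheme \<Rightarrow> ('a, 'm, 'd) module_scheme \<Rightarrow> ('a, 'n, 'e) module_scheme \<Rightarrow> ('m \<Rightarrow> 'n) set"
  where "mod_hom A M N = {f \<in> carrier M \<rightarrow>\<^sub>E carrier N.
    (\<forall>x\<in>carrier M. \<forall>y\<in>carrier M. f (x \<oplus>\<^bsub>M\<^esub> y) = f x \<oplus>\<^bsub>N\<^esub> f y) \<and>
    (\<forall>a\<in>carrier A. \<forall>x\<in>carrier M. f (a \<odot>\<^bsub>M\<^esub> x) = a \<odot>\<^bsub>N\<^esub> f x)}"

definition fin_gen :: "('a, 'c) ring_scheme \<Rightarrow> ('a, 'm, 'd) module_scheme \<Rightarrow> bool"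
  where "fin_gen A N \<longleftrightarrow> (\<exists>S. finite S \<and> S \<subseteq> carrier N \<and>
    (\<forall>H. submodule H A N \<and> S \<subseteq> H \<longrightarrow> H = carrier N))"

text \<open>Restriction of scalars along \<open>h\<close>, and a ring \<open>A\<close> as a module along a ring homomorphism into \<open>A\<close>.\<close>

definition restrict_scalars :: "('r \<Rightarrow> 'a) \<Rightarrow> ('a, 'm) module \<Rightarrow> ('r, 'm) module"
  where "restrict_scalars h N = \<lparr>carrier = carrier N, mult = mult N, one = one N,
    ring.zero = ring.zero N, add = add N, smult = (\<lambda>r x. h r \<odot>\<^bsub>N\<^esub> x)\<rparr>"

definition algebra_module :: "('r \<Rightarrow> 'a) \<Rightarrow> 'a ring \<Rightarrow> ('r, 'a) module"
  where "algebra_module h A = \<lparr>carrier = carrier A, mult = mult A, one = one A,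
    ring.zero = ring.zero A, add = add A, smult = (\<lambda>r x. h r \<otimes>\<^bsub>A\<^esub> x)\<rparr>"

record ('a, 'm, 'b) bimodule = "('a, 'm) module" +
  rsmult :: "'m \<Rightarrow> 'b \<Rightarrow> 'm"

definition right_part :: "('a, 'm, 'b) bimodule \<Rightarrow> ('b, 'm) module"
  where "right_part M = \<lparr>carrier = carrier M, mult = mult M, one = one M,
    ring.zero = ring.zero M, add = add M, smult = (\<lambda>b x. rsmult M x b)\<rparr>"

definition is_bimodule :: "'a ring \<Rightarrow> 'b ring \<Rightarrow> ('a, 'm, 'b) bimodule \<Rightarrow> bool"
  where "is_bimodule A B M \<longleftrightarrow> left_module A M \<and> right_module B (right_part M) \<and>
    (\<forall>a\<in>carrier A. \<forall>x\<in>carrier M. \<forall>b\<in>carrier B.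
      rsmult M (a \<odot>\<^bsub>M\<^esub> x) b = a \<odot>\<^bsub>M\<^esub> rsmult M x b)"


section \<open>Tensor products\<close>

text \<open>
  \<open>U \<otimes>\<^sub>A M\<close> for a right \<open>A\<close>-module \<open>U\<close> and a left \<open>A\<close>-module \<open>M\<close>, as an abelian group
  (written multiplicatively, as the free abelian groups of the library).
\<close>

definition tensor_relations ::
  "'a ring \<Rightarrow> ('a, 'u, 'c) module_scheme \<Rightarrow> ('a, 'm, 'd) module_scheme \<Rightarrow> (('u \<times> 'm) \<Rightarrow>\<^sub>0 int) set"
  where "tensor_relations A U M =
    {frag_of (u \<oplus>\<^bsub>U\<^esub> u', m) - frag_of (u, m) - frag_of (u', m) | u u' m.
      u \<in> carrier U \<and> u' \<in> carrier U \<and> m \<in> carrier M} \<union>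
    {frag_of (u, m \<oplus>\<^bsub>M\<^esub> m') - frag_of (u, m) - frag_of (u, m') | u m m'.
      u \<in> carrier U \<and> m \<in> carrier M \<and> m' \<in> carrier M} \<union>
    {frag_of (a \<odot>\<^bsub>U\<^esub> u, m) - frag_of (u, a \<odot>\<^bsub>M\<^esub> m) | a u m.
      a \<in> carrier A \<and> u \<in> carrier U \<and> m \<in> carrier M}"

definition tensor_kernel ::
  "'a ring \<Rightarrow> ('a, 'u, 'c) module_scheme \<Rightarrow> ('a, 'm, 'd) module_scheme \<Rightarrow> (('u \<times> 'm) \<Rightarrow>\<^sub>0 int) set"
  where "tensor_kernel A U M =
    generate (free_Abelian_group (carrier U \<times> carrier M)) (tensor_relations A U M)"

definition tensor ::
  "'a ring \<Rightarrow> ('a, 'u, 'c) module_scheme \<Rightarrow> ('a, 'm, 'd) module_scheme \<Rightarrow> (('u \<times> 'm) \<Rightarrow>\<^sub>0 int) set monoid"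
  where "tensor A U M = free_Abelian_group (carrier U \<times> carrier M) Mod tensor_kernel A U M"

definition pure_tensor ::
  "'a ring \<Rightarrow> ('a, 'u, 'c) module_scheme \<Rightarrow> ('a, 'm, 'd) module_scheme \<Rightarrow> 'u \<Rightarrow> 'm \<Rightarrow> (('u \<times> 'm) \<Rightarrow>\<^sub>0 int) set"
  where "pure_tensor A U M u m =
    tensor_kernel A U M #>\<^bsub>free_Abelian_group (carrier U \<times> carrier M)\<^esub> frag_of (u, m)"

text \<open>
  The homomorphism from the tensor product to \<open>V\<close> induced by a balanced map \<open>\<beta>\<close>: the class of
  \<open>\<Sum> k\<^sub>i (u\<^sub>i, m\<^sub>i)\<close> is sent to \<open>\<Sum> k\<^sub>i \<beta> u\<^sub>i m\<^sub>i\<close>.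
\<close>

definition tensor_lift ::
  "('v, 'c) ring_scheme \<Rightarrow> ('u \<Rightarrow> 'm \<Rightarrow> 'v) \<Rightarrow> (('u \<times> 'm) \<Rightarrow>\<^sub>0 int) set \<Rightarrow> 'v"
  where "tensor_lift V \<beta> C = the_elem ((\<lambda>c. \<Oplus>\<^bsub>V\<^esub> p \<in> Poly_Mapping.keys c.
    [Poly_Mapping.lookup c p] \<cdot>\<^bsub>V\<^esub> \<beta> (fst p) (snd p)) ` C)"


section \<open>Artin algebras\<close>

definition artinian_cring :: "'r ring \<Rightarrow> bool"
  where "artinian_cring R \<longleftrightarrow> cring R \<and>
    (\<forall>I :: nat \<Rightarrow> 'r set. (\<forall>n. ideal (I n) R \<and> I (Suc n) \<subseteq> I n) \<longrightarrow>
      (\<exists>n. \<forall>k\<ge>n. I k = I n))"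

text \<open>\<open>\<eta>\<close> is the structure homomorphism \<open>R \<rightarrow> A\<close> with central image.\<close>

definition artin_algebra :: "'r ring \<Rightarrow> 'a ring \<Rightarrow> ('r \<Rightarrow> 'a) \<Rightarrow> bool"
  where "artin_algebra R A \<eta> \<longleftrightarrow> artinian_cring R \<and> ring A \<and> \<eta> \<in> ring_hom R A \<and>
    (\<forall>r\<in>carrier R. \<forall>a\<in>carrier A. \<eta> r \<otimes>\<^bsub>A\<^esub> a = a \<otimes>\<^bsub>A\<^esub> \<eta> r) \<and>
    fin_gen R (algebra_module \<eta> A)"

text \<open>The matrix with rows \<open>(a, m)\<close> and \<open>(0, b)\<close> is encoded as \<open>(a, m, b)\<close>.\<close>

definition triangular ::
  "'a ring \<Rightarrow> ('a, 'm, 'b) bimodule \<Rightarrow> 'b ring \<Rightarrow> ('a \<times> 'm \<times> 'b) ring"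
  where "triangular A M B = \<lparr>carrier = carrier A \<times> carrier M \<times> carrier B,
    mult = (\<lambda>(a, m, b) (a', m', b').
      (a \<otimes>\<^bsub>A\<^esub> a', a \<odot>\<^bsub>M\<^esub> m' \<oplus>\<^bsub>M\<^esub> rsmult M m b', b \<otimes>\<^bsub>B\<^esub> b')),
    one = (\<one>\<^bsub>A\<^esub>, \<zero>\<^bsub>M\<^esub>, \<one>\<^bsub>B\<^esub>),
    ring.zero = (\<zero>\<^bsub>A\<^esub>, \<zero>\<^bsub>M\<^esub>, \<zero>\<^bsub>B\<^esub>),
    add = (\<lambda>(a, m, b) (a', m', b'). (a \<oplus>\<^bsub>A\<^esub> a', m \<oplus>\<^bsub>M\<^esub> m', b \<oplus>\<^bsub>B\<^esub> b'))\<rparr>"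

definition triangular_unit ::
  "('a, 'm, 'b) bimodule \<Rightarrow> ('r \<Rightarrow> 'a) \<Rightarrow> ('r \<Rightarrow> 'b) \<Rightarrow> 'r \<Rightarrow> 'a \<times> 'm \<times> 'b"
  where "triangular_unit M \<eta>\<^sub>A \<eta>\<^sub>B r = (\<eta>\<^sub>A r, \<zero>\<^bsub>M\<^esub>, \<eta>\<^sub>B r)"


section \<open>The identification of modules with triples\<close>

text \<open>
  Let \<open>e\<^sub>1 = (1, 0, 0)\<close> and \<open>e\<^sub>2 = (0, 0, 1)\<close>. A right module \<open>N\<close> over the triangular ring
  corresponds to the triple \<open>(U, V)\<^sub>\<psi>\<close> with \<open>U = N e\<^sub>1\<close>, \<open>V = N e\<^sub>2\<close> and
  \<open>\<psi> (u \<otimes> m) = u \<cdot> (0, m, 0)\<close>; a left module \<open>L\<close> to the triple with \<open>X = e\<^sub>1 L\<close>, \<open>Y = e\<^sub>2 L\<close> and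
  \<open>\<phi> (m \<otimes> y) = (0, m, 0) \<cdot> y\<close>. By the convention on right modules, the two components of a triple
  have the same definition for left and right modules.
\<close>

definition A_component ::
  "'a ring \<Rightarrow> ('a, 'm, 'b) bimodule \<Rightarrow> 'b ring \<Rightarrow> ('a \<times> 'm \<times> 'b, 'n) module \<Rightarrow> ('a, 'n) module"
  where "A_component A M B N = \<lparr>carrier = (\<lambda>x. (\<one>\<^bsub>A\<^esub>, \<zero>\<^bsub>M\<^esub>, \<zero>\<^bsub>B\<^esub>) \<odot>\<^bsub>N\<^esub> x) ` carrier N,
    mult = mult N, one = one N, ring.zero = ring.zero N, add = add N,
    smult = (\<lambda>a x. (a, \<zero>\<^bsub>M\<^esub>, \<zero>\<^bsub>B\<^esub>) \<odot>\<^bsub>N\<^esub> x)\<rparr>"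

definition B_component ::
  "'a ring \<Rightarrow> ('a, 'm, 'b) bimodule \<Rightarrow> 'b ring \<Rightarrow> ('a \<times> 'm \<times> 'b, 'n) module \<Rightarrow> ('b, 'n) module"
  where "B_component A M B N = \<lparr>carrier = (\<lambda>x. (\<zero>\<^bsub>A\<^esub>, \<zero>\<^bsub>M\<^esub>, \<one>\<^bsub>B\<^esub>) \<odot>\<^bsub>N\<^esub> x) ` carrier N,
    mult = mult N, one = one N, ring.zero = ring.zero N, add = add N,
    smult = (\<lambda>b x. (\<zero>\<^bsub>A\<^esub>, \<zero>\<^bsub>M\<^esub>, b) \<odot>\<^bsub>N\<^esub> x)\<rparr>"

definition right_psi ::
  "'a ring \<Rightarrow> ('a, 'm, 'b) bimodule \<Rightarrow> 'b ring \<Rightarrow> ('a \<times> 'm \<times> 'b, 'n) module \<Rightarrow>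
    (('n \<times> 'm) \<Rightarrow>\<^sub>0 int) set \<Rightarrow> 'n"
  where "right_psi A M B N =
    tensor_lift (B_component A M B N) (\<lambda>u m. (\<zero>\<^bsub>A\<^esub>, m, \<zero>\<^bsub>B\<^esub>) \<odot>\<^bsub>N\<^esub> u)"

definition left_phi ::
  "'a ring \<Rightarrow> ('a, 'm, 'b) bimodule \<Rightarrow> 'b ring \<Rightarrow> ('a \<times> 'm \<times> 'b, 'n) module \<Rightarrow>
    (('m \<times> 'n) \<Rightarrow>\<^sub>0 int) set \<Rightarrow> 'n"
  where "left_phi A M B L =
    tensor_lift (A_component A M B L) (\<lambda>m y. (\<zero>\<^bsub>A\<^esub>, m, \<zero>\<^bsub>B\<^esub>) \<odot>\<^bsub>L\<^esub> y)"

text \<open>The map \<open>Y \<rightarrow> Hom\<^sub>A(M, X)\<close>, \<open>y \<mapsto> (m \<mapsto> \<phi> (m \<otimes> y))\<close>, adjoint to \<open>\<phi>\<close>.\<close>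

definition left_phi_adjoint ::
  "'a ring \<Rightarrow> ('a, 'm, 'b) bimodule \<Rightarrow> 'b ring \<Rightarrow> ('a \<times> 'm \<times> 'b, 'n) module \<Rightarrow> 'n \<Rightarrow> 'm \<Rightarrow> 'n"
  where "left_phi_adjoint A M B L y = (\<lambda>m\<in>carrier M.
    left_phi A M B L (pure_tensor B (right_part M) (B_component A M B L) m y))"


section \<open>Categories and dualities\<close>

record ('o, 'h) category =
  Obj :: "'o set"
  Arr :: "'o \<Rightarrow> 'o \<Rightarrow> 'h set"
  Ident :: "'o \<Rightarrow> 'h"
  Comp :: "'o \<Rightarrow> 'o \<Rightarrow> 'o \<Rightarrow> 'h \<Rightarrow> 'h \<Rightarrow> 'h" \<comment> \<open>\<open>Comp C X Y Z g f\<close> is \<open>g \<circ> f\<close> for \<open>f : X \<rightarrow> Y\<close>, \<open>g : Y \<rightarrow> Z\<close>\<close>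

definition is_category :: "('o, 'h) category \<Rightarrow> bool"
  where "is_category C \<longleftrightarrow>
    (\<forall>X\<in>Obj C. Ident C X \<in> Arr C X X) \<and>
    (\<forall>X\<in>Obj C. \<forall>Y\<in>Obj C. \<forall>Z\<in>Obj C. \<forall>f\<in>Arr C X Y. \<forall>g\<in>Arr C Y Z.
      Comp C X Y Z g f \<in> Arr C X Z) \<and>
    (\<forall>X\<in>Obj C. \<forall>Y\<in>Obj C. \<forall>f\<in>Arr C X Y.
      Comp C X X Y f (Ident C X) = f \<and> Comp C X Y Y (Ident C Y) f = f) \<and>
    (\<forall>W\<in>Obj C. \<forall>X\<in>Obj C. \<forall>Y\<in>Obj C. \<forall>Z\<in>Obj C.
      \<forall>f\<in>Arr C W X. \<forall>g\<in>Arr C X Y. \<forall>h\<in>Arr C Y Z.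
        Comp C W Y Z h (Comp C W X Y g f) = Comp C W X Z (Comp C X Y Z h g) f)"

definition opposite :: "('o, 'h) category \<Rightarrow> ('o, 'h) category"
  where "opposite C = \<lparr>Obj = Obj C, Arr = (\<lambda>X Y. Arr C Y X), Ident = Ident C,
    Comp = (\<lambda>X Y Z g f. Comp C Z Y X f g)\<rparr>"

definition is_functor ::
  "('o, 'h) category \<Rightarrow> ('p, 'k) category \<Rightarrow> ('o \<Rightarrow> 'p) \<Rightarrow> ('o \<Rightarrow> 'o \<Rightarrow> 'h \<Rightarrow> 'k) \<Rightarrow> bool"
  where "is_functor C D F Fm \<longleftrightarrow> is_category C \<and> is_category D \<and>
    (\<forall>X\<in>Obj C. F X \<in> Obj D) \<and>
    (\<forall>X\<in>Obj C. \<forall>Y\<in>Obj C. \<forall>f\<in>Arr C X Y. Fm X Y f \<in> Arr D (F X) (F Y)) \<and>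
    (\<forall>X\<in>Obj C. Fm X X (Ident C X) = Ident D (F X)) \<and>
    (\<forall>X\<in>Obj C. \<forall>Y\<in>Obj C. \<forall>Z\<in>Obj C. \<forall>f\<in>Arr C X Y. \<forall>g\<in>Arr C Y Z.
      Fm X Z (Comp C X Y Z g f) = Comp D (F X) (F Y) (F Z) (Fm Y Z g) (Fm X Y f))"

definition is_iso_arrow :: "('o, 'h) category \<Rightarrow> 'o \<Rightarrow> 'o \<Rightarrow> 'h \<Rightarrow> bool"
  where "is_iso_arrow C X Y f \<longleftrightarrow> f \<in> Arr C X Y \<and>
    (\<exists>g\<in>Arr C Y X. Comp C X Y X g f = Ident C X \<and> Comp C Y X Y f g = Ident C Y)"

definition natural_iso ::
  "('o, 'h) category \<Rightarrow> ('p, 'k) category \<Rightarrow> ('o \<Rightarrow> 'p) \<Rightarrow> ('o \<Rightarrow> 'o \<Rightarrow> 'h \<Rightarrow> 'k) \<Rightarrow>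
    ('o \<Rightarrow> 'p) \<Rightarrow> ('o \<Rightarrow> 'o \<Rightarrow> 'h \<Rightarrow> 'k) \<Rightarrow> ('o \<Rightarrow> 'k) \<Rightarrow> bool"
  where "natural_iso C D F Fm G Gm \<tau> \<longleftrightarrow>
    (\<forall>X\<in>Obj C. is_iso_arrow D (F X) (G X) (\<tau> X)) \<and>
    (\<forall>X\<in>Obj C. \<forall>Y\<in>Obj C. \<forall>f\<in>Arr C X Y.
      Comp D (F X) (F Y) (G Y) (\<tau> Y) (Fm X Y f) = Comp D (F X) (G X) (G Y) (Gm X Y f) (\<tau> X))"

definition is_equivalence ::
  "('o, 'h) category \<Rightarrow> ('p, 'k) category \<Rightarrow> ('o \<Rightarrow> 'p) \<Rightarrow> ('o \<Rightarrow> 'o \<Rightarrow> 'h \<Rightarrow> 'k) \<Rightarrow> bool"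
  where "is_equivalence C D F Fm \<longleftrightarrow> is_functor C D F Fm \<and>
    (\<exists>G Gm \<tau> \<sigma>. is_functor D C G Gm \<and>
      natural_iso C C (\<lambda>X. G (F X)) (\<lambda>X Y f. Gm (F X) (F Y) (Fm X Y f))
        (\<lambda>X. X) (\<lambda>X Y f. f) \<tau> \<and>
      natural_iso D D (\<lambda>Z. F (G Z)) (\<lambda>Z W g. Fm (G Z) (G W) (Gm Z W g))
        (\<lambda>Z. Z) (\<lambda>Z W g. g) \<sigma>)"

text \<open>A contravariant equivalence; \<open>Fm X Y f : F Y \<rightarrow> F X\<close> for \<open>f : X \<rightarrow> Y\<close>.\<close>

definition is_duality ::
  "('o, 'h) category \<Rightarrow> ('p, 'k) category \<Rightarrow> ('o \<Rightarrow> 'p) \<Rightarrow> ('o \<Rightarrow> 'o \<Rightarrow> 'h \<Rightarrow> 'k) \<Rightarrow> bool"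
  where "is_duality C D F Fm \<longleftrightarrow> is_equivalence (opposite C) D F (\<lambda>X Y. Fm Y X)"

text \<open>The full subcategory, of left or of right modules, on a given class of objects.\<close>

definition module_category ::
  "'a ring \<Rightarrow> ('a, 'n) module set \<Rightarrow> (('a, 'n) module, 'n \<Rightarrow> 'n) category"
  where "module_category A Ob = \<lparr>Obj = Ob, Arr = mod_hom A,
    Ident = (\<lambda>X. \<lambda>x\<in>carrier X. x), Comp = (\<lambda>X Y Z g f. compose (carrier X) g f)\<rparr>"

definition mono_category_right ::
  "'a ring \<Rightarrow> ('a, 'm, 'b) bimodule \<Rightarrow> 'b ring \<Rightarrow>
    (('a \<times> 'm \<times> 'b, 'n) module, 'n \<Rightarrow> 'n) category"
  where "mono_category_right A M B = module_category (triangular A M B)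
    {N. right_module (triangular A M B) N \<and> fin_gen (triangular A M B) N \<and>
      inj_on (right_psi A M B N) (carrier (tensor A (A_component A M B N) M))}"

definition epi_category ::
  "'a ring \<Rightarrow> ('a, 'm, 'b) bimodule \<Rightarrow> 'b ring \<Rightarrow>
    (('a \<times> 'm \<times> 'b, 'n) module, 'n \<Rightarrow> 'n) category"
  where "epi_category A M B = module_category (triangular A M B)
    {L. left_module (triangular A M B) L \<and> fin_gen (triangular A M B) L \<and>
      left_phi_adjoint A M B L ` carrier (B_component A M B L) =
        mod_hom A M (A_component A M B L)}"


section \<open>The standard duality\<close>

definition jacobson_radical :: "'r ring \<Rightarrow> 'r set"
  where "jacobson_radical R = carrier R \<inter> \<Inter>{I. maximalideal I R}"

definition top_module :: "'r ring \<Rightarrow> ('r, 'r set) module"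
  where "top_module R = algebra_module (\<lambda>r. jacobson_radical R +>\<^bsub>R\<^esub> r) (R Quot jacobson_radical R)"

text \<open>
  Injectivity is tested on monomorphisms between modules whose elements lie in the type of the
  ring; these include the inclusions of ideals, so by Baer's criterion no generality is lost.
\<close>

definition injective_module :: "'r ring \<Rightarrow> ('r, 'e) module \<Rightarrow> bool"
  where "injective_module R J \<longleftrightarrow> module R J \<and>
    (\<forall>(X :: ('r, 'r) module) (Y :: ('r, 'r) module) i f.
      module R X \<and> module R Y \<and> i \<in> mod_hom R X Y \<and> inj_on i (carrier X) \<and> f \<in> mod_hom R X J \<longrightarrow>
      (\<exists>g\<in>mod_hom R Y J. \<forall>x\<in>carrier X. g (i x) = f x))"

definition injective_envelope ::
  "'r ring \<Rightarrow> ('r, 'x) module \<Rightarrow> ('r, 'e) module \<Rightarrow> ('x \<Rightarrow> 'e) \<Rightarrow> bool"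
  where "injective_envelope R X J i \<longleftrightarrow> injective_module R J \<and>
    i \<in> mod_hom R X J \<and> inj_on i (carrier X) \<and>
    (\<forall>H. submodule H R J \<and> H \<inter> i ` carrier X = {\<zero>\<^bsub>J\<^esub>} \<longrightarrow> H = {\<zero>\<^bsub>J\<^esub>})"

text \<open>
  \<open>D N = Hom\<^sub>R(N, J)\<close>, with \<open>J\<close> the injective envelope of \<open>R / rad R\<close> and \<open>\<eta>\<close> the structure
  map of the Artin algebra. For a right module \<open>N\<close> the action is \<open>(a f)(x) = f (x a)\<close>.
\<close>

definition D_obj ::
  "'r ring \<Rightarrow> ('r, 'e) module \<Rightarrow> ('r \<Rightarrow> 'a) \<Rightarrow> ('a, 'n) module \<Rightarrow> ('a, 'n \<Rightarrow> 'e) module"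
  where "D_obj R J \<eta> N = \<lparr>carrier = mod_hom R (restrict_scalars \<eta> N) J,
    mult = undefined, one = undefined,
    ring.zero = (\<lambda>x\<in>carrier N. \<zero>\<^bsub>J\<^esub>),
    add = (\<lambda>f g. \<lambda>x\<in>carrier N. f x \<oplus>\<^bsub>J\<^esub> g x),
    smult = (\<lambda>a f. \<lambda>x\<in>carrier N. f (a \<odot>\<^bsub>N\<^esub> x))\<rparr>"

definition D_map ::
  "'r ring \<Rightarrow> ('r, 'e) module \<Rightarrow> ('r \<Rightarrow> 'a) \<Rightarrow> ('a, 'n) module \<Rightarrow> ('a, 'n) module \<Rightarrow>
    ('n \<Rightarrow> 'n) \<Rightarrow> ('n \<Rightarrow> 'e) \<Rightarrow> ('n \<Rightarrow> 'e)"
  where "D_map R J \<eta> N N' h = (\<lambda>g\<in>carrier (D_obj R J \<eta> N'). compose (carrier N) g h)"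

end

theory Submission
  imports Defs
begin

text \<open>
  Over the artinian ring \<open>R\<close> the module \<open>J\<close> contains \<open>R/P\<close> exactly once for every maximal ideal \<open>P\<close>.
  Descending through ideals with simple subquotients one finds that every endomorphism of \<open>J\<close> is
  multiplication by a scalar and that \<open>J\<close> is noetherian; by induction on generators it follows that
  \<open>Hom\<^sub>R(N, J)\<close> is finitely generated and that all functionals on it are evaluations, for every
  finitely generated \<open>N\<close>. Hence \<open>D\<close> is a duality between right and left \<open>\<Lambda>\<close>-modules.
  For \<open>N = (U, V)\<^sub>\<psi>\<close> a map \<open>M \<rightarrow> D U\<close> of left \<open>A\<close>-modules is the same as a functional on \<open>U \<otimes>\<^sub>A M\<close>, and
  the adjoint structure map of \<open>D N\<close> becomes restriction of functionals along \<open>\<psi>\<close>. As functionals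
  extend along monomorphisms and separate points, it is epic iff \<open>\<psi>\<close> is monic.
\<close>

section \<open>Modules over commutative rings\<close>

text \<open>Two facts about types shape the proof. Injectivity of \<open>J\<close> is given only
  against modules on the type \<open>'r\<close>, so that Baer's criterion is what it yields;
  functionals on other modules are extended one generator at a time, and finite generation has to be
  tracked throughout. Moreover \<open>D\<close> leads from modules on \<open>'n\<close> to modules
  on \<open>'n \<Rightarrow> 'e\<close>, so a double dual is not an object of the original category
  and \<open>D\<close> cannot serve as its own quasi-inverse. The duality is therefore obtained as a
  fully faithful and essentially surjective contravariant functor. An object with dual
  \<open>Z\<close> is found as a copy of \<open>D Z\<close> on \<open>'n\<close>, built from codes
  of its elements by lists over \<Lambda>.

  Double duality is not proved by comparing lengths. A functional on the dual is peeled off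
  generator by generator, and each layer extends to an endomorphism of \<open>J\<close>. It is
  evaluation at a multiple of the generator because such endomorphisms are scalars; with repeated
  components in the socle they would be matrices.\<close>

lemma ideal_if_closed:
  assumes "cring R" "I \<subseteq> carrier R" "\<zero>\<^bsub>R\<^esub> \<in> I"
    and "\<And>a b. a \<in> I \<Longrightarrow> b \<in> I \<Longrightarrow> a \<oplus>\<^bsub>R\<^esub> b \<in> I"
    and "\<And>r a. r \<in> carrier R \<Longrightarrow> a \<in> I \<Longrightarrow> r \<otimes>\<^bsub>R\<^esub> a \<in> I"
  shows "ideal I R"
proof -
  interpret cring R by fact
  have neg: "\<ominus>\<^bsub>R\<^esub> a \<in> I" if "a \<in> I" for a
  proof -
    have "\<ominus>\<^bsub>R\<^esub> a = (\<ominus>\<^bsub>R\<^esub> \<one>\<^bsub>R\<^esub>) \<otimes>\<^bsub>R\<^esub> a"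
      using that assms(2) by (simp add: l_minus subset_iff)
    then show ?thesis using assms(5) that by simp
  qed
  show ?thesis
  proof (rule idealI)
    show "subgroup I (add_monoid R)"
      using assms neg by (intro add.subgroupI) (auto simp: a_inv_def)
    show "x \<otimes>\<^bsub>R\<^esub> a \<in> I" "a \<otimes>\<^bsub>R\<^esub> x \<in> I" if "a \<in> I" "x \<in> carrier R" for a x
      using that assms(2,5) m_comm[of a x] by auto
  qed (fact ring_axioms)
qed

section \<open>Ideals of a commutative ring\<close>

context cring
begin

lemma idealD:
  assumes "ideal I R"
  shows "I \<subseteq> carrier R" "\<zero> \<in> I" "a \<in> I \<Longrightarrow> b \<in> I \<Longrightarrow> a \<oplus> b \<in> I"
    "r \<in> carrier R \<Longrightarrow> a \<in> I \<Longrightarrow> r \<otimes> a \<in> I" "a \<in> I \<Longrightarrow> b \<in> I \<Longrightarrow> a \<ominus> b \<in> I"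
    "r \<in> carrier R \<Longrightarrow> a \<in> I \<Longrightarrow> a \<otimes> r \<in> I"
proof -
  interpret ideal I R by fact
  show "I \<subseteq> carrier R" "\<zero> \<in> I" "a \<in> I \<Longrightarrow> b \<in> I \<Longrightarrow> a \<oplus> b \<in> I"
    "r \<in> carrier R \<Longrightarrow> a \<in> I \<Longrightarrow> r \<otimes> a \<in> I" "r \<in> carrier R \<Longrightarrow> a \<in> I \<Longrightarrow> a \<otimes> r \<in> I"
    by (auto simp: I_l_closed I_r_closed a_subset a_Hcarr)
  show "a \<in> I \<Longrightarrow> b \<in> I \<Longrightarrow> a \<ominus> b \<in> I"
    by (simp add: a_minus_def)
qed

lemma ideal_sum:
  assumes "ideal I R" "ideal K R"
  shows "ideal {x \<oplus> y | x y. x \<in> I \<and> y \<in> K} R"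
proof -
  have "I <+>\<^bsub>R\<^esub> K = {x \<oplus> y | x y. x \<in> I \<and> y \<in> K}"
    by (auto simp: set_add_def set_mult_def)
  then show ?thesis using add_ideals[OF assms] by simp
qed

text \<open>Zorn's lemma for the ideals above \<open>I\<close> that miss \<open>\<one>\<close>;
  missing \<open>\<one>\<close> is the form of properness that survives unions of chains.\<close>

lemma ex_maximalideal:
  assumes "ideal I R" "I \<noteq> carrier R"
  shows "\<exists>P. maximalideal P R \<and> I \<subseteq> P"
proof -
  define S where "S = {K. ideal K R \<and> I \<subseteq> K \<and> \<one> \<notin> K}"
  have IS: "I \<in> S"
    using assms ideal.one_imp_carrier[of I R] by (auto simp: S_def)
  have "\<exists>P\<in>S. \<forall>X\<in>S. P \<subseteq> X \<longrightarrow> X = P"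
  proof (rule subset_Zorn)
    fix C assume C: "subset.chain S C"
    show "\<exists>U\<in>S. \<forall>X\<in>C. X \<subseteq> U"
    proof (cases "C = {}")
      case True
      then show ?thesis using IS by auto
    next
      case False
      have CS: "C \<subseteq> S" and total: "\<And>X Y. X \<in> C \<Longrightarrow> Y \<in> C \<Longrightarrow> X \<subseteq> Y \<or> Y \<subseteq> X"
        using C by (auto simp: pred_on.chain_def)
      have id: "ideal X R" if "X \<in> C" for X using that CS by (auto simp: S_def)
      have "ideal (\<Union>C) R"
      proof (rule ideal_if_closed)
        show "\<Union>C \<subseteq> carrier R" "\<zero> \<in> \<Union>C" using id idealD False by blast+
        show "a \<oplus> b \<in> \<Union>C" if "a \<in> \<Union>C" "b \<in> \<Union>C" for a b
        proof -
          from that obtain X Y where XY: "X \<in> C" "a \<in> X" "Y \<in> C" "b \<in> Y" by blast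
          with total[of X Y] idealD(3)[OF id[of X], of a b] idealD(3)[OF id[of Y], of a b]
          show ?thesis by blast
        qed
        show "r \<otimes> a \<in> \<Union>C" if "r \<in> carrier R" "a \<in> \<Union>C" for r a
          using that id idealD(4) by blast
      qed (fact is_cring)
      then have "\<Union>C \<in> S" using CS False by (auto simp: S_def)
      then show ?thesis by blast
    qed
  qed
  then obtain P where P: "P \<in> S" "\<And>X. X \<in> S \<Longrightarrow> P \<subseteq> X \<Longrightarrow> X = P" by blast
  have "maximalideal P R"
  proof (rule maximalidealI)
    show "ideal P R" "carrier R \<noteq> P" using P(1) by (auto simp: S_def)
    show "K = P \<or> K = carrier R" if "ideal K R" "P \<subseteq> K" for K
      using that P ideal.one_imp_carrier[of K R] by (auto simp: S_def)
  qed
  then show ?thesis using P(1) by (auto simp: S_def)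
qed

text \<open>\<open>R\<close> modulo \<open>P\<close> is a field and \<open>q\<close> represents the
  inverse of the class of \<open>r\<close>: maximality gives \<open>P + R r = R\<close>, and
  \<open>q\<close> is read off from a decomposition of \<open>\<one>\<close>.\<close>

lemma maximalideal_inverse:
  assumes "maximalideal P R" "r \<in> carrier R" "r \<notin> P"
  obtains q where "q \<in> carrier R" "\<one> \<ominus> q \<otimes> r \<in> P"
proof -
  interpret P: maximalideal P R by fact
  have idr: "ideal (PIdl r) R" by (rule cgenideal_ideal) fact
  have id: "ideal {x \<oplus> y | x y. x \<in> P \<and> y \<in> PIdl r} R" (is "ideal ?K R")
    by (rule ideal_sum[OF P.is_ideal idr])
  have "P \<subseteq> ?K"
  proof
    fix x assume "x \<in> P"
    then have "x = x \<oplus> \<zero>" using P.Icarr by simp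
    then show "x \<in> ?K" using \<open>x \<in> P\<close> idealD(2)[OF idr] by blast
  qed
  moreover have "r \<in> ?K"
  proof -
    have "r = \<zero> \<oplus> r" using assms by simp
    then show ?thesis using idealD(2)[OF P.is_ideal] cgenideal_self[OF assms(2)] by blast
  qed
  ultimately have "?K = carrier R"
    using P.I_maximal[OF id] idealD(1)[OF id] assms(3) by blast
  then obtain x q where xq: "x \<in> P" "q \<in> carrier R" "\<one> = x \<oplus> q \<otimes> r"
    using one_closed unfolding cgenideal_def by blast
  then have "\<one> \<ominus> q \<otimes> r = x"
    using P.Icarr[OF xq(1)] assms(2) by (simp add: a_minus_def a_assoc r_neg)
  then show ?thesis using that xq by simp
qed

end

text \<open>The descending chain condition as a minimum principle. Without a minimal member, choice
  would iterate to a strictly descending sequence of ideals.\<close>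

lemma artinian_minimal_ideal:
  assumes R: "artinian_cring R" and "I\<^sub>0 \<in> \<F>" and id: "\<And>I. I \<in> \<F> \<Longrightarrow> ideal I R"
  obtains I where "I \<in> \<F>" "\<And>K. K \<in> \<F> \<Longrightarrow> K \<subseteq> I \<Longrightarrow> K = I"
proof (rule ccontr)
  assume "\<not> thesis"
  then have "\<forall>I\<in>\<F>. \<exists>K\<in>\<F>. K \<subset> I" using that by blast
  then obtain next_ideal where n: "\<And>I. I \<in> \<F> \<Longrightarrow> next_ideal I \<in> \<F> \<and> next_ideal I \<subset> I" by metis
  define c where "c k = (next_ideal ^^ k) I\<^sub>0" for k
  have c: "c k \<in> \<F>" for k by (induction k) (use assms n in \<open>auto simp: c_def\<close>)
  then have "c (Suc k) \<subset> c k" for k using n[of "c k"] by (simp add: c_def)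
  moreover from this have "\<exists>n. \<forall>k\<ge>n. c k = c n"
    using R c id unfolding artinian_cring_def by blast
  ultimately show False by (metis le_SucI order_refl psubset_eq)
qed

text \<open>Linearity on a subset \<open>W\<close>, in practice a submodule or an ideal. Values
  outside \<open>W\<close> are free, so partial functionals can be extended without a module record
  for each domain and without the extensionality of \<open>mod_hom\<close>.\<close>

definition lin_on :: "('r, 'c) ring_scheme \<Rightarrow> ('r, 'm, 'd) module_scheme \<Rightarrow> ('r, 'n, 'e) module_scheme \<Rightarrow>
    'm set \<Rightarrow> ('m \<Rightarrow> 'n) \<Rightarrow> bool"
  where "lin_on R M N W f \<longleftrightarrow> (\<forall>x\<in>W. f x \<in> carrier N) \<and>
    (\<forall>x\<in>W. \<forall>y\<in>W. f (x \<oplus>\<^bsub>M\<^esub> y) = f x \<oplus>\<^bsub>N\<^esub> f y) \<and>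
    (\<forall>r\<in>carrier R. \<forall>x\<in>W. f (r \<odot>\<^bsub>M\<^esub> x) = r \<odot>\<^bsub>N\<^esub> f x)"

lemma lin_onD:
  assumes "lin_on R M N W f" "x \<in> W"
  shows "f x \<in> carrier N" "y \<in> W \<Longrightarrow> f (x \<oplus>\<^bsub>M\<^esub> y) = f x \<oplus>\<^bsub>N\<^esub> f y"
    "r \<in> carrier R \<Longrightarrow> f (r \<odot>\<^bsub>M\<^esub> x) = r \<odot>\<^bsub>N\<^esub> f x"
  using assms unfolding lin_on_def by auto

lemma mod_hom_iff:
  "f \<in> mod_hom R M N \<longleftrightarrow> lin_on R M N (carrier M) f \<and> f \<in> extensional (carrier M)"
  unfolding mod_hom_def lin_on_def by (auto simp: PiE_def)

lemma lin_on_subset: "lin_on R M N W f \<Longrightarrow> W' \<subseteq> W \<Longrightarrow> lin_on R M N W' f"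
  unfolding lin_on_def by blast

section \<open>Submodules and finite generation\<close>

context module
begin

lemma submodule_if_closed:
  assumes "H \<subseteq> carrier M" "\<zero>\<^bsub>M\<^esub> \<in> H"
    and "\<And>a b. a \<in> H \<Longrightarrow> b \<in> H \<Longrightarrow> a \<oplus>\<^bsub>M\<^esub> b \<in> H"
    and "\<And>a x. a \<in> carrier R \<Longrightarrow> x \<in> H \<Longrightarrow> a \<odot>\<^bsub>M\<^esub> x \<in> H"
  shows "submodule H R M"
proof (rule submoduleI)
  show "\<ominus>\<^bsub>M\<^esub> x \<in> H" if "x \<in> H" for x
  proof -
    have "\<ominus>\<^bsub>M\<^esub> x = (\<ominus> \<one>) \<odot>\<^bsub>M\<^esub> x" using that assms(1) by (subst smult_l_minus) auto
    then show ?thesis using assms(4) that by simp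
  qed
qed (use assms in auto)

lemma submoduleD:
  assumes "submodule H R M"
  shows "H \<subseteq> carrier M" "\<zero>\<^bsub>M\<^esub> \<in> H" "a \<in> H \<Longrightarrow> b \<in> H \<Longrightarrow> a \<oplus>\<^bsub>M\<^esub> b \<in> H"
    "r \<in> carrier R \<Longrightarrow> a \<in> H \<Longrightarrow> r \<odot>\<^bsub>M\<^esub> a \<in> H" "a \<in> H \<Longrightarrow> b \<in> H \<Longrightarrow> a \<ominus>\<^bsub>M\<^esub> b \<in> H"
  using submoduleE[OF assms] subgroup.one_closed[OF submodule.axioms(1)[OF assms]]
  by (auto simp: a_minus_def)

lemma submodule_lin:
  assumes "submodule H R M" "lin_on R M N H f" "module R N"
  shows "f \<zero>\<^bsub>M\<^esub> = \<zero>\<^bsub>N\<^esub>" "x \<in> H \<Longrightarrow> y \<in> H \<Longrightarrow> f (x \<ominus>\<^bsub>M\<^esub> y) = f x \<ominus>\<^bsub>N\<^esub> f y"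
proof -
  interpret N: module R N by fact
  note H = submoduleD[OF assms(1)]
  note f = lin_onD[OF assms(2)]
  have "f \<zero>\<^bsub>M\<^esub> = f (\<zero> \<odot>\<^bsub>M\<^esub> \<zero>\<^bsub>M\<^esub>)" by simp
  also have "\<dots> = \<zero> \<odot>\<^bsub>N\<^esub> f \<zero>\<^bsub>M\<^esub>" by (rule f(3)[OF H(2) R.zero_closed])
  finally show "f \<zero>\<^bsub>M\<^esub> = \<zero>\<^bsub>N\<^esub>" using f(1)[OF H(2)] by simp
  assume xy: "x \<in> H" "y \<in> H"
  have y: "y \<in> carrier M" "(\<ominus> \<one>) \<odot>\<^bsub>M\<^esub> y \<in> H" using H xy by auto
  have "f (x \<ominus>\<^bsub>M\<^esub> y) = f (x \<oplus>\<^bsub>M\<^esub> (\<ominus> \<one>) \<odot>\<^bsub>M\<^esub> y)"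
    using y by (simp add: smult_l_minus a_minus_def)
  also have "\<dots> = f x \<ominus>\<^bsub>N\<^esub> f y"
    using f(2)[OF xy(1) y(2)] f(3)[OF xy(2)] f(1)[OF xy(2)]
    by (simp add: N.smult_l_minus a_minus_def)
  finally show "f (x \<ominus>\<^bsub>M\<^esub> y) = f x \<ominus>\<^bsub>N\<^esub> f y" .
qed

lemma submodule_vimage:
  assumes "submodule W R M" "lin_on R M N W f" "module R N" "submodule K R N"
  shows "submodule {x \<in> W. f x \<in> K} R M"
proof -
  interpret N: module R N by fact
  note W = submoduleD[OF assms(1)] and K = N.submoduleD[OF assms(4)]
  show ?thesis
    by (rule submodule_if_closed)
      (use W K lin_onD[OF assms(2)] submodule_lin(1)[OF assms(1-3)] in auto)
qed

lemma submodule_image: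
  assumes "submodule W R M" "lin_on R M N W f" "module R N"
  shows "submodule (f ` W) R N"
proof -
  interpret N: module R N by fact
  note W = submoduleD[OF assms(1)] and f = lin_onD[OF assms(2)]
  show ?thesis
  proof (rule N.submodule_if_closed)
    show "f ` W \<subseteq> carrier N" using f by auto
    show "\<zero>\<^bsub>N\<^esub> \<in> f ` W" using submodule_lin(1)[OF assms] W by (metis image_eqI)
    show "a \<oplus>\<^bsub>N\<^esub> b \<in> f ` W" if "a \<in> f ` W" "b \<in> f ` W" for a b
      using that f(2) W(3) by (auto simp flip: f(2))
    show "a \<odot>\<^bsub>N\<^esub> x \<in> f ` W" if "a \<in> carrier R" "x \<in> f ` W" for a x
      using that W(4) by (auto simp flip: f(3))
  qed
qed

lemma zero_submodule: "submodule {\<zero>\<^bsub>M\<^esub>} R M"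
  by (rule submodule_if_closed) auto

lemma submodule_kernel:
  assumes "submodule W R M" "lin_on R M N W f" "module R N"
  shows "submodule {x \<in> W. f x = \<zero>\<^bsub>N\<^esub>} R M"
  using submodule_vimage[OF assms module.zero_submodule[OF assms(3)]] by simp

lemma submodule_Int:
  assumes "submodule H R M" "submodule K R M"
  shows "submodule (H \<inter> K) R M"
  using submoduleD[OF assms(1)] submoduleD[OF assms(2)]
  by (intro submodule_if_closed) auto

lemma smult_minus_left:
  assumes "a \<in> carrier R" "b \<in> carrier R" "x \<in> carrier M"
  shows "(a \<ominus> b) \<odot>\<^bsub>M\<^esub> x = a \<odot>\<^bsub>M\<^esub> x \<ominus>\<^bsub>M\<^esub> b \<odot>\<^bsub>M\<^esub> x"
  using assms by (simp add: a_minus_def smult_l_distr smult_l_minus)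

lemma smult_minus_right:
  assumes "a \<in> carrier R" "y \<in> carrier M" "x \<in> carrier M"
  shows "a \<odot>\<^bsub>M\<^esub> (x \<ominus>\<^bsub>M\<^esub> y) = a \<odot>\<^bsub>M\<^esub> x \<ominus>\<^bsub>M\<^esub> a \<odot>\<^bsub>M\<^esub> y"
  using assms by (simp add: a_minus_def smult_r_distr smult_r_minus)

lemma minus_eq_zero_imp_eq:
  assumes "x \<in> carrier M" "y \<in> carrier M" "x \<ominus>\<^bsub>M\<^esub> y = \<zero>\<^bsub>M\<^esub>"
  shows "x = y"
  using assms by (metis M.minus_equality M.minus_minus M.add.inv_closed M.a_comm a_minus_def)

lemma eq_add_minus:
  assumes "x \<in> carrier M" "y \<in> carrier M"
  shows "x = y \<oplus>\<^bsub>M\<^esub> (x \<ominus>\<^bsub>M\<^esub> y)"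
  using assms by (simp add: a_minus_def M.a_lcomm M.r_neg)

end

text \<open>Generation is tested against submodules of the ambient \<open>N\<close>, which avoids a
  separate module record for \<open>W\<close>.\<close>

definition fg_sub :: "('r, 'c) ring_scheme \<Rightarrow> ('r, 'n, 'd) module_scheme \<Rightarrow> 'n set \<Rightarrow> bool"
  where "fg_sub R N W \<longleftrightarrow> (\<exists>S. finite S \<and> S \<subseteq> W \<and> (\<forall>H. submodule H R N \<and> S \<subseteq> H \<longrightarrow> W \<subseteq> H))"

lemma fg_subE:
  assumes "fg_sub R N W"
  obtains S where "finite S" "S \<subseteq> W" "\<And>H. submodule H R N \<Longrightarrow> S \<subseteq> H \<Longrightarrow> W \<subseteq> H"
  using assms that unfolding fg_sub_def by metis

lemma (in module) fin_gen_iff: "fin_gen R M \<longleftrightarrow> fg_sub R M (carrier M)"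
  unfolding fin_gen_def fg_sub_def using submoduleD(1) by (metis subset_antisym)

text \<open>Generators \<open>S\<close> of the kernel and lifts \<open>T'\<close> of generators of
  the image generate \<open>W\<close>: a submodule \<open>H\<close> containing both attains every
  value of \<open>f\<close> within \<open>W\<close>, so each \<open>w\<close> differs from some
  \<open>h \<in> H\<close> by an element of the kernel.\<close>

lemma (in module) fg_sub_extension:
  assumes W: "submodule W R M" and f: "lin_on R M N W f" and N: "module R N"
    and ker: "fg_sub R M {x \<in> W. f x = \<zero>\<^bsub>N\<^esub>}" and im: "fg_sub R N (f ` W)"
  shows "fg_sub R M W"
proof -
  obtain S where S: "finite S" "S \<subseteq> {x \<in> W. f x = \<zero>\<^bsub>N\<^esub>}"
    "\<And>H. submodule H R M \<Longrightarrow> S \<subseteq> H \<Longrightarrow> {x \<in> W. f x = \<zero>\<^bsub>N\<^esub>} \<subseteq> H"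
    using fg_subE[OF ker] by metis
  obtain T where T: "finite T" "T \<subseteq> f ` W"
    "\<And>H. submodule H R N \<Longrightarrow> T \<subseteq> H \<Longrightarrow> f ` W \<subseteq> H"
    using fg_subE[OF im] by metis
  from T(1,2) obtain T' where T': "T' \<subseteq> W" "finite T'" "T = f ` T'"
    by (meson finite_subset_image)
  interpret N: module R N by fact
  note WD = submoduleD[OF W] and fD = lin_onD[OF f]
  have "W \<subseteq> H" if H: "submodule H R M" "S \<union> T' \<subseteq> H" for H
  proof
    fix w assume w: "w \<in> W"
    note HD = submoduleD[OF H(1)]
    have HW: "submodule (H \<inter> W) R M" by (rule submodule_Int) fact+
    have "f ` W \<subseteq> f ` (H \<inter> W)"
      by (rule T(3)[OF submodule_image[OF HW lin_on_subset[OF f] N]]) (use T' H in auto)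
    then obtain h where h: "h \<in> H" "h \<in> W" "f w = f h" using w by blast
    have "f (w \<ominus>\<^bsub>M\<^esub> h) = \<zero>\<^bsub>N\<^esub>"
      using submodule_lin(2)[OF W f N w h(2)] h(3) fD(1)[OF h(2)]
      by (simp add: a_minus_def N.M.r_neg)
    then have "w \<ominus>\<^bsub>M\<^esub> h \<in> H" using S(3)[OF H(1)] H(2) WD(5)[OF w h(2)] by blast
    then show "w \<in> H" using eq_add_minus[of w h] HD(3)[OF h(1)] w h(2) WD(1) by (metis subsetD)
  qed
  moreover have "finite (S \<union> T')" "S \<union> T' \<subseteq> W" using S T' by auto
  ultimately show ?thesis unfolding fg_sub_def by blast
qed

section \<open>The injective envelope of the top of an artinian ring\<close>

abbreviation self_module :: "'r ring \<Rightarrow> ('r, 'r) module"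
  where "self_module R \<equiv> algebra_module (\<lambda>r. r) R"

lemma self_module_simps [simp]:
  "carrier (self_module R) = carrier R" "\<zero>\<^bsub>self_module R\<^esub> = \<zero>\<^bsub>R\<^esub>"
  "x \<oplus>\<^bsub>self_module R\<^esub> y = x \<oplus>\<^bsub>R\<^esub> y" "r \<odot>\<^bsub>self_module R\<^esub> x = r \<otimes>\<^bsub>R\<^esub> x"
  by (simp_all add: algebra_module_def)

lemma abelian_group_cong:
  assumes "abelian_group M" "carrier N = carrier M" "add N = add M" "\<zero>\<^bsub>N\<^esub> = \<zero>\<^bsub>M\<^esub>"
  shows "abelian_group N"
  using abelian_groupE[OF assms(1)] assms(2-) by (intro abelian_groupI) auto

lemma self_module: "cring R \<Longrightarrow> module R (self_module R)"
proof -
  assume "cring R"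
  then interpret cring R .
  show ?thesis
    by (intro moduleI abelian_group_cong[OF is_abelian_group])
      (auto simp: algebra_module_def l_distr r_distr m_assoc is_cring)
qed

lemma ideal_submodule:
  assumes "cring R" "ideal I R"
  shows "submodule I R (self_module R)"
proof -
  interpret cring R by fact
  interpret S: module R "self_module R" by (rule self_module) fact
  show ?thesis using idealD[OF assms(2)] by (intro S.submodule_if_closed) auto
qed

section \<open>Injectivity, and the socle of \<open>J\<close>\<close>

locale artin_envelope = module R J for R :: "'r ring" (structure) and J :: "('r, 'e) module" +
  fixes i :: "'r set \<Rightarrow> 'e"
  assumes artinian: "artinian_cring R" and envelope: "injective_envelope R (top_module R) J i"
begin

text \<open>Injectivity is applied to the inclusion of \<open>I\<close> into \<open>R\<close>, two
  modules on the type \<open>'r\<close> as \<open>injective_module\<close> demands. An extension to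
  \<open>R\<close> is determined by its value \<open>z\<close> at \<open>\<one>\<close>.\<close>

lemma baer:
  assumes I: "ideal I R" and f: "lin_on R (self_module R) J I f"
  shows "\<exists>z\<in>carrier J. \<forall>x\<in>I. f x = x \<odot>\<^bsub>J\<^esub> z"
proof -
  interpret S: module R "self_module R" by (rule self_module[OF is_cring])
  define X where "X = self_module R\<lparr>carrier := I\<rparr>"
  have X: "module R X" unfolding X_def
    by (rule submodule.submodule_is_module[OF ideal_submodule[OF is_cring I] S.module_axioms])
  have IR: "I \<subseteq> carrier R" using idealD[OF I] by simp
  have simps: "carrier X = I" "\<And>x y. x \<oplus>\<^bsub>X\<^esub> y = x \<oplus> y" "\<And>r x. r \<odot>\<^bsub>X\<^esub> x = r \<otimes> x"
    by (simp_all add: X_def)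
  have "injective_module R J" using envelope by (simp add: injective_envelope_def)
  moreover have "(\<lambda>x\<in>I. x) \<in> mod_hom R X (self_module R)" "restrict f I \<in> mod_hom R X J"
    using IR f idealD[OF I] unfolding mod_hom_def lin_on_def by (auto simp: simps)
  moreover have "inj_on (\<lambda>x\<in>I. x) (carrier X)" by (auto simp: inj_on_def simps)
  ultimately obtain g where g: "g \<in> mod_hom R (self_module R) J"
    "\<forall>x\<in>carrier X. g ((\<lambda>x\<in>I. x) x) = restrict f I x"
    using X S.module_axioms unfolding injective_module_def by blast
  have "f x = x \<odot>\<^bsub>J\<^esub> g \<one>" if "x \<in> I" for x
  proof -
    have "f x = g (x \<otimes> \<one>)" using g(2) that IR by (auto simp: simps)
    also have "\<dots> = x \<odot>\<^bsub>J\<^esub> g \<one>" using g(1) that IR by (auto simp: mod_hom_def simp del: r_one)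
    finally show ?thesis .
  qed
  moreover have "g \<one> \<in> carrier J" using g(1) by (auto simp: mod_hom_def PiE_def Pi_def)
  ultimately show ?thesis by blast
qed

lemma jacobson_radical_ideal: "ideal (jacobson_radical R) R"
proof (rule ideal_if_closed[OF is_cring])
  note max = idealD[OF maximalideal.axioms(1)]
  show "jacobson_radical R \<subseteq> carrier R" "\<zero> \<in> jacobson_radical R"
    using max(2) by (auto simp: jacobson_radical_def)
  show "a \<oplus> b \<in> jacobson_radical R" if "a \<in> jacobson_radical R" "b \<in> jacobson_radical R" for a b
    using that max(3) by (auto simp: jacobson_radical_def)
  show "r \<otimes> a \<in> jacobson_radical R" if "r \<in> carrier R" "a \<in> jacobson_radical R" for r a
    using that max(4) by (auto simp: jacobson_radical_def)
qed

text \<open>\<open>t\<close> is the projection of \<open>R\<close> onto its top followed by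
  \<open>i\<close>. It lets elements of \<open>R\<close> stand for cosets of the radical; the last
  clause is the essentiality of \<open>i\<close>.\<close>

lemma top_map:
  obtains t where "lin_on R (self_module R) J (carrier R) t"
    "\<And>a. a \<in> carrier R \<Longrightarrow> t a = \<zero>\<^bsub>J\<^esub> \<longleftrightarrow> a \<in> jacobson_radical R"
    "\<And>H. submodule H R J \<Longrightarrow> H \<noteq> {\<zero>\<^bsub>J\<^esub>} \<Longrightarrow> \<exists>a\<in>carrier R. t a \<in> H \<and> t a \<noteq> \<zero>\<^bsub>J\<^esub>"
proof -
  let ?N = "jacobson_radical R" and ?T = "top_module R"
  interpret N: ideal ?N R by (rule jacobson_radical_ideal)
  have i: "i \<in> mod_hom R ?T J" "inj_on i (carrier ?T)"
    "\<And>H. submodule H R J \<Longrightarrow> H \<inter> i ` carrier ?T = {\<zero>\<^bsub>J\<^esub>} \<Longrightarrow> H = {\<zero>\<^bsub>J\<^esub>}"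
    using envelope by (auto simp: injective_envelope_def)
  have carr: "carrier ?T = (\<lambda>a. ?N +> a) ` carrier R"
    by (auto simp: top_module_def algebra_module_def FactRing_def A_RCOSETS_def' a_r_coset_def')
  have add: "(?N +> a) \<oplus>\<^bsub>?T\<^esub> (?N +> b) = ?N +> (a \<oplus> b)"
    and smult: "a \<odot>\<^bsub>?T\<^esub> (?N +> b) = ?N +> (a \<otimes> b)"
    if "a \<in> carrier R" "b \<in> carrier R" for a b
    using that by (simp_all add: top_module_def algebra_module_def FactRing_def N.a_rcos_sum
        N.rcoset_mult_add)
  define t where "t a = i (?N +> a)" for a
  have lin: "lin_on R (self_module R) J (carrier R) t"
    using i(1) carr unfolding lin_on_def mod_hom_def t_def
    by (auto simp flip: add smult)
  interpret S: module R "self_module R" by (rule self_module[OF is_cring])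
  have t0: "t \<zero> = \<zero>\<^bsub>J\<^esub>"
    using S.submodule_lin(1)[OF S.carrier_is_submodule _ module_axioms] lin by simp
  have ker: "t a = \<zero>\<^bsub>J\<^esub> \<longleftrightarrow> a \<in> ?N" if a: "a \<in> carrier R" for a
  proof -
    have "t a = \<zero>\<^bsub>J\<^esub> \<longleftrightarrow> ?N +> a = ?N +> \<zero>"
      using inj_on_eq_iff[OF i(2), of "?N +> a" "?N +> \<zero>"] a carr t0 by (auto simp: t_def)
    also have "\<dots> \<longleftrightarrow> a \<in> ?N"
      using quotient_eq_iff_same_a_r_cos[OF N.is_ideal a R.zero_closed] a by (simp add: a_minus_def)
    finally show ?thesis .
  qed
  have "\<exists>a\<in>carrier R. t a \<in> H \<and> t a \<noteq> \<zero>\<^bsub>J\<^esub>" if H: "submodule H R J" "H \<noteq> {\<zero>\<^bsub>J\<^esub>}" for H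
  proof (rule ccontr)
    assume "\<not> ?thesis"
    then have "H \<inter> i ` carrier ?T \<subseteq> {\<zero>\<^bsub>J\<^esub>}" unfolding carr by (auto simp: t_def)
    moreover have "\<zero>\<^bsub>J\<^esub> \<in> H" using submoduleD(2)[OF H(1)] .
    moreover have "t \<zero> \<in> i ` carrier ?T" unfolding carr t_def by blast
    then have "\<zero>\<^bsub>J\<^esub> \<in> i ` carrier ?T" unfolding t0 .
    ultimately have "H \<inter> i ` carrier ?T = {\<zero>\<^bsub>J\<^esub>}" by blast
    with i(3) H show False by blast
  qed
  with that lin ker show thesis by blast
qed

lemma principal_submodule:
  assumes "z \<in> carrier J"
  shows "submodule {r \<odot>\<^bsub>J\<^esub> z | r. r \<in> carrier R} R J"
proof (rule submodule_if_closed)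
  show "\<zero>\<^bsub>J\<^esub> \<in> {r \<odot>\<^bsub>J\<^esub> z | r. r \<in> carrier R}"
    using assms smult_l_null by (metis (mono_tags, lifting) R.zero_closed mem_Collect_eq)
qed (use assms in \<open>auto simp flip: smult_l_distr smult_assoc1\<close>)

text \<open>
  The \<open>P\<close>-socle of \<open>R / rad R\<close> is spanned by the class of an element \<open>e\<close> which lies in every maximal
  ideal except \<open>P\<close>, and essentiality of \<open>i\<close> leaves no room for more in \<open>J\<close>.
\<close>

lemma socle:
  assumes P: "maximalideal P R"
  obtains s where "s \<in> carrier J" "s \<noteq> \<zero>\<^bsub>J\<^esub>" "\<And>r. r \<in> P \<Longrightarrow> r \<odot>\<^bsub>J\<^esub> s = \<zero>\<^bsub>J\<^esub>"
    "\<And>z. z \<in> carrier J \<Longrightarrow> (\<And>r. r \<in> P \<Longrightarrow> r \<odot>\<^bsub>J\<^esub> z = \<zero>\<^bsub>J\<^esub>) \<Longrightarrow> \<exists>c\<in>carrier R. z = c \<odot>\<^bsub>J\<^esub> s"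
proof -
  obtain t where t: "lin_on R (self_module R) J (carrier R) t"
    and ker: "\<And>a. a \<in> carrier R \<Longrightarrow> t a = \<zero>\<^bsub>J\<^esub> \<longleftrightarrow> a \<in> jacobson_radical R"
    and ess: "\<And>H. submodule H R J \<Longrightarrow> H \<noteq> {\<zero>\<^bsub>J\<^esub>} \<Longrightarrow> \<exists>a\<in>carrier R. t a \<in> H \<and> t a \<noteq> \<zero>\<^bsub>J\<^esub>"
    using top_map by metis
  have tD: "\<And>a. a \<in> carrier R \<Longrightarrow> t a \<in> carrier J"
    "\<And>a b. a \<in> carrier R \<Longrightarrow> b \<in> carrier R \<Longrightarrow> t (a \<otimes> b) = a \<odot>\<^bsub>J\<^esub> t b"
    using t unfolding lin_on_def by simp_all
  have tminus: "t (a \<ominus> b) = t a \<ominus>\<^bsub>J\<^esub> t b" if "a \<in> carrier R" "b \<in> carrier R" for a b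
  proof -
    have "a \<ominus> b = a \<oplus> (\<ominus> \<one>) \<otimes> b" using that by (simp add: a_minus_def l_minus)
    also have "t \<dots> = t a \<oplus>\<^bsub>J\<^esub> t ((\<ominus> \<one>) \<otimes> b)"
      using t that by (simp add: lin_on_def)
    also have "\<dots> = t a \<ominus>\<^bsub>J\<^esub> t b"
      using that tD by (simp add: smult_l_minus a_minus_def)
    finally show ?thesis .
  qed
  have prime: "\<And>Q a b. maximalideal Q R \<Longrightarrow> a \<in> carrier R \<Longrightarrow> b \<in> carrier R \<Longrightarrow> a \<otimes> b \<in> Q \<Longrightarrow> a \<in> Q \<or> b \<in> Q"
    using primeideal.I_prime[OF maximalideal_prime] by blast
  have maxid: "\<And>Q. maximalideal Q R \<Longrightarrow> ideal Q R" by (rule maximalideal.axioms(1))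
  have incomp: "\<exists>x\<in>Q. x \<notin> Q'" if "maximalideal Q R" "maximalideal Q' R" "Q \<noteq> Q'" for Q Q'
    using maximalideal.I_maximal[OF that(1) maxid[OF that(2)]] that idealD(1)[OF maxid[OF that(2)]]
      maximalideal.I_notcarr[OF that(2)] by blast
  \<comment> \<open>The element \<open>e\<close> should lie in all maximal ideals but
    \<open>P\<close>. A minimal \<open>E\<close> handles all of them at once, without first showing
    that there are finitely many.\<close>
  have "carrier R \<in> {I. ideal I R \<and> \<not> I \<subseteq> P}"
    using oneideal maximalideal.I_notcarr[OF P] idealD(1)[OF maxid[OF P]] by auto
  then obtain E where E: "E \<in> {I. ideal I R \<and> \<not> I \<subseteq> P}"
    "\<And>K. K \<in> {I. ideal I R \<and> \<not> I \<subseteq> P} \<Longrightarrow> K \<subseteq> E \<Longrightarrow> K = E"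
    using artinian_minimal_ideal[OF artinian, of _ "{I. ideal I R \<and> \<not> I \<subseteq> P}"] by (metis (no_types, lifting) mem_Collect_eq)
  from E(1) obtain e where e: "e \<in> E" "e \<notin> P" "e \<in> carrier R" using idealD(1) by blast
  \<comment> \<open>\<open>E \<inter> Q\<close> contains \<open>x \<otimes> e\<close>, which avoids
    the prime ideal \<open>P\<close>; by minimality it equals \<open>E\<close>.\<close>
  have eQ: "e \<in> Q" if Q: "maximalideal Q R" "Q \<noteq> P" for Q
  proof -
    obtain x where x: "x \<in> Q" "x \<notin> P" using incomp[OF Q(1) P Q(2)] by blast
    have id: "ideal (E \<inter> Q) R" using i_intersect E(1) maxid[OF Q(1)] by blast
    have "x \<in> carrier R" using x idealD(1)[OF maxid[OF Q(1)]] by blast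
    then have "x \<otimes> e \<in> E \<inter> Q" "x \<otimes> e \<notin> P"
      using x e prime[OF P, of x e] idealD(4) idealD(6)[OF maxid[OF Q(1)]] E(1) by auto
    then have "E \<inter> Q = E" using E(2)[of "E \<inter> Q"] id by blast
    then show ?thesis using e by blast
  qed
  have rad: "a \<in> jacobson_radical R" if "a \<in> P" "\<And>Q. maximalideal Q R \<Longrightarrow> Q \<noteq> P \<Longrightarrow> a \<in> Q" for a
    using that idealD(1)[OF maxid[OF P]] by (auto simp: jacobson_radical_def)
  have radD: "a \<in> Q" if "a \<in> jacobson_radical R" "maximalideal Q R" for a Q
    using that by (auto simp: jacobson_radical_def)
  show thesis
  proof (rule that)
    show "t e \<in> carrier J" "t e \<noteq> \<zero>\<^bsub>J\<^esub>" using e tD ker radD P by auto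
    show "r \<odot>\<^bsub>J\<^esub> t e = \<zero>\<^bsub>J\<^esub>" if r: "r \<in> P" for r
    proof -
      have rR: "r \<in> carrier R" using r idealD(1)[OF maxid[OF P]] by blast
      have "r \<otimes> e \<in> jacobson_radical R"
        using rad r rR e eQ idealD(4,6)[OF maxid] P by auto
      then show ?thesis using ker[of "r \<otimes> e"] tD(2) e rR by simp
    qed
    show "\<exists>c\<in>carrier R. z = c \<odot>\<^bsub>J\<^esub> t e"
      if z: "z \<in> carrier J" "\<And>r. r \<in> P \<Longrightarrow> r \<odot>\<^bsub>J\<^esub> z = \<zero>\<^bsub>J\<^esub>" for z
    proof (cases "z = \<zero>\<^bsub>J\<^esub>")
      case True
      then show ?thesis using tD(1)[OF e(3)] by (intro bexI[of _ \<zero>]) simp_all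
    next
      case False
      \<comment> \<open>By essentiality \<open>R z\<close> meets the image of \<open>t\<close> in
        some \<open>r z \<noteq> 0\<close>. Then \<open>r\<close> is invertible modulo
        \<open>P\<close>, and \<open>P\<close> kills \<open>z\<close>, so \<open>z\<close> itself
        lies in the image of \<open>t\<close>.\<close>
      let ?H = "{r \<odot>\<^bsub>J\<^esub> z | r. r \<in> carrier R}"
      have "z \<in> ?H" using smult_one[OF z(1)] one_closed by (metis (mono_tags, lifting) mem_Collect_eq)
      then have "?H \<noteq> {\<zero>\<^bsub>J\<^esub>}" using False by blast
      then obtain a r where ar: "a \<in> carrier R" "r \<in> carrier R" "t a = r \<odot>\<^bsub>J\<^esub> z" "t a \<noteq> \<zero>\<^bsub>J\<^esub>"
        using ess[OF principal_submodule[OF z(1)]] by blast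
      then have "r \<notin> P" using z(2) by auto
      then obtain q where q: "q \<in> carrier R" "\<one> \<ominus> q \<otimes> r \<in> P"
        using maximalideal_inverse[OF P ar(2)] by blast
      have "z \<ominus>\<^bsub>J\<^esub> q \<odot>\<^bsub>J\<^esub> (r \<odot>\<^bsub>J\<^esub> z) = \<zero>\<^bsub>J\<^esub>"
        using z(2)[OF q(2)] z(1) q(1) ar(2) by (simp add: smult_minus_left smult_assoc1)
      then have "z = q \<odot>\<^bsub>J\<^esub> (r \<odot>\<^bsub>J\<^esub> z)"
        using minus_eq_zero_imp_eq[OF z(1)] q(1) ar(2) z(1) by simp
      then have zb: "z = t (q \<otimes> a)" using tD(2) q ar by simp
      define b where "b = q \<otimes> a"
      have b: "b \<in> carrier R" "z = t b" using q ar zb by (simp_all add: b_def)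
      \<comment> \<open>\<open>x\<close> kills \<open>z = t b\<close>, so
        \<open>x \<otimes> b\<close> lies in the radical and hence in the prime ideal
        \<open>Q\<close>, while \<open>x\<close> does not.\<close>
      have bQ: "b \<in> Q" if Q: "maximalideal Q R" "Q \<noteq> P" for Q
      proof -
        obtain x where x: "x \<in> P" "x \<notin> Q" using incomp[OF P Q(1)] Q(2) by blast
        have xR: "x \<in> carrier R" using x idealD(1)[OF maxid[OF P]] by blast
        have "x \<otimes> b \<in> jacobson_radical R" using ker[of "x \<otimes> b"] tD(2)[OF xR b(1)] z(2)[OF x(1)] b xR by simp
        then show ?thesis using radD[OF _ Q(1)] prime[OF Q(1) xR b(1)] x by blast
      qed
      obtain q' where q': "q' \<in> carrier R" "\<one> \<ominus> q' \<otimes> e \<in> P"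
        using maximalideal_inverse[OF P e(3,2)] by blast
      \<comment> \<open>\<open>b\<close> and \<open>b q' e\<close> agree modulo \<open>P\<close>,
        where \<open>q'\<close> inverts \<open>e\<close>, and modulo every other \<open>Q\<close>,
        which contains both \<open>b\<close> and \<open>e\<close>. So they agree modulo the radical,
        which is the kernel of \<open>t\<close>.\<close>
      have "b \<otimes> (\<one> \<ominus> q' \<otimes> e) = b \<ominus> (b \<otimes> q') \<otimes> e"
        using b e q' by (simp add: a_minus_def r_distr r_minus m_assoc)
      then have "b \<ominus> (b \<otimes> q') \<otimes> e \<in> P"
        using idealD(4)[OF maxid[OF P] b(1) q'(2)] by simp
      moreover have "b \<ominus> (b \<otimes> q') \<otimes> e \<in> Q" if Q: "maximalideal Q R" "Q \<noteq> P" for Q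
        using idealD(5)[OF maxid[OF Q(1)] bQ[OF Q]] idealD(4)[OF maxid[OF Q(1)] _ eQ[OF Q]] b q' by blast
      ultimately have "b \<ominus> (b \<otimes> q') \<otimes> e \<in> jacobson_radical R" by (rule rad)
      then have "t (b \<ominus> (b \<otimes> q') \<otimes> e) = \<zero>\<^bsub>J\<^esub>" using ker b e q' by simp
      then have "z \<ominus>\<^bsub>J\<^esub> (b \<otimes> q') \<odot>\<^bsub>J\<^esub> t e = \<zero>\<^bsub>J\<^esub>" using tminus tD b e q' by simp
      then have "z = (b \<otimes> q') \<odot>\<^bsub>J\<^esub> t e"
        using minus_eq_zero_imp_eq[OF z(1)] b e q' tD by simp
      then show ?thesis using b q' by blast
    qed
  qed
qed

end

lemma submodule_ideal:
  assumes "cring R" "submodule I R (self_module R)"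
  shows "ideal I R"
proof -
  interpret cring R by fact
  interpret S: module R "self_module R" by (rule self_module) fact
  show ?thesis using S.submoduleD[OF assms(2)] by (intro ideal_if_closed[OF is_cring]) auto
qed

text \<open>Sending \<open>x\<close> to \<open>z\<close> is consistent once every relation that
  places a multiple of \<open>x\<close> in \<open>X\<close> is respected. By \<open>compat\<close>
  the value at \<open>y + r x\<close> is independent of the representation, so \<open>f'\<close> may
  choose one.\<close>

lemma (in module) extend_by_element:
  assumes N: "module R N" and X: "submodule X R M" and f: "lin_on R M N X f"
    and x: "x \<in> carrier M" and z: "z \<in> carrier N"
    and compat: "\<And>r. r \<in> carrier R \<Longrightarrow> r \<odot>\<^bsub>M\<^esub> x \<in> X \<Longrightarrow> f (r \<odot>\<^bsub>M\<^esub> x) = r \<odot>\<^bsub>N\<^esub> z"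
  obtains X' f' where "submodule X' R M" "X \<subseteq> X'" "x \<in> X'" "lin_on R M N X' f'"
    "\<And>y. y \<in> X \<Longrightarrow> f' y = f y" "f' x = z"
proof -
  interpret N: module R N by fact
  note XD = submoduleD[OF X] and fD = lin_onD[OF f]
  have XM: "y \<in> carrier M" if "y \<in> X" for y using XD(1) that by blast
  define X' where "X' = {y \<oplus>\<^bsub>M\<^esub> r \<odot>\<^bsub>M\<^esub> x | y r. y \<in> X \<and> r \<in> carrier R}"
  have "\<forall>w\<in>X'. \<exists>y r. y \<in> X \<and> r \<in> carrier R \<and> w = y \<oplus>\<^bsub>M\<^esub> r \<odot>\<^bsub>M\<^esub> x"
    unfolding X'_def by blast
  then obtain yy rr where yr: "\<And>w. w \<in> X' \<Longrightarrow> yy w \<in> X \<and> rr w \<in> carrier R \<and> w = yy w \<oplus>\<^bsub>M\<^esub> rr w \<odot>\<^bsub>M\<^esub> x"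
    by metis
  define f' where "f' w = f (yy w) \<oplus>\<^bsub>N\<^esub> rr w \<odot>\<^bsub>N\<^esub> z" for w
  have f': "f' (y \<oplus>\<^bsub>M\<^esub> r \<odot>\<^bsub>M\<^esub> x) = f y \<oplus>\<^bsub>N\<^esub> r \<odot>\<^bsub>N\<^esub> z" if y: "y \<in> X" and r: "r \<in> carrier R" for y r
  proof -
    define w where "w = y \<oplus>\<^bsub>M\<^esub> r \<odot>\<^bsub>M\<^esub> x"
    have "w \<in> X'" using y r by (auto simp: X'_def w_def)
    then obtain y' r' where yr': "yy w = y'" "rr w = r'" "y' \<in> X" "r' \<in> carrier R"
      "w = y' \<oplus>\<^bsub>M\<^esub> r' \<odot>\<^bsub>M\<^esub> x" using yr by blast
    have "r \<odot>\<^bsub>M\<^esub> x = w \<ominus>\<^bsub>M\<^esub> y"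
      using y r x XM unfolding w_def
      by (simp add: a_minus_def M.a_comm[of y] M.a_assoc M.r_neg)
    also have "\<dots> = (y' \<ominus>\<^bsub>M\<^esub> y) \<oplus>\<^bsub>M\<^esub> r' \<odot>\<^bsub>M\<^esub> x"
      using yr' y r x XM by (simp add: a_minus_def M.a_ac)
    finally have eq: "r \<odot>\<^bsub>M\<^esub> x = (y' \<ominus>\<^bsub>M\<^esub> y) \<oplus>\<^bsub>M\<^esub> r' \<odot>\<^bsub>M\<^esub> x" .
    have d: "y' \<ominus>\<^bsub>M\<^esub> y \<in> X" using XD(5) y yr' by blast
    \<comment> \<open>Two representations of \<open>w\<close> differ by a multiple of
      \<open>x\<close> that lies in \<open>X\<close>, which is the case covered by
      \<open>compat\<close>.\<close>
    have "(r \<ominus> r') \<odot>\<^bsub>M\<^esub> x = y' \<ominus>\<^bsub>M\<^esub> y"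
      using yr' r x eq XM[OF d] by (simp add: smult_minus_left) (simp add: a_minus_def M.a_assoc M.r_neg)
    then have "f (y' \<ominus>\<^bsub>M\<^esub> y) = (r \<ominus> r') \<odot>\<^bsub>N\<^esub> z"
      using compat[of "r \<ominus> r'"] d r yr' by simp
    then have "f y' \<ominus>\<^bsub>N\<^esub> f y = r \<odot>\<^bsub>N\<^esub> z \<ominus>\<^bsub>N\<^esub> r' \<odot>\<^bsub>N\<^esub> z"
      using submodule_lin(2)[OF X f N, of y' y] yr' y r z by (simp add: N.smult_minus_left)
    then have "f y' = f y \<oplus>\<^bsub>N\<^esub> (r \<odot>\<^bsub>N\<^esub> z \<ominus>\<^bsub>N\<^esub> r' \<odot>\<^bsub>N\<^esub> z)"
      using N.eq_add_minus[of "f y'" "f y"] fD(1) yr' y by simp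
    then have "f y' \<oplus>\<^bsub>N\<^esub> r' \<odot>\<^bsub>N\<^esub> z = f y \<oplus>\<^bsub>N\<^esub> r \<odot>\<^bsub>N\<^esub> z"
      using fD(1)[OF y] r yr' z by (simp add: a_minus_def N.M.a_assoc N.M.l_neg)
    then show ?thesis using yr' by (simp add: f'_def w_def)
  qed
  have add: "(y \<oplus>\<^bsub>M\<^esub> r \<odot>\<^bsub>M\<^esub> x) \<oplus>\<^bsub>M\<^esub> (y' \<oplus>\<^bsub>M\<^esub> r' \<odot>\<^bsub>M\<^esub> x) = (y \<oplus>\<^bsub>M\<^esub> y') \<oplus>\<^bsub>M\<^esub> (r \<oplus> r') \<odot>\<^bsub>M\<^esub> x"
    and smult: "r' \<odot>\<^bsub>M\<^esub> (y \<oplus>\<^bsub>M\<^esub> r \<odot>\<^bsub>M\<^esub> x) = r' \<odot>\<^bsub>M\<^esub> y \<oplus>\<^bsub>M\<^esub> (r' \<otimes> r) \<odot>\<^bsub>M\<^esub> x"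
    if "y \<in> X" "y' \<in> X" "r \<in> carrier R" "r' \<in> carrier R" for y y' r r'
    using that x XM by (simp_all add: smult_l_distr smult_r_distr smult_assoc1 M.a_ac)
  have mem: "y \<oplus>\<^bsub>M\<^esub> r \<odot>\<^bsub>M\<^esub> x \<in> X'" if "y \<in> X" "r \<in> carrier R" for y r
    using that by (auto simp: X'_def)
  have elim: "\<exists>y\<in>X. \<exists>r\<in>carrier R. w = y \<oplus>\<^bsub>M\<^esub> r \<odot>\<^bsub>M\<^esub> x" if "w \<in> X'" for w
    using that by (auto simp: X'_def)
  have inc: "y \<in> X'" "f' y = f y" if y: "y \<in> X" for y
  proof -
    have "y = y \<oplus>\<^bsub>M\<^esub> \<zero> \<odot>\<^bsub>M\<^esub> x" using x XM[OF y] by simp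
    then show "y \<in> X'" "f' y = f y"
      using mem[OF y R.zero_closed] f'[OF y R.zero_closed] fD(1)[OF y] z by simp_all
  qed
  have xz: "x \<in> X'" "f' x = z"
  proof -
    have "x = \<zero>\<^bsub>M\<^esub> \<oplus>\<^bsub>M\<^esub> \<one> \<odot>\<^bsub>M\<^esub> x" using x by simp
    then show "x \<in> X'" "f' x = z"
      using mem[OF XD(2) R.one_closed] f'[OF XD(2) R.one_closed] submodule_lin(1)[OF X f N] z
      by simp_all
  qed
  have "submodule X' R M"
  proof (rule submodule_if_closed)
    show "X' \<subseteq> carrier M" using XM x by (auto simp: X'_def)
    show "\<zero>\<^bsub>M\<^esub> \<in> X'" using inc(1) XD(2) by blast
    show "a \<oplus>\<^bsub>M\<^esub> b \<in> X'" if "a \<in> X'" "b \<in> X'" for a b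
      using elim[OF that(1)] elim[OF that(2)] add mem XD(3) R.a_closed by metis
    show "r \<odot>\<^bsub>M\<^esub> a \<in> X'" if "r \<in> carrier R" "a \<in> X'" for r a
      using elim[OF that(2)] smult mem XD(4) R.m_closed that(1) by metis
  qed
  moreover have "lin_on R M N X' f'"
    unfolding lin_on_def
  proof (intro conjI ballI)
    show "f' w \<in> carrier N" if "w \<in> X'" for w
      using elim[OF that] f' fD(1) z by auto
    show "f' (w \<oplus>\<^bsub>M\<^esub> w') = f' w \<oplus>\<^bsub>N\<^esub> f' w'" if "w \<in> X'" "w' \<in> X'" for w w'
    proof -
      obtain y r y' r' where "y \<in> X" "r \<in> carrier R" "w = y \<oplus>\<^bsub>M\<^esub> r \<odot>\<^bsub>M\<^esub> x"
        "y' \<in> X" "r' \<in> carrier R" "w' = y' \<oplus>\<^bsub>M\<^esub> r' \<odot>\<^bsub>M\<^esub> x" using elim \<open>w \<in> X'\<close> \<open>w' \<in> X'\<close> by metis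
      then show ?thesis using fD z XD(3)[of y y']
        by (simp add: add f' N.smult_l_distr N.M.a_ac)
    qed
    show "f' (r' \<odot>\<^bsub>M\<^esub> w) = r' \<odot>\<^bsub>N\<^esub> f' w" if "r' \<in> carrier R" "w \<in> X'" for r' w
    proof -
      obtain y r where "y \<in> X" "r \<in> carrier R" "w = y \<oplus>\<^bsub>M\<^esub> r \<odot>\<^bsub>M\<^esub> x" using elim \<open>w \<in> X'\<close> by metis
      then show ?thesis using fD z XD(4)[of r' y] \<open>r' \<in> carrier R\<close>
        by (simp add: smult f' N.smult_r_distr N.smult_assoc1)
    qed
  qed
  ultimately show thesis using that inc xz by blast
qed

section \<open>Descent through the ideals of \<open>R\<close>\<close>

context artin_envelope
begin

text \<open>A copy of the dual of \<open>R/I\<close> inside \<open>J\<close>, since a functional on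
  \<open>R/I\<close> is fixed by its value at the class of \<open>\<one>\<close>. As
  \<open>I\<close> shrinks from \<open>R\<close> to zero, it grows from zero to
  \<open>J\<close>.\<close>

definition annihilated :: "'r set \<Rightarrow> 'e set"
  where "annihilated I = {z \<in> carrier J. \<forall>r\<in>I. r \<odot>\<^bsub>J\<^esub> z = \<zero>\<^bsub>J\<^esub>}"

text \<open>
  If \<open>P I = I\<close> for all \<open>P\<close>, then an ideal \<open>K\<close> minimal with \<open>K I \<noteq> 0\<close> is generated by an element \<open>k\<close> with
  \<open>P k = R k\<close> for all \<open>P\<close>, and Nakayama's argument gives \<open>k = 0\<close>.
\<close>

lemma maximalideal_product_neq:
  assumes I: "ideal I R" "I \<noteq> {\<zero>}"
  obtains P where "maximalideal P R" "Idl {p \<otimes> y | p y. p \<in> P \<and> y \<in> I} \<noteq> I"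
proof (rule ccontr)
  assume "\<not> thesis"
  then have PI: "Idl {p \<otimes> y | p y. p \<in> P \<and> y \<in> I} = I" if "maximalideal P R" for P
    using that \<open>\<not> thesis\<close> \<open>(\<And>P. maximalideal P R \<Longrightarrow> Idl {p \<otimes> y |p y. p \<in> P \<and> y \<in> I} \<noteq> I \<Longrightarrow> thesis)\<close> by blast
  note ID = idealD[OF I(1)]
  let ?F = "{K. ideal K R \<and> (\<exists>k\<in>K. \<exists>y\<in>I. k \<otimes> y \<noteq> \<zero>)}"
  obtain y where y: "y \<in> I" "y \<noteq> \<zero>" using I(2) ID(2) by blast
  then have "\<one> \<otimes> y \<noteq> \<zero>" using ID(1) by auto
  then have "carrier R \<in> ?F" using oneideal y by blast
  then obtain K where K: "K \<in> ?F" "\<And>L. L \<in> ?F \<Longrightarrow> L \<subseteq> K \<Longrightarrow> L = K"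
    using artinian_minimal_ideal[OF artinian, of _ ?F] by (metis (mono_tags, lifting) mem_Collect_eq)
  then obtain k y where ky: "k \<in> K" "y \<in> I" "k \<otimes> y \<noteq> \<zero>" "ideal K R" by blast
  have kR: "k \<in> carrier R" using ky idealD(1) by blast
  have k: "k \<in> PIdl k" "PIdl k \<subseteq> K"
    using cgenideal_self[OF kR] cgenideal_minimal[OF ky(4,1)] by auto
  then have Kk: "PIdl k = K" using K(2)[of "PIdl k"] ky cgenideal_ideal[OF kR] by blast
  have yR: "y \<in> carrier R" using ky ID(1) by blast
  \<comment> \<open>\<open>P\<close> is taken above the annihilator of \<open>k\<close>, so that an
    equation \<open>p k = k\<close> with \<open>p \<in> P\<close> will force
    \<open>\<one> \<ominus> p \<in> P\<close>.\<close>
  have ann: "ideal {r \<in> carrier R. r \<otimes> k = \<zero>} R" (is "ideal ?A R")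
    using kR by (intro ideal_if_closed[OF is_cring]) (auto simp: l_distr m_assoc)
  have "\<one> \<otimes> k \<noteq> \<zero>" using ky kR yR by auto
  then have "?A \<noteq> carrier R" using one_closed by blast
  then obtain P where P: "maximalideal P R" "?A \<subseteq> P" using ex_maximalideal[OF ann] by blast
  note PD = idealD[OF maximalideal.axioms(1)[OF P(1)]]
  have PR: "p \<in> carrier R" if "p \<in> P" for p using PD(1) that by blast
  let ?L = "{p \<otimes> k | p. p \<in> P}"
  have L: "ideal ?L R"
  proof (rule ideal_if_closed[OF is_cring])
    show "?L \<subseteq> carrier R" using kR PR by auto
    show "\<zero> \<in> ?L" using PD(2) kR by (metis (mono_tags, lifting) l_null mem_Collect_eq)
    show "a \<oplus> b \<in> ?L" if "a \<in> ?L" "b \<in> ?L" for a b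
    proof -
      from that obtain p q where pq: "p \<in> P" "q \<in> P" "a = p \<otimes> k" "b = q \<otimes> k" by blast
      then have "a \<oplus> b = (p \<oplus> q) \<otimes> k" using kR PR by (simp add: l_distr)
      then show ?thesis using PD(3)[of p q] pq by blast
    qed
    show "r \<otimes> a \<in> ?L" if "r \<in> carrier R" "a \<in> ?L" for r a
    proof -
      from that obtain p where p: "p \<in> P" "a = p \<otimes> k" by blast
      then have "r \<otimes> a = (r \<otimes> p) \<otimes> k" using kR PR that by (simp add: m_assoc)
      then show ?thesis using PD(4)[of r p] p that by blast
    qed
  qed
  \<comment> \<open>Otherwise \<open>k\<close> kills all products of \<open>P\<close> with
    \<open>I\<close>. By assumption these generate \<open>I\<close>, so \<open>k\<close> kills
    \<open>I\<close>, against \<open>k y \<noteq> 0\<close>.\<close>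
  have "\<exists>p\<in>P. \<exists>y'\<in>I. (p \<otimes> k) \<otimes> y' \<noteq> \<zero>"
  proof (rule ccontr)
    assume none: "\<not> ?thesis"
    let ?Y = "{y' \<in> carrier R. k \<otimes> y' = \<zero>}"
    have IR: "y \<in> carrier R" if "y \<in> I" for y using ID(1) that by blast
    have Y: "ideal ?Y R"
      using kR by (intro ideal_if_closed[OF is_cring]) (auto simp: r_distr m_lcomm[of k])
    have "k \<otimes> (p \<otimes> y') = \<zero>" if "p \<in> P" "y' \<in> I" for p y'
    proof -
      have "k \<otimes> (p \<otimes> y') = (p \<otimes> k) \<otimes> y'" using that kR PR IR by (simp add: m_ac)
      then show ?thesis using none that by simp
    qed
    then have "{p \<otimes> y | p y. p \<in> P \<and> y \<in> I} \<subseteq> ?Y" using PR IR by auto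
    then have "Idl {p \<otimes> y | p y. p \<in> P \<and> y \<in> I} \<subseteq> ?Y" by (rule genideal_minimal[OF Y])
    then have "I \<subseteq> ?Y" using PI[OF P(1)] by simp
    then show False using ky by blast
  qed
  then have "?L \<in> ?F" using L by blast
  moreover have "?L \<subseteq> K" using Kk PR by (auto simp: cgenideal_def)
  ultimately have "k \<in> ?L" using K(2) ky(1) by blast
  then obtain p where p: "p \<in> P" "k = p \<otimes> k" by blast
  have "(\<one> \<ominus> p) \<otimes> k = \<zero>"
  proof -
    have "(\<one> \<ominus> p) \<otimes> k = k \<ominus> p \<otimes> k" using kR PR[OF p(1)] by (simp add: a_minus_def l_distr l_minus)
    also have "\<dots> = \<zero>" using p(2) kR by (simp add: a_minus_def R.r_neg)
    finally show ?thesis .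
  qed
  then have "\<one> \<ominus> p \<in> P" using P(2) PR[OF p(1)] by auto
  then have "(\<one> \<ominus> p) \<oplus> p \<in> P" using PD(3) p(1) by blast
  moreover have "(\<one> \<ominus> p) \<oplus> p = \<one>" using PR[OF p(1)] by (simp add: a_minus_def R.a_assoc R.l_neg)
  ultimately show False
    using ideal.one_imp_carrier[OF maximalideal.axioms(1)[OF P(1)]] maximalideal.I_notcarr[OF P(1)] by auto
qed

text \<open>\<open>H\<close> is the kernel of a \<open>J\<close>-valued functional on \<open>I\<close> which vanishes on \<open>P I\<close> but not at \<open>x\<close>.\<close>

lemma ideal_simple_step:
  assumes I: "ideal I R" "I \<noteq> {\<zero>}"
  obtains H x P where "ideal H R" "H \<subseteq> I" "maximalideal P R" "x \<in> I" "x \<notin> H"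
    "\<And>r. r \<in> P \<Longrightarrow> r \<otimes> x \<in> H" "\<And>y. y \<in> I \<Longrightarrow> \<exists>c\<in>carrier R. y \<ominus> c \<otimes> x \<in> H"
proof -
  note ID = idealD[OF I(1)]
  obtain P where P: "maximalideal P R" and K_neq: "Idl {p \<otimes> y | p y. p \<in> P \<and> y \<in> I} \<noteq> I"
    by (rule maximalideal_product_neq[OF I]) (rule that)
  note PD = idealD[OF maximalideal.axioms(1)[OF P(1)]]
  define K where "K = Idl {p \<otimes> y | p y. p \<in> P \<and> y \<in> I}"
  have sub: "{p \<otimes> y | p y. p \<in> P \<and> y \<in> I} \<subseteq> I"
    using ID(4) PD(1) by (auto simp: subset_iff)
  then have subR: "{p \<otimes> y | p y. p \<in> P \<and> y \<in> I} \<subseteq> carrier R" using ID(1) by blast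
  have K: "ideal K R" "K \<subseteq> I" "K \<noteq> I"
    using genideal_ideal[OF subR] genideal_minimal[OF I(1) sub] K_neq by (simp_all add: K_def)
  have PK: "p \<otimes> y \<in> K" if "p \<in> P" "y \<in> I" for p y
    using genideal_self[OF subR] that by (auto simp: K_def)
  note KD = idealD[OF K(1)]
  obtain x where x: "x \<in> I" "x \<notin> K" using K by blast
  have xR: "x \<in> carrier R" using x ID(1) by blast
  obtain s where s: "s \<in> carrier J" "s \<noteq> \<zero>\<^bsub>J\<^esub>" "\<And>r. r \<in> P \<Longrightarrow> r \<odot>\<^bsub>J\<^esub> s = \<zero>\<^bsub>J\<^esub>"
    "\<And>z. z \<in> carrier J \<Longrightarrow> (\<And>r. r \<in> P \<Longrightarrow> r \<odot>\<^bsub>J\<^esub> z = \<zero>\<^bsub>J\<^esub>) \<Longrightarrow> \<exists>c\<in>carrier R. z = c \<odot>\<^bsub>J\<^esub> s"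
    using socle[OF P] by metis
  interpret S: module R "self_module R" by (rule self_module[OF is_cring])
  \<comment> \<open>If \<open>r\<close> were invertible modulo \<open>P\<close>, then
    \<open>r x \<in> K\<close> and \<open>P x \<subseteq> K\<close> would give
    \<open>x \<in> K\<close>. This makes \<open>x \<mapsto> s\<close> compatible with zero on
    \<open>K\<close>.\<close>
  have rP: "r \<in> P" if r: "r \<in> carrier R" "r \<otimes> x \<in> K" for r
  proof (rule ccontr)
    assume "r \<notin> P"
    then obtain q where q: "q \<in> carrier R" "\<one> \<ominus> q \<otimes> r \<in> P"
      using maximalideal_inverse[OF P r(1)] by blast
    have "(\<one> \<ominus> q \<otimes> r) \<otimes> x \<oplus> q \<otimes> (r \<otimes> x) \<in> K"
      by (rule KD(3)[OF PK[OF q(2) x(1)] KD(4)[OF q(1) r(2)]])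
    moreover have "(\<one> \<ominus> q \<otimes> r) \<otimes> x \<oplus> q \<otimes> (r \<otimes> x) = x"
      using q(1) r xR by (simp add: a_minus_def l_distr l_minus m_assoc R.a_assoc R.l_neg)
    ultimately show False using x by simp
  qed
  have lin: "lin_on R (self_module R) J K (\<lambda>_. \<zero>\<^bsub>J\<^esub>)" by (simp add: lin_on_def)
  obtain X f where X: "submodule X R (self_module R)" "K \<subseteq> X" "x \<in> X"
    and f: "lin_on R (self_module R) J X f" "\<And>y. y \<in> K \<Longrightarrow> f y = \<zero>\<^bsub>J\<^esub>" "f x = s"
  proof (rule S.extend_by_element[OF module_axioms ideal_submodule[OF is_cring K(1)] lin])
    show "x \<in> carrier (self_module R)" "s \<in> carrier J" using xR s(1) by simp_all
    show "\<zero>\<^bsub>J\<^esub> = r \<odot>\<^bsub>J\<^esub> s" if "r \<in> carrier R" "r \<odot>\<^bsub>self_module R\<^esub> x \<in> K" for r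
      using rP[of r] s(3) that by simp
  qed (use that in blast)
  \<comment> \<open>The functional is only given on \<open>X\<close>, which is not known to contain
    \<open>I\<close>. Written as multiplication by \<open>z\<close> it makes sense on all of
    \<open>R\<close>.\<close>
  obtain z where z: "z \<in> carrier J" "\<And>y. y \<in> X \<Longrightarrow> f y = y \<odot>\<^bsub>J\<^esub> z"
    using baer[OF submodule_ideal[OF is_cring X(1)] f(1)] by blast
  have zK: "y \<odot>\<^bsub>J\<^esub> z = \<zero>\<^bsub>J\<^esub>" if "y \<in> K" for y using z(2) f(2) X(2) that by force
  have zx: "x \<odot>\<^bsub>J\<^esub> z = s" using z(2) f(3) X(3) by simp
  define H where "H = {y \<in> I. y \<odot>\<^bsub>J\<^esub> z = \<zero>\<^bsub>J\<^esub>}"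
  have IR: "y \<in> carrier R" if "y \<in> I" for y using ID(1) that by blast
  show thesis
  proof (rule that)
    show "ideal H R"
      using ID z(1) IR by (intro ideal_if_closed[OF is_cring]) (auto simp: H_def smult_l_distr smult_assoc1)
    show "H \<subseteq> I" "maximalideal P R" "x \<in> I" by (auto simp: H_def P x)
    show "x \<notin> H" using zx s by (simp add: H_def)
    show "r \<otimes> x \<in> H" if "r \<in> P" for r
      using PK[OF that x(1)] zK K(2) by (auto simp: H_def)
    show "\<exists>c\<in>carrier R. y \<ominus> c \<otimes> x \<in> H" if y: "y \<in> I" for y
    proof -
      \<comment> \<open>Since \<open>P I\<close> lies in \<open>K\<close>, the element
        \<open>y z\<close> belongs to the \<open>P\<close>-socle and is a multiple of
        \<open>s = x z\<close>.\<close>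
      have "r \<odot>\<^bsub>J\<^esub> (y \<odot>\<^bsub>J\<^esub> z) = \<zero>\<^bsub>J\<^esub>" if "r \<in> P" for r
        using zK[OF PK[OF that y]] IR[OF y] that PD(1) z(1) by (auto simp: smult_assoc1)
      then obtain c where c: "c \<in> carrier R" "y \<odot>\<^bsub>J\<^esub> z = c \<odot>\<^bsub>J\<^esub> s" using s(4) IR[OF y] z(1) by blast
      have "(y \<ominus> c \<otimes> x) \<odot>\<^bsub>J\<^esub> z = \<zero>\<^bsub>J\<^esub>"
        using c zx IR[OF y] xR z(1) s(1) by (simp add: smult_minus_left smult_assoc1) (simp add: a_minus_def M.r_neg)
      moreover have "y \<ominus> c \<otimes> x \<in> I" using ID(4,5) c(1) x y by blast
      ultimately show ?thesis using c(1) by (auto simp: H_def)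
    qed
  qed
qed

end

lemma (in module) smult_commute:
  "a \<in> carrier R \<Longrightarrow> b \<in> carrier R \<Longrightarrow> x \<in> carrier M \<Longrightarrow> a \<odot>\<^bsub>M\<^esub> (b \<odot>\<^bsub>M\<^esub> x) = b \<odot>\<^bsub>M\<^esub> (a \<odot>\<^bsub>M\<^esub> x)"
  using m_comm[of a b] by (simp flip: smult_assoc1)

lemma (in module) submodule_annihilated:
  assumes "I \<subseteq> carrier R"
  shows "submodule {z \<in> carrier M. \<forall>r\<in>I. r \<odot>\<^bsub>M\<^esub> z = \<zero>\<^bsub>M\<^esub>} R M"
proof (rule submodule_if_closed)
  fix a z assume a: "a \<in> carrier R" and z: "z \<in> {z \<in> carrier M. \<forall>r\<in>I. r \<odot>\<^bsub>M\<^esub> z = \<zero>\<^bsub>M\<^esub>}"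
  have "r \<odot>\<^bsub>M\<^esub> (a \<odot>\<^bsub>M\<^esub> z) = a \<odot>\<^bsub>M\<^esub> (r \<odot>\<^bsub>M\<^esub> z)" if "r \<in> I" for r
    using assms a z that by (intro smult_commute) auto
  then show "a \<odot>\<^bsub>M\<^esub> z \<in> {z \<in> carrier M. \<forall>r\<in>I. r \<odot>\<^bsub>M\<^esub> z = \<zero>\<^bsub>M\<^esub>}" using a z by auto
qed (use assms in \<open>auto simp: smult_r_distr subset_iff\<close>)

lemma (in module) lin_on_smult:
  assumes "W \<subseteq> carrier M" "x \<in> carrier R"
  shows "lin_on R M M W (\<lambda>z. x \<odot>\<^bsub>M\<^esub> z)"
  using assms m_comm unfolding lin_on_def
  by (auto simp: smult_r_distr subset_iff simp flip: smult_assoc1)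

lemma (in module) lin_on_diff:
  assumes f: "lin_on R L M W f" and g: "lin_on R L M W g"
  shows "lin_on R L M W (\<lambda>x. f x \<ominus>\<^bsub>M\<^esub> g x)"
  unfolding lin_on_def
proof (intro conjI ballI)
  note fD = lin_onD[OF f] and gD = lin_onD[OF g]
  show "f x \<ominus>\<^bsub>M\<^esub> g x \<in> carrier M" if "x \<in> W" for x using fD(1) gD(1) that by simp
  show "f (x \<oplus>\<^bsub>L\<^esub> y) \<ominus>\<^bsub>M\<^esub> g (x \<oplus>\<^bsub>L\<^esub> y) = (f x \<ominus>\<^bsub>M\<^esub> g x) \<oplus>\<^bsub>M\<^esub> (f y \<ominus>\<^bsub>M\<^esub> g y)"
    if "x \<in> W" "y \<in> W" for x y
    using fD(1,2) gD(1,2) that by (simp add: a_minus_def M.minus_add M.a_ac)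
  show "f (r \<odot>\<^bsub>L\<^esub> x) \<ominus>\<^bsub>M\<^esub> g (r \<odot>\<^bsub>L\<^esub> x) = r \<odot>\<^bsub>M\<^esub> (f x \<ominus>\<^bsub>M\<^esub> g x)"
    if "r \<in> carrier R" "x \<in> W" for r x
    using fD(1,3) gD(1,3) that by (simp add: smult_minus_right)
qed

lemma fg_sub_finite_generators:
  assumes "finite S" "S \<subseteq> W" "\<And>H. submodule H R N \<Longrightarrow> S \<subseteq> H \<Longrightarrow> W \<subseteq> H"
  shows "fg_sub R N W"
  using assms unfolding fg_sub_def by metis

context artin_envelope
begin

lemma annihilated_zero: "annihilated {\<zero>} = carrier J"
  by (auto simp: annihilated_def)

lemma annihilated_carrier: "annihilated (carrier R) = {\<zero>\<^bsub>J\<^esub>}"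
  unfolding annihilated_def using smult_one one_closed by fastforce

text \<open>The property that propagates from \<open>I = R\<close> down to \<open>I = 0\<close>, where \<open>annihilated I = J\<close>.\<close>

definition scalar_noetherian :: "'r set \<Rightarrow> bool"
  where "scalar_noetherian I \<longleftrightarrow>
    (\<forall>F. lin_on R J J (annihilated I) F \<longrightarrow> (\<exists>r\<in>carrier R. \<forall>z\<in>annihilated I. F z = r \<odot>\<^bsub>J\<^esub> z)) \<and>
    (\<forall>W. submodule W R J \<longrightarrow> W \<subseteq> annihilated I \<longrightarrow> fg_sub R J W)"

text \<open>Multiplication by \<open>x\<close> maps \<open>annihilated H\<close> into the
  \<open>P\<close>-socle \<open>R s\<close>, with kernel \<open>annihilated I\<close>. Thus
  \<open>annihilated H\<close> is an extension of a submodule of a simple module by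
  \<open>annihilated I\<close>, and both halves of the property pass through this extension.\<close>

lemma scalar_noetherian_step:
  assumes I: "ideal I R" and H: "ideal H R" "H \<subseteq> I" and P: "maximalideal P R" and x: "x \<in> I"
    and Px: "\<And>r. r \<in> P \<Longrightarrow> r \<otimes> x \<in> H" and IH: "\<And>y. y \<in> I \<Longrightarrow> \<exists>c\<in>carrier R. y \<ominus> c \<otimes> x \<in> H"
    and sn: "scalar_noetherian I"
  shows "scalar_noetherian H"
proof -
  obtain s where s: "s \<in> carrier J" "s \<noteq> \<zero>\<^bsub>J\<^esub>" "\<And>r. r \<in> P \<Longrightarrow> r \<odot>\<^bsub>J\<^esub> s = \<zero>\<^bsub>J\<^esub>"
    and simple: "\<And>z. z \<in> carrier J \<Longrightarrow> (\<And>r. r \<in> P \<Longrightarrow> r \<odot>\<^bsub>J\<^esub> z = \<zero>\<^bsub>J\<^esub>) \<Longrightarrow> \<exists>c\<in>carrier R. z = c \<odot>\<^bsub>J\<^esub> s"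
    using socle[OF P] by metis
  have PR: "r \<in> carrier R" if "r \<in> P" for r using idealD(1)[OF maximalideal.axioms(1)[OF P]] that by blast
  have xR: "x \<in> carrier R" using x idealD(1)[OF I] by blast
  have HR: "H \<subseteq> carrier R" and IR: "I \<subseteq> carrier R" using idealD(1) H I by auto
  have subH: "submodule (annihilated H) R J" and subI: "submodule (annihilated I) R J"
    unfolding annihilated_def using HR IR by (simp_all add: submodule_annihilated)
  note AD = submoduleD[OF subH]
  have IsubH: "annihilated I \<subseteq> annihilated H" using H(2) by (auto simp: annihilated_def)
  have AJ: "z \<in> carrier J" if "z \<in> annihilated H" for z using AD(1) that by blast
  have xz: "\<exists>c\<in>carrier R. x \<odot>\<^bsub>J\<^esub> z = c \<odot>\<^bsub>J\<^esub> s" if z: "z \<in> annihilated H" for z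
  proof (rule simple)
    show "x \<odot>\<^bsub>J\<^esub> z \<in> carrier J" using AJ[OF z] xR by simp
    show "r \<odot>\<^bsub>J\<^esub> (x \<odot>\<^bsub>J\<^esub> z) = \<zero>\<^bsub>J\<^esub>" if "r \<in> P" for r
      using Px[OF that] z xR PR[OF that] AJ[OF z] by (simp add: annihilated_def flip: smult_assoc1)
  qed
  have annI: "z \<in> annihilated I" if z: "z \<in> annihilated H" "x \<odot>\<^bsub>J\<^esub> z = \<zero>\<^bsub>J\<^esub>" for z
    unfolding annihilated_def
  proof (intro CollectI conjI ballI)
    show zJ: "z \<in> carrier J" using AJ z by simp
    fix y assume y: "y \<in> I"
    then obtain c where c: "c \<in> carrier R" "y \<ominus> c \<otimes> x \<in> H" using IH by blast
    have yR: "y \<in> carrier R" using y IR by blast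
    have "(y \<ominus> c \<otimes> x) \<odot>\<^bsub>J\<^esub> z = \<zero>\<^bsub>J\<^esub>" using c(2) z(1) by (simp add: annihilated_def)
    then show "y \<odot>\<^bsub>J\<^esub> z = \<zero>\<^bsub>J\<^esub>"
      using minus_eq_zero_imp_eq[of "y \<odot>\<^bsub>J\<^esub> z" "\<zero>\<^bsub>J\<^esub>"] c(1) yR xR zJ z(2)
      by (simp add: smult_minus_left smult_assoc1)
  qed
  \<comment> \<open>\<open>R s\<close> is simple: from a nonzero multiple of \<open>s\<close> the
    element \<open>s\<close> is recovered.\<close>
  have invs: "\<exists>q\<in>carrier R. q \<odot>\<^bsub>J\<^esub> (c \<odot>\<^bsub>J\<^esub> s) = s" if c: "c \<in> carrier R" "c \<odot>\<^bsub>J\<^esub> s \<noteq> \<zero>\<^bsub>J\<^esub>" for c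
  proof -
    have "c \<notin> P" using c s(3) by auto
    then obtain q where q: "q \<in> carrier R" "\<one> \<ominus> q \<otimes> c \<in> P"
      using maximalideal_inverse[OF P c(1)] by blast
    have "s \<ominus>\<^bsub>J\<^esub> q \<odot>\<^bsub>J\<^esub> (c \<odot>\<^bsub>J\<^esub> s) = \<zero>\<^bsub>J\<^esub>"
      using s(3)[OF q(2)] s(1) q(1) c(1) by (simp add: smult_minus_left smult_assoc1)
    then have "s = q \<odot>\<^bsub>J\<^esub> (c \<odot>\<^bsub>J\<^esub> s)"
      using minus_eq_zero_imp_eq[OF s(1)] s(1) q(1) c(1) by simp
    then show ?thesis using q(1) by metis
  qed
  have scalar: "\<exists>r\<in>carrier R. \<forall>z\<in>annihilated H. F z = r \<odot>\<^bsub>J\<^esub> z"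
    if F: "lin_on R J J (annihilated H) F" for F
  proof -
    obtain r where r: "r \<in> carrier R" "\<And>z. z \<in> annihilated I \<Longrightarrow> F z = r \<odot>\<^bsub>J\<^esub> z"
      using sn lin_on_subset[OF F IsubH] unfolding scalar_noetherian_def by blast
    show ?thesis
    proof (cases "\<forall>z\<in>annihilated H. x \<odot>\<^bsub>J\<^esub> z = \<zero>\<^bsub>J\<^esub>")
      case True
      then show ?thesis using r annI by blast
    next
      case False
      then obtain z1 where z1: "z1 \<in> annihilated H" "x \<odot>\<^bsub>J\<^esub> z1 \<noteq> \<zero>\<^bsub>J\<^esub>" by blast
      obtain c where c: "c \<in> carrier R" "x \<odot>\<^bsub>J\<^esub> z1 = c \<odot>\<^bsub>J\<^esub> s" using xz[OF z1(1)] by blast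
      obtain q where q: "q \<in> carrier R" "q \<odot>\<^bsub>J\<^esub> (c \<odot>\<^bsub>J\<^esub> s) = s" using invs[OF c(1)] z1(2) c(2) by auto
      \<comment> \<open>Normalised so that \<open>x z0 = s\<close>; then every \<open>z\<close> in
        \<open>annihilated H\<close> is a multiple of \<open>z0\<close> up to
        \<open>annihilated I\<close>.\<close>
      define z0 where "z0 = q \<odot>\<^bsub>J\<^esub> z1"
      have z0: "z0 \<in> annihilated H" unfolding z0_def by (rule AD(4)[OF q(1) z1(1)])
      have xz0: "x \<odot>\<^bsub>J\<^esub> z0 = s"
      proof -
        have "x \<odot>\<^bsub>J\<^esub> z0 = q \<odot>\<^bsub>J\<^esub> (x \<odot>\<^bsub>J\<^esub> z1)"
          unfolding z0_def by (rule smult_commute[OF xR q(1) AJ[OF z1(1)]])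
        then show ?thesis using q c by simp
      qed
      \<comment> \<open>Subtracting the scalar known on \<open>annihilated I\<close> leaves a map
        that vanishes there and so factors through multiplication by \<open>x\<close>.\<close>
      define G where "G z = F z \<ominus>\<^bsub>J\<^esub> r \<odot>\<^bsub>J\<^esub> z" for z
      have G: "lin_on R J J (annihilated H) G"
        unfolding G_def by (rule lin_on_diff[OF F lin_on_smult[OF AD(1) r(1)]])
      note GD = lin_onD[OF G]
      have GI: "G z = \<zero>\<^bsub>J\<^esub>" if "z \<in> annihilated I" for z
        using r that IsubH AJ by (auto simp: G_def a_minus_def M.r_neg)
      \<comment> \<open>\<open>G z0\<close> lies in the \<open>P\<close>-socle, hence in
        \<open>R s\<close> again, so that it is \<open>d s = d x z0\<close>. A second copy of
        \<open>R/P\<close> in \<open>J\<close> would break the argument at this point.\<close>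
      have "p \<odot>\<^bsub>J\<^esub> G z0 = \<zero>\<^bsub>J\<^esub>" if p: "p \<in> P" for p
      proof -
        have pz: "p \<odot>\<^bsub>J\<^esub> z0 \<in> annihilated H" by (rule AD(4)[OF PR[OF p] z0])
        have "x \<odot>\<^bsub>J\<^esub> (p \<odot>\<^bsub>J\<^esub> z0) = p \<odot>\<^bsub>J\<^esub> (x \<odot>\<^bsub>J\<^esub> z0)"
          by (rule smult_commute[OF xR PR[OF p] AJ[OF z0]])
        then have "x \<odot>\<^bsub>J\<^esub> (p \<odot>\<^bsub>J\<^esub> z0) = \<zero>\<^bsub>J\<^esub>" using s(3)[OF p] xz0 by simp
        then have "G (p \<odot>\<^bsub>J\<^esub> z0) = \<zero>\<^bsub>J\<^esub>" using GI annI[OF pz] by simp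
        then show ?thesis using GD(3)[OF z0 PR[OF p]] by simp
      qed
      then obtain d where d: "d \<in> carrier R" "G z0 = d \<odot>\<^bsub>J\<^esub> s" using simple[OF GD(1)[OF z0]] by blast
      have "F z = (r \<oplus> d \<otimes> x) \<odot>\<^bsub>J\<^esub> z" if z: "z \<in> annihilated H" for z
      proof -
        obtain c where c: "c \<in> carrier R" "x \<odot>\<^bsub>J\<^esub> z = c \<odot>\<^bsub>J\<^esub> s" using xz[OF z] by blast
        have cz0: "c \<odot>\<^bsub>J\<^esub> z0 \<in> annihilated H" by (rule AD(4)[OF c(1) z0])
        have zJ: "z \<in> carrier J" "z0 \<in> carrier J" using AJ z z0 by auto
        have "x \<odot>\<^bsub>J\<^esub> (c \<odot>\<^bsub>J\<^esub> z0) = c \<odot>\<^bsub>J\<^esub> (x \<odot>\<^bsub>J\<^esub> z0)"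
          by (rule smult_commute[OF xR c(1) zJ(2)])
        then have "x \<odot>\<^bsub>J\<^esub> (z \<ominus>\<^bsub>J\<^esub> c \<odot>\<^bsub>J\<^esub> z0) = \<zero>\<^bsub>J\<^esub>"
          using c xz0 zJ xR s(1) by (simp add: smult_minus_right) (simp add: a_minus_def M.r_neg)
        then have "G (z \<ominus>\<^bsub>J\<^esub> c \<odot>\<^bsub>J\<^esub> z0) = \<zero>\<^bsub>J\<^esub>" using GI annI AD(5)[OF z cz0] by blast
        then have "G z \<ominus>\<^bsub>J\<^esub> c \<odot>\<^bsub>J\<^esub> G z0 = \<zero>\<^bsub>J\<^esub>"
          using submodule_lin(2)[OF subH G module_axioms z cz0] GD(3)[OF z0 c(1)] by simp
        then have "G z = c \<odot>\<^bsub>J\<^esub> G z0"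
          using minus_eq_zero_imp_eq[OF GD(1)[OF z]] GD(1)[OF z0] c(1) by simp
        also have "\<dots> = d \<odot>\<^bsub>J\<^esub> (c \<odot>\<^bsub>J\<^esub> s)"
          unfolding d(2) by (rule smult_commute[OF c(1) d(1) s(1)])
        also have "\<dots> = (d \<otimes> x) \<odot>\<^bsub>J\<^esub> z" using c d xR zJ by (simp add: smult_assoc1)
        finally have Gz: "G z = (d \<otimes> x) \<odot>\<^bsub>J\<^esub> z" .
        have "F z = r \<odot>\<^bsub>J\<^esub> z \<oplus>\<^bsub>J\<^esub> G z"
          unfolding G_def using lin_onD(1)[OF F z] r(1) zJ by (intro eq_add_minus) auto
        then show ?thesis using Gz r(1) d xR zJ by (simp add: smult_l_distr)
      qed
      then show ?thesis using r d xR by blast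
    qed
  qed
  have noeth: "fg_sub R J W" if W: "submodule W R J" "W \<subseteq> annihilated H" for W
  proof (rule fg_sub_extension[OF W(1) _ module_axioms])
    have WJ: "W \<subseteq> carrier J" using submoduleD(1)[OF W(1)] .
    show lin: "lin_on R J J W (\<lambda>z. x \<odot>\<^bsub>J\<^esub> z)" by (rule lin_on_smult[OF WJ xR])
    have "submodule {z \<in> W. x \<odot>\<^bsub>J\<^esub> z = \<zero>\<^bsub>J\<^esub>} R J"
      by (rule submodule_kernel[OF W(1) lin module_axioms])
    moreover have "{z \<in> W. x \<odot>\<^bsub>J\<^esub> z = \<zero>\<^bsub>J\<^esub>} \<subseteq> annihilated I" using annI W(2) by blast
    ultimately show "fg_sub R J {z \<in> W. x \<odot>\<^bsub>J\<^esub> z = \<zero>\<^bsub>J\<^esub>}"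
      using sn unfolding scalar_noetherian_def by blast
    let ?K = "(\<lambda>z. x \<odot>\<^bsub>J\<^esub> z) ` W"
    have K: "submodule ?K R J" by (rule submodule_image[OF W(1) lin module_axioms])
    have Ks: "\<exists>c\<in>carrier R. k = c \<odot>\<^bsub>J\<^esub> s" if "k \<in> ?K" for k using xz W(2) that by blast
    \<comment> \<open>A submodule of the simple module \<open>R s\<close> is zero or contains its
      generator \<open>s\<close>.\<close>
    show "fg_sub R J ?K"
    proof (cases "?K \<subseteq> {\<zero>\<^bsub>J\<^esub>}")
      case True
      show ?thesis
        by (rule fg_sub_finite_generators[of "{}"]) (use True submoduleD(2) in auto)
    next
      case False
      then obtain k where k: "k \<in> ?K" "k \<noteq> \<zero>\<^bsub>J\<^esub>" by blast
      obtain c where c: "c \<in> carrier R" "k = c \<odot>\<^bsub>J\<^esub> s" using Ks[OF k(1)] by blast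
      obtain q where q: "q \<in> carrier R" "q \<odot>\<^bsub>J\<^esub> k = s" using invs[OF c(1)] k(2) c(2) by auto
      have "s \<in> ?K" using submoduleD(4)[OF K q(1) k(1)] q(2) by simp
      moreover have "?K \<subseteq> H'" if H': "submodule H' R J" "{s} \<subseteq> H'" for H'
      proof
        fix k assume "k \<in> ?K"
        then obtain c where "c \<in> carrier R" "k = c \<odot>\<^bsub>J\<^esub> s" using Ks by blast
        then show "k \<in> H'" using submoduleD(4)[OF H'(1)] H'(2) by simp
      qed
      ultimately show ?thesis by (intro fg_sub_finite_generators[of "{s}"]) simp_all
    qed
  qed
  show ?thesis unfolding scalar_noetherian_def using scalar noeth by blast
qed

text \<open>A minimal ideal with the property takes the place of the end of a composition series.
  The property holds for \<open>R\<close>, whose annihilator in \<open>J\<close> is zero, and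
  \<open>ideal_simple_step\<close> leads strictly below any nonzero ideal.\<close>

lemma scalar_noetherian_zero: "scalar_noetherian {\<zero>}"
proof -
  let ?F = "{I. ideal I R \<and> scalar_noetherian I}"
  have "scalar_noetherian (carrier R)"
    unfolding scalar_noetherian_def annihilated_carrier
  proof (intro conjI allI impI)
    fix F assume "lin_on R J J {\<zero>\<^bsub>J\<^esub>} F"
    then have "F \<zero>\<^bsub>J\<^esub> = \<zero>\<^bsub>J\<^esub>" by (rule submodule_lin(1)[OF zero_submodule _ module_axioms])
    then show "\<exists>r\<in>carrier R. \<forall>z\<in>{\<zero>\<^bsub>J\<^esub>}. F z = r \<odot>\<^bsub>J\<^esub> z" by (intro bexI[of _ \<zero>]) simp_all
  next
    fix W assume "submodule W R J" "W \<subseteq> {\<zero>\<^bsub>J\<^esub>}"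
    then show "fg_sub R J W"
      by (intro fg_sub_finite_generators[of "{}"]) (use submoduleD(2) in auto)
  qed
  then have "carrier R \<in> ?F" using oneideal by simp
  then obtain I where "I \<in> ?F" and min: "\<And>K. K \<in> ?F \<Longrightarrow> K \<subseteq> I \<Longrightarrow> K = I"
    by (rule artinian_minimal_ideal[OF artinian]) (simp, rule that)
  then have I: "ideal I R" "scalar_noetherian I" by simp_all
  have "I = {\<zero>}"
  proof (rule ccontr)
    assume "I \<noteq> {\<zero>}"
    from I(1) this show False
    proof (rule ideal_simple_step)
      fix H x P
      assume *: "ideal H R" "H \<subseteq> I" "maximalideal P R" "x \<in> I" "x \<notin> H"
        "\<And>r. r \<in> P \<Longrightarrow> r \<otimes> x \<in> H" "\<And>y. y \<in> I \<Longrightarrow> \<exists>c\<in>carrier R. y \<ominus> c \<otimes> x \<in> H"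
      have "scalar_noetherian H" by (rule scalar_noetherian_step[OF I(1) *(1-4,6,7) I(2)])
      then have "H = I" using min[of H] *(1,2) by simp
      then show False using * by simp
    qed
  qed
  then show ?thesis using I by simp
qed

section \<open>Endomorphisms of \<open>J\<close>, extension and separation of functionals\<close>

lemma endomorphism_scalar:
  assumes "lin_on R J J (carrier J) F"
  obtains r where "r \<in> carrier R" "\<And>z. z \<in> carrier J \<Longrightarrow> F z = r \<odot>\<^bsub>J\<^esub> z"
  using scalar_noetherian_zero assms that unfolding scalar_noetherian_def annihilated_zero by blast

lemma submodule_fg:
  assumes "submodule W R J"
  shows "fg_sub R J W"
  using scalar_noetherian_zero assms submoduleD(1)[OF assms]
  unfolding scalar_noetherian_def annihilated_zero by blast

text \<open>\<open>N\<close> may live on a type other than \<open>'r\<close>, out of reach of the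
  definition of injectivity. Its generators are adjoined one by one instead, each by Baer's
  criterion.\<close>

lemma extend_lin:
  assumes N: "module R N" and fg: "fin_gen R N" and X: "submodule X R N" and f: "lin_on R N J X f"
  obtains g where "g \<in> mod_hom R N J" "\<And>x. x \<in> X \<Longrightarrow> g x = f x"
proof -
  interpret N: module R N by fact
  obtain S where S: "finite S" "S \<subseteq> carrier N" "\<And>H. submodule H R N \<Longrightarrow> S \<subseteq> H \<Longrightarrow> H = carrier N"
    using fg unfolding fin_gen_def by auto
  have "\<exists>X' f'. submodule X' R N \<and> X \<union> S \<subseteq> X' \<and> lin_on R N J X' f' \<and> (\<forall>x\<in>X. f' x = f x)"
    using S(1,2)
  proof (induction S rule: finite_induct)
    case empty
    show ?case using X f by (intro exI[of _ X] exI[of _ f]) simp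
  next
    case (insert t S)
    then obtain X' f' where X': "submodule X' R N" "X \<union> S \<subseteq> X'" "lin_on R N J X' f'"
      "\<And>x. x \<in> X \<Longrightarrow> f' x = f x" by auto
    have tN: "t \<in> carrier N" using insert by simp
    note XD = N.submoduleD[OF X'(1)] and fD = lin_onD[OF X'(3)]
    \<comment> \<open>The multiples of the new generator \<open>t\<close> that fall into
      \<open>X'\<close> come from an ideal; Baer's criterion on it yields a value \<open>z\<close>
      for \<open>t\<close> that respects all these relations.\<close>
    let ?L = "{r \<in> carrier R. r \<odot>\<^bsub>N\<^esub> t \<in> X'}"
    have L: "ideal ?L R"
      using tN XD by (intro ideal_if_closed[OF is_cring]) (auto simp: N.smult_l_distr N.smult_assoc1)
    have "lin_on R (self_module R) J ?L (\<lambda>r. f' (r \<odot>\<^bsub>N\<^esub> t))"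
      using fD tN unfolding lin_on_def by (auto simp: N.smult_l_distr N.smult_assoc1)
    then obtain z where z: "z \<in> carrier J" "\<And>r. r \<in> ?L \<Longrightarrow> f' (r \<odot>\<^bsub>N\<^esub> t) = r \<odot>\<^bsub>J\<^esub> z"
      using baer[OF L] by blast
    show ?case
    proof (rule N.extend_by_element[OF module_axioms X'(1,3) tN z(1)])
      show "f' (r \<odot>\<^bsub>N\<^esub> t) = r \<odot>\<^bsub>J\<^esub> z" if "r \<in> carrier R" "r \<odot>\<^bsub>N\<^esub> t \<in> X'" for r
        using z(2) that by simp
      show ?case if "submodule X'' R N" "X' \<subseteq> X''" "t \<in> X''" "lin_on R N J X'' f''"
        "\<And>y. y \<in> X' \<Longrightarrow> f'' y = f' y" for X'' f''
        using that X'(2,4) by (intro exI[of _ X''] exI[of _ f'']) (auto simp: subset_iff)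
    qed
  qed
  then obtain X' f' where X': "submodule X' R N" "X \<subseteq> X'" "S \<subseteq> X'" "lin_on R N J X' f'"
    "\<And>x. x \<in> X \<Longrightarrow> f' x = f x" by auto
  have "X' = carrier N" using S(3) X' by simp
  then have "restrict f' (carrier N) \<in> mod_hom R N J"
    using X'(4) by (simp add: lin_on_def mod_hom_def)
  moreover have "restrict f' (carrier N) x = f x" if "x \<in> X" for x
    using that X'(5) N.submoduleD(1)[OF X] by auto
  ultimately show thesis by (rule that)
qed

text \<open>With a maximal ideal \<open>P\<close> above the annihilator of \<open>x\<close>, the
  module \<open>R x\<close> maps onto \<open>R/P\<close>, which sits in \<open>J\<close> as
  \<open>R s\<close>. The functional with \<open>x \<mapsto> s\<close> is then extended to
  \<open>N\<close>.\<close>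

lemma separate_points:
  assumes N: "module R N" and fg: "fin_gen R N" and x: "x \<in> carrier N" "x \<noteq> \<zero>\<^bsub>N\<^esub>"
  obtains g where "g \<in> mod_hom R N J" "g x \<noteq> \<zero>\<^bsub>J\<^esub>"
proof -
  interpret N: module R N by fact
  let ?A = "{r \<in> carrier R. r \<odot>\<^bsub>N\<^esub> x = \<zero>\<^bsub>N\<^esub>}"
  have A: "ideal ?A R"
    using x by (intro ideal_if_closed[OF is_cring]) (auto simp: N.smult_l_distr N.smult_assoc1)
  have "\<one> \<notin> ?A" using x by simp
  then have "?A \<noteq> carrier R" using one_closed by blast
  then obtain P where P: "maximalideal P R" "?A \<subseteq> P" using ex_maximalideal[OF A] by blast
  obtain s where s: "s \<in> carrier J" "s \<noteq> \<zero>\<^bsub>J\<^esub>" "\<And>r. r \<in> P \<Longrightarrow> r \<odot>\<^bsub>J\<^esub> s = \<zero>\<^bsub>J\<^esub>"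
    using socle[OF P(1)] by metis
  have lin: "lin_on R N J {\<zero>\<^bsub>N\<^esub>} (\<lambda>_. \<zero>\<^bsub>J\<^esub>)" by (simp add: lin_on_def)
  show thesis
  proof (rule N.extend_by_element[OF module_axioms N.zero_submodule lin x(1) s(1)])
    show "\<zero>\<^bsub>J\<^esub> = r \<odot>\<^bsub>J\<^esub> s" if "r \<in> carrier R" "r \<odot>\<^bsub>N\<^esub> x \<in> {\<zero>\<^bsub>N\<^esub>}" for r
      using that P(2) s(3)[of r] by auto
    fix X f assume X: "submodule X R N" "x \<in> X" "lin_on R N J X f" "f x = s"
    show thesis
    proof (rule extend_lin[OF N fg X(1,3)])
      fix g assume "g \<in> mod_hom R N J" "\<And>x. x \<in> X \<Longrightarrow> g x = f x"
      then show thesis using that X(2,4) s(2) by simp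
    qed
  qed
qed

end

section \<open>The dual module\<close>

lemma restrict_scalars_simps [simp]:
  "carrier (restrict_scalars h N) = carrier N" "add (restrict_scalars h N) = add N"
  "\<zero>\<^bsub>restrict_scalars h N\<^esub> = \<zero>\<^bsub>N\<^esub>" "r \<odot>\<^bsub>restrict_scalars h N\<^esub> x = h r \<odot>\<^bsub>N\<^esub> x"
  by (simp_all add: restrict_scalars_def)

lemma restrict_scalars_ident: "restrict_scalars (\<lambda>r. r) N = N"
  by (cases N) (simp add: restrict_scalars_def)

lemma D_obj_simps:
  "carrier (D_obj R J \<eta> N) = mod_hom R (restrict_scalars \<eta> N) J"
  "\<zero>\<^bsub>D_obj R J \<eta> N\<^esub> = (\<lambda>x\<in>carrier N. \<zero>\<^bsub>J\<^esub>)"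
  "f \<oplus>\<^bsub>D_obj R J \<eta> N\<^esub> g = (\<lambda>x\<in>carrier N. f x \<oplus>\<^bsub>J\<^esub> g x)"
  "a \<odot>\<^bsub>D_obj R J \<eta> N\<^esub> f = (\<lambda>x\<in>carrier N. f (a \<odot>\<^bsub>N\<^esub> x))"
  by (simp_all add: D_obj_def)

text \<open>The bridge from the algebra to the base ring: seen over \<open>R\<close>, the dual is
  the plain \<open>R\<close>-dual, so results on finiteness and evaluations carry over.\<close>

lemma restrict_scalars_D_obj:
  "restrict_scalars \<eta> (D_obj R J \<eta> N) = D_obj R J (\<lambda>r. r) (restrict_scalars \<eta> N)"
  by (simp add: D_obj_def restrict_scalars_ident) (simp add: restrict_scalars_def)

lemma mod_homD:
  assumes "f \<in> mod_hom R M N"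
  shows "x \<in> carrier M \<Longrightarrow> f x \<in> carrier N"
    "x \<in> carrier M \<Longrightarrow> y \<in> carrier M \<Longrightarrow> f (x \<oplus>\<^bsub>M\<^esub> y) = f x \<oplus>\<^bsub>N\<^esub> f y"
    "r \<in> carrier R \<Longrightarrow> x \<in> carrier M \<Longrightarrow> f (r \<odot>\<^bsub>M\<^esub> x) = r \<odot>\<^bsub>N\<^esub> f x"
    "x \<notin> carrier M \<Longrightarrow> f x = undefined"
  using assms unfolding mod_hom_def by (auto simp: PiE_def extensional_def)

lemma mod_homI:
  assumes "\<And>x. x \<in> carrier M \<Longrightarrow> f x \<in> carrier N"
    and "\<And>x y. x \<in> carrier M \<Longrightarrow> y \<in> carrier M \<Longrightarrow> f (x \<oplus>\<^bsub>M\<^esub> y) = f x \<oplus>\<^bsub>N\<^esub> f y"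
    and "\<And>r x. r \<in> carrier R \<Longrightarrow> x \<in> carrier M \<Longrightarrow> f (r \<odot>\<^bsub>M\<^esub> x) = r \<odot>\<^bsub>N\<^esub> f x"
    and "\<And>x. x \<notin> carrier M \<Longrightarrow> f x = undefined"
  shows "f \<in> mod_hom R M N"
  using assms unfolding mod_hom_def by (auto simp: PiE_def extensional_def)

lemma mod_hom_eqI:
  assumes "f \<in> mod_hom R M N" "g \<in> mod_hom R M N" "\<And>x. x \<in> carrier M \<Longrightarrow> f x = g x"
  shows "f = g"
  using assms mod_homD(4) by (metis ext)

lemma mod_hom_lin_on: "f \<in> mod_hom R M N \<Longrightarrow> lin_on R M N (carrier M) f"
  by (simp add: mod_hom_iff)

context artin_envelope
begin

abbreviation dual :: "('r, 'n) module \<Rightarrow> ('r, 'n \<Rightarrow> 'e) module"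
  where "dual \<equiv> D_obj R J (\<lambda>r. r)"

lemmas dual_simps = D_obj_simps[where \<eta> = "\<lambda>r. r", unfolded restrict_scalars_ident]

lemma dual_module:
  assumes N: "module R N"
  shows "module R (dual N)"
proof -
  interpret N: module R N by fact
  note hD = mod_homD[where N = J and R = R and M = N]
  note simps = dual_simps fun_eq_iff restrict_def
  have closed: "f \<oplus>\<^bsub>dual N\<^esub> g \<in> mod_hom R N J" "r \<odot>\<^bsub>dual N\<^esub> f \<in> mod_hom R N J"
    if "f \<in> mod_hom R N J" "g \<in> mod_hom R N J" "r \<in> carrier R" for f g r
    using hD[OF that(1)] hD[OF that(2)] that(3)
    by (auto intro!: mod_homI simp: dual_simps smult_r_distr M.a_ac N.smult_r_distr smult_commute)
  have zero: "\<zero>\<^bsub>dual N\<^esub> \<in> mod_hom R N J" by (auto intro!: mod_homI simp: dual_simps)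
  show ?thesis
  proof (rule moduleI)
    show "cring R" by (rule is_cring)
    show "abelian_group (dual N)"
    proof (rule abelian_groupI)
      fix f assume f: "f \<in> carrier (dual N)"
      then have f': "f \<in> mod_hom R N J" by (simp add: dual_simps)
      show "\<zero>\<^bsub>dual N\<^esub> \<oplus>\<^bsub>dual N\<^esub> f = f" using hD[OF f'] by (auto simp: simps)
      have "(\<ominus> \<one>) \<odot>\<^bsub>dual N\<^esub> f \<oplus>\<^bsub>dual N\<^esub> f = \<zero>\<^bsub>dual N\<^esub>"
        using hD(1,3)[OF f'] by (auto simp: simps smult_l_minus M.l_neg)
      moreover have "(\<ominus> \<one>) \<odot>\<^bsub>dual N\<^esub> f \<in> carrier (dual N)" using closed(2)[OF f' f'] by (simp add: dual_simps(1))
      ultimately show "\<exists>g\<in>carrier (dual N). g \<oplus>\<^bsub>dual N\<^esub> f = \<zero>\<^bsub>dual N\<^esub>" by blast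
    next
      fix f g h assume "f \<in> carrier (dual N)" "g \<in> carrier (dual N)"
      then have f: "f \<in> mod_hom R N J" and g: "g \<in> mod_hom R N J" by (simp_all add: dual_simps)
      show "f \<oplus>\<^bsub>dual N\<^esub> g \<in> carrier (dual N)"
        using closed(1)[OF f g R.zero_closed] by (simp add: dual_simps(1))
      show "f \<oplus>\<^bsub>dual N\<^esub> g = g \<oplus>\<^bsub>dual N\<^esub> f"
        using hD(1)[OF f] hD(1)[OF g] by (auto simp: simps M.a_comm)
      assume "h \<in> carrier (dual N)"
      then have h: "h \<in> mod_hom R N J" by (simp add: dual_simps)
      show "f \<oplus>\<^bsub>dual N\<^esub> g \<oplus>\<^bsub>dual N\<^esub> h = f \<oplus>\<^bsub>dual N\<^esub> (g \<oplus>\<^bsub>dual N\<^esub> h)"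
        using hD(1)[OF f] hD(1)[OF g] hD(1)[OF h] by (auto simp: simps M.a_assoc)
    qed (use zero in \<open>simp add: dual_simps\<close>)
    show "\<one> \<odot>\<^bsub>dual N\<^esub> f = f" if "f \<in> carrier (dual N)" for f
      using hD[of f] that by (auto simp: simps)
  next
    fix a b f assume a: "a \<in> carrier R" and "f \<in> carrier (dual N)"
    then have f: "f \<in> mod_hom R N J" by (simp add: dual_simps)
    show "a \<odot>\<^bsub>dual N\<^esub> f \<in> carrier (dual N)" using closed(2)[OF f f a] by (simp add: dual_simps(1))
    assume b: "b \<in> carrier R"
    show "(a \<oplus> b) \<odot>\<^bsub>dual N\<^esub> f = a \<odot>\<^bsub>dual N\<^esub> f \<oplus>\<^bsub>dual N\<^esub> b \<odot>\<^bsub>dual N\<^esub> f"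
        using hD(1,3)[OF f] a b by (auto simp: simps smult_l_distr)
    show "(a \<otimes> b) \<odot>\<^bsub>dual N\<^esub> f = a \<odot>\<^bsub>dual N\<^esub> (b \<odot>\<^bsub>dual N\<^esub> f)"
        using hD(1,3)[OF f] a b by (auto simp: simps smult_assoc1 smult_commute)
  next
    fix a f g assume a: "a \<in> carrier R" and "f \<in> carrier (dual N)" "g \<in> carrier (dual N)"
    then have f: "f \<in> mod_hom R N J" and g: "g \<in> mod_hom R N J" by (simp_all add: dual_simps)
    show "a \<odot>\<^bsub>dual N\<^esub> (f \<oplus>\<^bsub>dual N\<^esub> g) = a \<odot>\<^bsub>dual N\<^esub> f \<oplus>\<^bsub>dual N\<^esub> a \<odot>\<^bsub>dual N\<^esub> g"
      using hD(1,3)[OF f] hD(1,3)[OF g] a by (auto simp: simps)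
  qed
qed

lemma lin_on_eval:
  assumes "module R N" "x \<in> carrier N" "W \<subseteq> carrier (dual N)"
  shows "lin_on R (dual N) J W (\<lambda>f. f x)"
proof -
  have W: "f \<in> mod_hom R N J" if "f \<in> W" for f using assms(3) that by (auto simp: dual_simps)
  show ?thesis
    using assms(2) mod_homD[OF W] unfolding lin_on_def
    by (auto simp: dual_simps)
qed

lemma mod_hom_vanishing_on_generators:
  assumes N: "module R N" and S: "\<And>H. submodule H R N \<Longrightarrow> S \<subseteq> H \<Longrightarrow> H = carrier N" "S \<subseteq> carrier N"
    and f: "f \<in> mod_hom R N J" "\<And>x. x \<in> S \<Longrightarrow> f x = \<zero>\<^bsub>J\<^esub>"
  shows "f = \<zero>\<^bsub>dual N\<^esub>"
proof -
  interpret N: module R N by fact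
  have "submodule {x \<in> carrier N. f x = \<zero>\<^bsub>J\<^esub>} R N"
    by (rule N.submodule_kernel[OF N.carrier_is_submodule mod_hom_lin_on[OF f(1)] module_axioms])
  then have "{x \<in> carrier N. f x = \<zero>\<^bsub>J\<^esub>} = carrier N" using S f(2) by blast
  then show ?thesis
    using mod_homD(4)[OF f(1)] by (auto simp: dual_simps fun_eq_iff)
qed

text \<open>Evaluation at a generator has its image in \<open>J\<close>, where submodules are
  finitely generated, and its kernel consists of the functionals vanishing at that generator. Once
  all generators are used, only zero is left.\<close>

lemma dual_submodule_fg:
  assumes N: "module R N" and fg: "fin_gen R N" and W: "submodule W R (dual N)"
  shows "fg_sub R (dual N) W"
proof -
  interpret N: module R N by fact
  interpret D: module R "dual N" by (rule dual_module) fact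
  obtain S where S: "finite S" "S \<subseteq> carrier N" "\<And>H. submodule H R N \<Longrightarrow> S \<subseteq> H \<Longrightarrow> H = carrier N"
    using fg unfolding fin_gen_def by auto
  \<comment> \<open>The induction goes down to functionals vanishing on more and more of
    \<open>S\<close>, so finite generation is passed upwards as an implication, whose premise is
    discharged at the end.\<close>
  have "fg_sub R (dual N) {f \<in> W. \<forall>x\<in>S. f x = \<zero>\<^bsub>J\<^esub>} \<Longrightarrow> fg_sub R (dual N) W"
    using S(1,2) W
  proof (induction S rule: finite_induct)
    case empty
    then show ?case by simp
  next
    case (insert t S)
    let ?W' = "{f \<in> W. \<forall>x\<in>S. f x = \<zero>\<^bsub>J\<^esub>}"
    note WD = D.submoduleD[OF insert.prems(3)]
    have lin: "lin_on R (dual N) J W (\<lambda>f. f x)" if "x \<in> carrier N" for x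
      by (rule lin_on_eval[OF N that WD(1)])
    have W': "submodule ?W' R (dual N)"
    proof (rule D.submodule_if_closed)
      show "?W' \<subseteq> carrier (dual N)" using WD(1) by blast
      show "\<zero>\<^bsub>dual N\<^esub> \<in> ?W'" using WD(2) insert.prems(2) by (auto simp: dual_simps)
      show "f \<oplus>\<^bsub>dual N\<^esub> g \<in> ?W'" if "f \<in> ?W'" "g \<in> ?W'" for f g
        using that WD(3)[of f g] lin_onD(2)[OF lin, of _ f g] insert.prems(2) by auto
      show "r \<odot>\<^bsub>dual N\<^esub> f \<in> ?W'" if "r \<in> carrier R" "f \<in> ?W'" for r f
        using that WD(4)[of r f] lin_onD(3)[OF lin, of _ f r] insert.prems(2) by auto
    qed
    have lin': "lin_on R (dual N) J ?W' (\<lambda>f. f t)"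
      by (rule lin_on_subset[OF lin]) (use insert.prems(2) in auto)
    have "fg_sub R (dual N) ?W'"
    proof (rule D.fg_sub_extension[OF W' lin' module_axioms])
      have "{f \<in> ?W'. f t = \<zero>\<^bsub>J\<^esub>} = {f \<in> W. \<forall>x\<in>insert t S. f x = \<zero>\<^bsub>J\<^esub>}" by auto
      then show "fg_sub R (dual N) {f \<in> ?W'. f t = \<zero>\<^bsub>J\<^esub>}" using insert.prems(1) by simp
      show "fg_sub R J ((\<lambda>f. f t) ` ?W')"
        by (rule submodule_fg[OF D.submodule_image[OF W' lin' module_axioms]])
    qed
    then show ?case using insert.IH insert.prems(2,3) by simp
  qed
  moreover have "fg_sub R (dual N) {f \<in> W. \<forall>x\<in>S. f x = \<zero>\<^bsub>J\<^esub>}"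
  proof (rule fg_sub_finite_generators[of "{}"])
    fix H assume H: "submodule H R (dual N)"
    have "f \<in> H" if "f \<in> W" "\<forall>x\<in>S. f x = \<zero>\<^bsub>J\<^esub>" for f
    proof -
      have "f \<in> mod_hom R N J" using that D.submoduleD(1)[OF W] by (auto simp: dual_simps)
      then have "f = \<zero>\<^bsub>dual N\<^esub>" using mod_hom_vanishing_on_generators[OF N S(3,2)] that(2) by blast
      then show ?thesis using D.submoduleD(2)[OF H] by simp
    qed
    then show "{f \<in> W. \<forall>x\<in>S. f x = \<zero>\<^bsub>J\<^esub>} \<subseteq> H" by blast
  qed simp_all
  ultimately show ?thesis by blast
qed

lemma dual_fin_gen:
  assumes "module R N" "fin_gen R N"
  shows "fin_gen R (dual N)"
proof -
  interpret D: module R "dual N" by (rule dual_module) fact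
  show ?thesis
    unfolding D.fin_gen_iff by (rule dual_submodule_fg[OF assms D.carrier_is_submodule])
qed

lemma self_fin_gen: "fin_gen R J"
  unfolding fin_gen_iff by (rule submodule_fg[OF carrier_is_submodule])

text \<open>Induction on generators with \<open>F\<close> varying. On the functionals vanishing at
  the generators other than \<open>t\<close>, the value \<open>F f\<close> depends on
  \<open>f t\<close> alone. This dependence extends to an endomorphism of \<open>J\<close>, which is
  a scalar \<open>r\<close>, so there \<open>F\<close> is evaluation at \<open>r t\<close>.
  Subtracting this evaluation from \<open>F\<close> disposes of \<open>t\<close>.\<close>

lemma functional_is_evaluation:
  assumes N: "module R N" and fg: "fin_gen R N"
    and F: "lin_on R (dual N) J (mod_hom R N J) F"
  obtains x where "x \<in> carrier N" "\<And>f. f \<in> mod_hom R N J \<Longrightarrow> F f = f x"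
proof -
  interpret N: module R N by fact
  interpret D: module R "dual N" by (rule dual_module) fact
  obtain S where S: "finite S" "S \<subseteq> carrier N" "\<And>H. submodule H R N \<Longrightarrow> S \<subseteq> H \<Longrightarrow> H = carrier N"
    using fg unfolding fin_gen_def by auto
  let ?D = "mod_hom R N J"
  have DD: "submodule ?D R (dual N)" using D.carrier_is_submodule by (simp add: dual_simps)
  have eval: "lin_on R (dual N) J ?D (\<lambda>f. f x)" if "x \<in> carrier N" for x
    by (rule lin_on_eval[OF N that]) (simp add: dual_simps)
  \<comment> \<open>During the induction \<open>S\<close> is no longer a generating set. What
    remains of that property is the hypothesis that \<open>F\<close> kills the functionals vanishing
    on \<open>S\<close>.\<close>
  have "\<exists>x\<in>carrier N. \<forall>f\<in>?D. F f = f x" if "\<And>f. f \<in> ?D \<Longrightarrow> (\<forall>x\<in>S. f x = \<zero>\<^bsub>J\<^esub>) \<Longrightarrow> F f = \<zero>\<^bsub>J\<^esub>"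
    using S(1,2) that F
  proof (induction S arbitrary: F rule: finite_induct)
    case empty
    have "f \<zero>\<^bsub>N\<^esub> = \<zero>\<^bsub>J\<^esub>" if "f \<in> ?D" for f
      by (rule N.submodule_lin(1)[OF N.carrier_is_submodule mod_hom_lin_on[OF that] module_axioms])
    then show ?case using empty.prems(2) by (intro bexI[of _ "\<zero>\<^bsub>N\<^esub>"]) auto
  next
    case (insert t S)
    note FD = lin_onD[OF insert.prems(3)]
    have t: "t \<in> carrier N" and SN: "S \<subseteq> carrier N" using insert.prems(1) by auto
    define K where "K = {f \<in> ?D. \<forall>x\<in>S. f x = \<zero>\<^bsub>J\<^esub>}"
    have K: "submodule K R (dual N)"
    proof (rule D.submodule_if_closed)
      note E = D.submoduleD[OF DD]
      show "K \<subseteq> carrier (dual N)" using E(1) by (auto simp: K_def)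
      show "\<zero>\<^bsub>dual N\<^esub> \<in> K" using E(2) SN by (auto simp: K_def dual_simps)
      show "f \<oplus>\<^bsub>dual N\<^esub> g \<in> K" if "f \<in> K" "g \<in> K" for f g
        using that E(3)[of f g] lin_onD(2)[OF eval, of _ f g] SN by (auto simp: K_def)
      show "r \<odot>\<^bsub>dual N\<^esub> f \<in> K" if "r \<in> carrier R" "f \<in> K" for r f
        using that E(4)[of r f] lin_onD(3)[OF eval, of _ f r] SN by (auto simp: K_def)
    qed
    have KD: "K \<subseteq> ?D" by (auto simp: K_def)
    note KS = D.submoduleD[OF K]
    have lin: "lin_on R (dual N) J K (\<lambda>f. f t)" and linF: "lin_on R (dual N) J K F"
      by (rule lin_on_subset[OF _ KD], rule eval[OF t] insert.prems(3))+
    let ?E = "(\<lambda>f. f t) ` K"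
    have E: "submodule ?E R J" by (rule D.submodule_image[OF K lin module_axioms])
    \<comment> \<open>The difference of \<open>f\<close> and \<open>g\<close> vanishes on
      \<open>insert t S\<close> and is killed by \<open>F\<close>. So \<open>F\<close> on
      \<open>K\<close> factors through evaluation at \<open>t\<close>, and \<open>G\<close> below is
      the factor.\<close>
    have wd: "F f = F g" if "f \<in> K" "g \<in> K" "f t = g t" for f g
    proof -
      have d: "f \<ominus>\<^bsub>dual N\<^esub> g \<in> K" by (rule KS(5)) fact+
      have "(f \<ominus>\<^bsub>dual N\<^esub> g) t = f t \<ominus>\<^bsub>J\<^esub> g t"
        by (rule D.submodule_lin(2)[OF K lin module_axioms that(1,2)])
      also have "\<dots> = \<zero>\<^bsub>J\<^esub>" using that lin_onD(1)[OF lin that(2)] by (simp add: a_minus_def M.r_neg)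
      finally have "F (f \<ominus>\<^bsub>dual N\<^esub> g) = \<zero>\<^bsub>J\<^esub>" using insert.prems(2) d by (auto simp: K_def)
      then have "F f \<ominus>\<^bsub>J\<^esub> F g = \<zero>\<^bsub>J\<^esub>"
        using D.submodule_lin(2)[OF K linF module_axioms that(1,2)] by simp
      then show ?thesis
        using minus_eq_zero_imp_eq lin_onD(1)[OF linF] that by blast
    qed
    define G where "G z = F (SOME f. f \<in> K \<and> f t = z)" for z
    have G: "G (f t) = F f" if "f \<in> K" for f
    proof -
      have "(SOME g. g \<in> K \<and> g t = f t) \<in> K \<and> (SOME g. g \<in> K \<and> g t = f t) t = f t"
        by (rule someI[of _ f]) (use that in simp)
      then show ?thesis unfolding G_def by (intro wd) (use that in simp_all)
    qed
    have linG: "lin_on R J J ?E G"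
      unfolding lin_on_def
    proof (intro conjI ballI; elim imageE; hypsubst)
      fix f assume f: "f \<in> K"
      show "G (f t) \<in> carrier J" using G[OF f] lin_onD(1)[OF linF f] by simp
      show "G (r \<odot>\<^bsub>J\<^esub> f t) = r \<odot>\<^bsub>J\<^esub> G (f t)" if "r \<in> carrier R" for r
        using G[OF KS(4)[OF that f]] lin_onD(3)[OF linF f that] lin_onD(3)[OF lin f that] G[OF f] by simp
      show "G (f t \<oplus>\<^bsub>J\<^esub> g t) = G (f t) \<oplus>\<^bsub>J\<^esub> G (g t)" if "g \<in> K" for g
        using G[OF KS(3)[OF f that]] lin_onD(2)[OF linF f that] lin_onD(2)[OF lin f that] G[OF f] G[OF that] by simp
    qed
    \<comment> \<open>\<open>J\<close> is itself finitely generated, so \<open>extend_lin\<close>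
      applies to it and turns \<open>G\<close> into an endomorphism of \<open>J\<close>.\<close>
    obtain H where H: "H \<in> mod_hom R J J" "\<And>z. z \<in> ?E \<Longrightarrow> H z = G z"
      using extend_lin[OF module_axioms self_fin_gen E linG] by metis
    obtain r where r: "r \<in> carrier R" "\<And>z. z \<in> carrier J \<Longrightarrow> H z = r \<odot>\<^bsub>J\<^esub> z"
      using endomorphism_scalar[OF mod_hom_lin_on[OF H(1)]] by metis
    define x0 where "x0 = r \<odot>\<^bsub>N\<^esub> t"
    have x0: "x0 \<in> carrier N" using r t by (simp add: x0_def)
    have FK: "F f = f x0" if f: "f \<in> K" for f
    proof -
      have "F f = H (f t)" using H(2) G f by simp
      also have "\<dots> = f x0"
        using r lin_onD(1)[OF lin f] mod_homD(3)[of f R N J r t] f KD t by (auto simp: x0_def)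
      finally show ?thesis .
    qed
    let ?F' = "\<lambda>f. F f \<ominus>\<^bsub>J\<^esub> f x0"
    have "\<exists>x\<in>carrier N. \<forall>f\<in>?D. ?F' f = f x"
    proof (rule insert.IH[OF SN])
      show "lin_on R (dual N) J ?D ?F'" by (rule lin_on_diff[OF insert.prems(3) eval[OF x0]])
      show "?F' f = \<zero>\<^bsub>J\<^esub>" if "f \<in> ?D" "\<forall>x\<in>S. f x = \<zero>\<^bsub>J\<^esub>" for f
        using FK[of f] that mod_homD(1)[OF that(1) x0] by (simp add: K_def a_minus_def M.r_neg)
    qed
    then obtain x where x: "x \<in> carrier N" "\<And>f. f \<in> ?D \<Longrightarrow> ?F' f = f x" by blast
    have "F f = f (x0 \<oplus>\<^bsub>N\<^esub> x)" if f: "f \<in> ?D" for f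
    proof -
      have "F f = f x0 \<oplus>\<^bsub>J\<^esub> ?F' f" by (rule eq_add_minus[OF FD(1)[OF f] mod_homD(1)[OF f x0]])
      then show ?thesis using x f mod_homD(2)[OF f x0 x(1)] by simp
    qed
    then show ?case using x0 x(1) by (intro bexI[of _ "x0 \<oplus>\<^bsub>N\<^esub> x"]) simp_all
  qed
  moreover have "F f = \<zero>\<^bsub>J\<^esub>" if "f \<in> ?D" "\<forall>x\<in>S. f x = \<zero>\<^bsub>J\<^esub>" for f
    using mod_hom_vanishing_on_generators[OF N S(3,2) that(1)] that(2)
      D.submodule_lin(1)[OF DD F module_axioms] by simp
  ultimately show thesis using that by blast
qed

end

lemma (in artin_envelope) functionals_separate:
  assumes N: "module R N" and fg: "fin_gen R N" and xy: "x \<in> carrier N" "y \<in> carrier N"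
    and eq: "\<And>f. f \<in> mod_hom R N J \<Longrightarrow> f x = f y"
  shows "x = y"
proof (rule ccontr)
  interpret N: module R N by fact
  assume "x \<noteq> y"
  then have "x \<ominus>\<^bsub>N\<^esub> y \<noteq> \<zero>\<^bsub>N\<^esub>" using N.minus_eq_zero_imp_eq[of x y] xy by auto
  then obtain f where f: "f \<in> mod_hom R N J" "f (x \<ominus>\<^bsub>N\<^esub> y) \<noteq> \<zero>\<^bsub>J\<^esub>"
    using separate_points[OF N fg, of "x \<ominus>\<^bsub>N\<^esub> y"] N.M.minus_closed[OF xy] by metis
  have "f (x \<ominus>\<^bsub>N\<^esub> y) = f x \<ominus>\<^bsub>J\<^esub> f y"
    using N.submodule_lin(2)[OF N.carrier_is_submodule mod_hom_lin_on[OF f(1)] module_axioms] xy by simp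
  then show False
    using f eq[of f] mod_homD(1)[OF f(1)] xy by (simp add: a_minus_def M.r_neg)
qed

section \<open>Modules over an Artin algebra\<close>

text \<open>Most of the theory does not see on which side the algebra acts.\<close>

definition sided_module :: "'l ring \<Rightarrow> ('l, 'n) module \<Rightarrow> bool"
  where "sided_module L N \<longleftrightarrow> left_module L N \<or> right_module L N"

lemma sided_moduleD:
  assumes "sided_module L N"
  shows "ring L" "abelian_group N"
    "a \<in> carrier L \<Longrightarrow> x \<in> carrier N \<Longrightarrow> a \<odot>\<^bsub>N\<^esub> x \<in> carrier N"
    "a \<in> carrier L \<Longrightarrow> b \<in> carrier L \<Longrightarrow> x \<in> carrier N \<Longrightarrow> (a \<oplus>\<^bsub>L\<^esub> b) \<odot>\<^bsub>N\<^esub> x = a \<odot>\<^bsub>N\<^esub> x \<oplus>\<^bsub>N\<^esub> b \<odot>\<^bsub>N\<^esub> x"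
    "a \<in> carrier L \<Longrightarrow> x \<in> carrier N \<Longrightarrow> y \<in> carrier N \<Longrightarrow> a \<odot>\<^bsub>N\<^esub> (x \<oplus>\<^bsub>N\<^esub> y) = a \<odot>\<^bsub>N\<^esub> x \<oplus>\<^bsub>N\<^esub> a \<odot>\<^bsub>N\<^esub> y"
    "x \<in> carrier N \<Longrightarrow> \<one>\<^bsub>L\<^esub> \<odot>\<^bsub>N\<^esub> x = x"
  using assms
  by (auto simp: sided_module_def left_module_def right_module_def left_module_axioms_def right_module_axioms_def)

text \<open>Acting by \<open>b\<close> and then by \<open>a\<close> is the action of
  \<open>a b\<close> on a left module and of \<open>b a\<close> on a right one. Both conventions
  share that the composite is again some scalar and that the order is immaterial for commuting
  elements.\<close>

lemma sided_module_smult_smult: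
  assumes N: "sided_module L N" and ab: "a \<in> carrier L" "b \<in> carrier L"
  shows "\<exists>c\<in>carrier L. \<forall>x\<in>carrier N. a \<odot>\<^bsub>N\<^esub> (b \<odot>\<^bsub>N\<^esub> x) = c \<odot>\<^bsub>N\<^esub> x"
    "x \<in> carrier N \<Longrightarrow> a \<otimes>\<^bsub>L\<^esub> b = b \<otimes>\<^bsub>L\<^esub> a \<Longrightarrow> a \<odot>\<^bsub>N\<^esub> (b \<odot>\<^bsub>N\<^esub> x) = b \<odot>\<^bsub>N\<^esub> (a \<odot>\<^bsub>N\<^esub> x)"
    "x \<in> carrier N \<Longrightarrow> a \<otimes>\<^bsub>L\<^esub> b = b \<otimes>\<^bsub>L\<^esub> a \<Longrightarrow> (a \<otimes>\<^bsub>L\<^esub> b) \<odot>\<^bsub>N\<^esub> x = a \<odot>\<^bsub>N\<^esub> (b \<odot>\<^bsub>N\<^esub> x)"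
proof -
  interpret ring L by (rule sided_moduleD(1)[OF N])
  have assoc: "(\<forall>a\<in>carrier L. \<forall>b\<in>carrier L. \<forall>x\<in>carrier N. (a \<otimes>\<^bsub>L\<^esub> b) \<odot>\<^bsub>N\<^esub> x = a \<odot>\<^bsub>N\<^esub> (b \<odot>\<^bsub>N\<^esub> x)) \<or>
      (\<forall>a\<in>carrier L. \<forall>b\<in>carrier L. \<forall>x\<in>carrier N. (a \<otimes>\<^bsub>L\<^esub> b) \<odot>\<^bsub>N\<^esub> x = b \<odot>\<^bsub>N\<^esub> (a \<odot>\<^bsub>N\<^esub> x))"
    using N unfolding sided_module_def
    by (auto simp: left_module_def right_module_def left_module_axioms_def right_module_axioms_def)
  show "\<exists>c\<in>carrier L. \<forall>x\<in>carrier N. a \<odot>\<^bsub>N\<^esub> (b \<odot>\<^bsub>N\<^esub> x) = c \<odot>\<^bsub>N\<^esub> x"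
    "x \<in> carrier N \<Longrightarrow> a \<otimes>\<^bsub>L\<^esub> b = b \<otimes>\<^bsub>L\<^esub> a \<Longrightarrow> a \<odot>\<^bsub>N\<^esub> (b \<odot>\<^bsub>N\<^esub> x) = b \<odot>\<^bsub>N\<^esub> (a \<odot>\<^bsub>N\<^esub> x)"
    "x \<in> carrier N \<Longrightarrow> a \<otimes>\<^bsub>L\<^esub> b = b \<otimes>\<^bsub>L\<^esub> a \<Longrightarrow> (a \<otimes>\<^bsub>L\<^esub> b) \<odot>\<^bsub>N\<^esub> x = a \<odot>\<^bsub>N\<^esub> (b \<odot>\<^bsub>N\<^esub> x)"
    using assoc ab by (metis m_closed)+
qed

lemma sided_module_zero:
  assumes N: "sided_module L N"
  shows "a \<in> carrier L \<Longrightarrow> a \<odot>\<^bsub>N\<^esub> \<zero>\<^bsub>N\<^esub> = \<zero>\<^bsub>N\<^esub>" "x \<in> carrier N \<Longrightarrow> \<zero>\<^bsub>L\<^esub> \<odot>\<^bsub>N\<^esub> x = \<zero>\<^bsub>N\<^esub>"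
proof -
  note ND = sided_moduleD[OF N]
  interpret L: ring L by (rule ND(1))
  interpret N: abelian_group N by (rule ND(2))
  show "a \<odot>\<^bsub>N\<^esub> \<zero>\<^bsub>N\<^esub> = \<zero>\<^bsub>N\<^esub>" if "a \<in> carrier L"
    using ND(5)[OF that, of "\<zero>\<^bsub>N\<^esub>" "\<zero>\<^bsub>N\<^esub>"] ND(3)[OF that, of "\<zero>\<^bsub>N\<^esub>"] by simp
  show "\<zero>\<^bsub>L\<^esub> \<odot>\<^bsub>N\<^esub> x = \<zero>\<^bsub>N\<^esub>" if "x \<in> carrier N"
    using ND(4)[of "\<zero>\<^bsub>L\<^esub>" "\<zero>\<^bsub>L\<^esub>", OF _ _ that] ND(3)[of "\<zero>\<^bsub>L\<^esub>", OF _ that] by simp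
qed

lemma a_inv_restrict_scalars: "a_inv (restrict_scalars h N) = a_inv N"
  by (simp add: a_inv_def m_inv_def fun_eq_iff)

lemma fin_gen_image:
  assumes M: "module R M" and N: "module R N" and f: "lin_on R M N (carrier M) f"
    and surj: "f ` carrier M = carrier N" and fg: "fin_gen R M"
  shows "fin_gen R N"
proof -
  interpret M: module R M by fact
  interpret N: module R N by fact
  obtain S where S: "finite S" "S \<subseteq> carrier M" "\<And>H. submodule H R M \<Longrightarrow> S \<subseteq> H \<Longrightarrow> H = carrier M"
    using fg unfolding fin_gen_def by auto
  have "H = carrier N" if H: "submodule H R N" "f ` S \<subseteq> H" for H
  proof -
    have "submodule {x \<in> carrier M. f x \<in> H} R M"
      by (rule M.submodule_vimage[OF M.carrier_is_submodule f N H(1)])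
    then have "{x \<in> carrier M. f x \<in> H} = carrier M" by (rule S(3)) (use S(2) H(2) in auto)
    then have "f ` carrier M \<subseteq> H" by blast
    then have "carrier N \<subseteq> H" using surj by simp
    then show ?thesis using N.submoduleD(1)[OF H(1)] by blast
  qed
  moreover have "finite (f ` S)" "f ` S \<subseteq> carrier N" using S surj by auto
  ultimately show ?thesis unfolding fin_gen_def by blast
qed

section \<open>Restriction of scalars to the base ring\<close>

locale artinian_algebra =
  fixes R :: "'r ring" and L :: "'l ring" and \<eta> :: "'r \<Rightarrow> 'l"
  assumes algebra: "artin_algebra R L \<eta>"
begin

lemma R_cring: "cring R" and L_ring: "ring L"
  and \<eta>_closed: "r \<in> carrier R \<Longrightarrow> \<eta> r \<in> carrier L"
  and \<eta>_add: "r \<in> carrier R \<Longrightarrow> s \<in> carrier R \<Longrightarrow> \<eta> (r \<oplus>\<^bsub>R\<^esub> s) = \<eta> r \<oplus>\<^bsub>L\<^esub> \<eta> s"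
  and \<eta>_mult: "r \<in> carrier R \<Longrightarrow> s \<in> carrier R \<Longrightarrow> \<eta> (r \<otimes>\<^bsub>R\<^esub> s) = \<eta> r \<otimes>\<^bsub>L\<^esub> \<eta> s"
  and \<eta>_one: "\<eta> \<one>\<^bsub>R\<^esub> = \<one>\<^bsub>L\<^esub>"
  and \<eta>_central: "r \<in> carrier R \<Longrightarrow> a \<in> carrier L \<Longrightarrow> \<eta> r \<otimes>\<^bsub>L\<^esub> a = a \<otimes>\<^bsub>L\<^esub> \<eta> r"
  using algebra unfolding artin_algebra_def artinian_cring_def ring_hom_def by auto

lemma algebra_module_simps [simp]:
  "carrier (algebra_module \<eta> L) = carrier L" "\<zero>\<^bsub>algebra_module \<eta> L\<^esub> = \<zero>\<^bsub>L\<^esub>"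
  "x \<oplus>\<^bsub>algebra_module \<eta> L\<^esub> y = x \<oplus>\<^bsub>L\<^esub> y" "r \<odot>\<^bsub>algebra_module \<eta> L\<^esub> x = \<eta> r \<otimes>\<^bsub>L\<^esub> x"
  by (simp_all add: algebra_module_def)

lemma module_algebra: "module R (algebra_module \<eta> L)"
proof -
  interpret L: ring L by (rule L_ring)
  show ?thesis
    by (intro moduleI R_cring abelian_group_cong[OF L.is_abelian_group])
      (auto simp: algebra_module_def \<eta>_closed \<eta>_add \<eta>_mult \<eta>_one L.l_distr L.r_distr L.m_assoc)
qed

lemma restrict_module:
  assumes "sided_module L N"
  shows "module R (restrict_scalars \<eta> N)"
proof -
  note ND = sided_moduleD[OF assms]
  show ?thesis
    by (intro moduleI R_cring abelian_group_cong[OF ND(2)])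
      (auto simp: ND(3-6) sided_module_smult_smult(3)[OF assms _ _ _ \<eta>_central] \<eta>_closed \<eta>_add \<eta>_mult \<eta>_one)
qed

lemma smult_central:
  assumes "sided_module L N" "r \<in> carrier R" "a \<in> carrier L" "x \<in> carrier N"
  shows "a \<odot>\<^bsub>N\<^esub> (\<eta> r \<odot>\<^bsub>N\<^esub> x) = \<eta> r \<odot>\<^bsub>N\<^esub> (a \<odot>\<^bsub>N\<^esub> x)"
  using sided_module_smult_smult(2)[OF assms(1) \<eta>_closed[OF assms(2)] assms(3,4) \<eta>_central[OF assms(2,3)]] by simp

lemma sided_submodule_iff:
  assumes N: "sided_module L N"
  shows "submodule H L N \<longleftrightarrow> submodule H R (restrict_scalars \<eta> N) \<and>
    (\<forall>a\<in>carrier L. \<forall>x\<in>H. a \<odot>\<^bsub>N\<^esub> x \<in> H)"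
proof -
  have "subgroup H (add_monoid (restrict_scalars \<eta> N)) \<longleftrightarrow> subgroup H (add_monoid N)"
    using a_inv_restrict_scalars[of \<eta> N] by (simp add: subgroup_def a_inv_def)
  then show ?thesis
    using \<eta>_closed by (auto simp: submodule_def submodule_axioms_def)
qed

lemma sided_submoduleI:
  assumes N: "sided_module L N" and "H \<subseteq> carrier N" "\<zero>\<^bsub>N\<^esub> \<in> H"
    and "\<And>x y. x \<in> H \<Longrightarrow> y \<in> H \<Longrightarrow> x \<oplus>\<^bsub>N\<^esub> y \<in> H"
    and "\<And>a x. a \<in> carrier L \<Longrightarrow> x \<in> H \<Longrightarrow> a \<odot>\<^bsub>N\<^esub> x \<in> H"
  shows "submodule H L N"
proof -
  interpret module R "restrict_scalars \<eta> N" by (rule restrict_module) fact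
  have "submodule H R (restrict_scalars \<eta> N)"
    using assms(2-5) \<eta>_closed by (intro submodule_if_closed) auto
  then show ?thesis using assms(5) by (simp add: sided_submodule_iff[OF N])
qed

text \<open>Since \<open>L\<close> is finitely generated over \<open>R\<close>, the products of its
  \<open>R\<close>-generators with \<open>L\<close>-generators of \<open>N\<close> generate
  \<open>N\<close> over \<open>R\<close>. This moves every question of finiteness to
  \<open>R\<close>.\<close>

lemma fin_gen_restrict:
  assumes N: "sided_module L N"
  shows "fin_gen R (restrict_scalars \<eta> N) \<longleftrightarrow> fin_gen L N"
proof
  assume "fin_gen R (restrict_scalars \<eta> N)"
  then show "fin_gen L N" unfolding fin_gen_def sided_submodule_iff[OF N] by auto
next
  note ND = sided_moduleD[OF N]
  interpret N: module R "restrict_scalars \<eta> N" by (rule restrict_module) fact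
  interpret L: module R "algebra_module \<eta> L" by (rule module_algebra)
  assume "fin_gen L N"
  then obtain T where T: "finite T" "T \<subseteq> carrier N" "\<And>H. submodule H L N \<Longrightarrow> T \<subseteq> H \<Longrightarrow> H = carrier N"
    unfolding fin_gen_def by metis
  obtain S where S: "finite S" "S \<subseteq> carrier L"
    "\<And>H. submodule H R (algebra_module \<eta> L) \<Longrightarrow> S \<subseteq> H \<Longrightarrow> H = carrier L"
    using algebra unfolding artin_algebra_def fin_gen_def by auto
  let ?G = "(\<lambda>(a, x). a \<odot>\<^bsub>N\<^esub> x) ` (S \<times> T)"
  have "H = carrier N" if H: "submodule H R (restrict_scalars \<eta> N)" "?G \<subseteq> H" for H
  proof -
    note HD = N.submoduleD[OF H(1)]
    have HN: "x \<in> carrier N" if "x \<in> H" for x using HD(1) that by auto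
    have aH: "a \<odot>\<^bsub>N\<^esub> x \<in> H" if a: "a \<in> carrier L" and x: "x \<in> T" for a x
    proof -
      have xN: "x \<in> carrier N" using x T(2) by blast
      have "\<zero>\<^bsub>L\<^esub> \<odot>\<^bsub>N\<^esub> x = \<zero>\<^bsub>N\<^esub>" by (rule sided_module_zero(2)[OF N xN])
      then have "submodule {a \<in> carrier L. a \<odot>\<^bsub>N\<^esub> x \<in> H} R (algebra_module \<eta> L)"
        using HD xN ND(4) sided_module_smult_smult(3)[OF N \<eta>_closed _ xN \<eta>_central] L.M.zero_closed L.M.add.m_closed L.smult_closed
        by (intro L.submodule_if_closed) auto
      then have "{a \<in> carrier L. a \<odot>\<^bsub>N\<^esub> x \<in> H} = carrier L" by (rule S(3)) (use H(2) S(2) x in auto)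
      then show ?thesis using a by blast
    qed
    \<comment> \<open>The largest \<open>L\<close>-submodule contained in \<open>H\<close>. It
      contains the generators \<open>T\<close>, hence is everything.\<close>
    let ?K = "{x \<in> carrier N. \<forall>a\<in>carrier L. a \<odot>\<^bsub>N\<^esub> x \<in> H}"
    have "submodule ?K L N"
    proof (rule sided_submoduleI[OF N])
      show "\<zero>\<^bsub>N\<^esub> \<in> ?K" using HD(2) N.M.zero_closed sided_module_zero(1)[OF N] by simp
      show "x \<oplus>\<^bsub>N\<^esub> y \<in> ?K" if "x \<in> ?K" "y \<in> ?K" for x y
        using that HD(3) ND(5) N.M.add.m_closed by auto
      show "b \<odot>\<^bsub>N\<^esub> x \<in> ?K" if "b \<in> carrier L" "x \<in> ?K" for b x
        using that ND(3) sided_module_smult_smult(1)[OF N, of _ b] by fastforce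
    qed blast
    then have "?K = carrier N" by (rule T(3)) (use T(2) aH in auto)
    then have "carrier N \<subseteq> H" using ND(6) ring.ring_simprules(6)[OF L_ring] by (metis (mono_tags, lifting) mem_Collect_eq subsetI)
    then show ?thesis using HN by blast
  qed
  moreover have "finite ?G" using S T by simp
  moreover have "?G \<subseteq> carrier N" using S(2) T(2) ND(3) by (auto simp: subset_iff)
  ultimately show "fin_gen R (restrict_scalars \<eta> N)"
    unfolding fin_gen_def restrict_scalars_simps by (intro exI[of _ ?G]) auto
qed

lemma mod_hom_restrict:
  assumes "h \<in> mod_hom L N N'"
  shows "h \<in> mod_hom R (restrict_scalars \<eta> N) (restrict_scalars \<eta> N')"
  using assms \<eta>_closed unfolding mod_hom_def by auto

lemma fin_gen_bij:
  assumes N: "sided_module L N" and P: "sided_module L P" and f: "f \<in> mod_hom L P N"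
    and "f ` carrier P = carrier N" "fin_gen L P"
  shows "fin_gen L N"
  using fin_gen_image[OF restrict_module[OF P] restrict_module[OF N]
      lin_on_subset[OF mod_hom_lin_on[OF mod_hom_restrict[OF f]]]] assms(4,5)
  by (simp add: fin_gen_restrict N P)

text \<open>An element is described by coefficients with respect to finitely many generators. With
  lists one type serves any number of generators, so a single embedding \<open>\<iota>\<close> can
  provide room for all finitely generated modules.\<close>

lemma coded_by_lists:
  assumes N: "sided_module L N" and fg: "fin_gen L N"
  obtains c :: "'n \<Rightarrow> 'l list" where "inj_on c (carrier N)"
proof -
  note ND = sided_moduleD[OF N]
  interpret N: module R "restrict_scalars \<eta> N" by (rule restrict_module) fact
  obtain T where T: "finite T" "T \<subseteq> carrier N" "\<And>H. submodule H L N \<Longrightarrow> T \<subseteq> H \<Longrightarrow> H = carrier N"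
    using fg unfolding fin_gen_def by metis
  have one: "\<one>\<^bsub>L\<^esub> \<in> carrier L" by (rule ring.ring_simprules(6)[OF L_ring])
  have add: "a \<in> carrier L \<Longrightarrow> b \<in> carrier L \<Longrightarrow> a \<oplus>\<^bsub>L\<^esub> b \<in> carrier L" for a b
    by (rule ring.ring_simprules(1)[OF L_ring])
  have "\<exists>K (e :: 'l list \<Rightarrow> 'n). submodule K L N \<and> T \<subseteq> K \<and> K \<subseteq> range e"
    using T(1,2)
  proof (induction T rule: finite_induct)
    case empty
    have "submodule {\<zero>\<^bsub>N\<^esub>} L N"
    proof (rule sided_submoduleI[OF N])
      show "a \<odot>\<^bsub>N\<^esub> x \<in> {\<zero>\<^bsub>N\<^esub>}" if "a \<in> carrier L" "x \<in> {\<zero>\<^bsub>N\<^esub>}" for a x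
        using that sided_module_zero(1)[OF N] by simp
    qed (use N.M.zero_closed N.M.l_zero in auto)
    then show ?case by (intro exI[of _ "{\<zero>\<^bsub>N\<^esub>}"] exI[of _ "\<lambda>_. \<zero>\<^bsub>N\<^esub>"]) auto
  next
    case (insert t T)
    then obtain K and e :: "'l list \<Rightarrow> 'n" where K: "submodule K L N" "T \<subseteq> K" "K \<subseteq> range e" by auto
    have t: "t \<in> carrier N" using insert by simp
    have KR: "submodule K R (restrict_scalars \<eta> N)" and KL: "\<And>a x. a \<in> carrier L \<Longrightarrow> x \<in> K \<Longrightarrow> a \<odot>\<^bsub>N\<^esub> x \<in> K"
      using K(1) by (simp_all add: sided_submodule_iff[OF N])
    note KD = N.submoduleD[OF KR, unfolded restrict_scalars_simps]
    have KN: "k \<in> carrier N" if "k \<in> K" for k using KD(1) that by blast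
    let ?K = "{k \<oplus>\<^bsub>N\<^esub> a \<odot>\<^bsub>N\<^esub> t | k a. k \<in> K \<and> a \<in> carrier L}"
    have zero_t: "\<eta> \<zero>\<^bsub>R\<^esub> \<odot>\<^bsub>N\<^esub> t = \<zero>\<^bsub>N\<^esub>" using N.smult_l_null t by simp
    have KK: "k \<in> ?K" if "k \<in> K" for k
    proof -
      have "k = k \<oplus>\<^bsub>N\<^esub> \<eta> \<zero>\<^bsub>R\<^esub> \<odot>\<^bsub>N\<^esub> t" using N.M.r_zero KN[OF that] zero_t by simp
      then show ?thesis using that \<eta>_closed[OF N.R.zero_closed] by blast
    qed
    have "t = \<zero>\<^bsub>N\<^esub> \<oplus>\<^bsub>N\<^esub> \<one>\<^bsub>L\<^esub> \<odot>\<^bsub>N\<^esub> t" using ND(6) t N.M.l_zero by simp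
    then have tK: "t \<in> ?K" using KD(2) one by blast
    have sub: "submodule ?K L N"
    proof (rule sided_submoduleI[OF N])
      show "?K \<subseteq> carrier N" using KN t ND(3) N.M.add.m_closed by auto
      show "\<zero>\<^bsub>N\<^esub> \<in> ?K" using KK KD(2) by simp
      show "x \<oplus>\<^bsub>N\<^esub> y \<in> ?K" if "x \<in> ?K" "y \<in> ?K" for x y
      proof -
        obtain k a k' a' where ka: "k \<in> K" "a \<in> carrier L" "x = k \<oplus>\<^bsub>N\<^esub> a \<odot>\<^bsub>N\<^esub> t"
          "k' \<in> K" "a' \<in> carrier L" "y = k' \<oplus>\<^bsub>N\<^esub> a' \<odot>\<^bsub>N\<^esub> t"
          using \<open>x \<in> ?K\<close> \<open>y \<in> ?K\<close> by blast
        have "x \<oplus>\<^bsub>N\<^esub> y = (k \<oplus>\<^bsub>N\<^esub> k') \<oplus>\<^bsub>N\<^esub> (a \<oplus>\<^bsub>L\<^esub> a') \<odot>\<^bsub>N\<^esub> t"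
          using ka KN t ND(3,4) N.M.a_ac N.M.add.m_closed by simp
        then show ?thesis using KD(3)[OF ka(1,4)] add[OF ka(2,5)] by blast
      qed
      show "b \<odot>\<^bsub>N\<^esub> x \<in> ?K" if b: "b \<in> carrier L" and x: "x \<in> ?K" for b x
      proof -
        obtain k a where ka: "k \<in> K" "a \<in> carrier L" "x = k \<oplus>\<^bsub>N\<^esub> a \<odot>\<^bsub>N\<^esub> t" using x by blast
        obtain c where c: "c \<in> carrier L" "b \<odot>\<^bsub>N\<^esub> (a \<odot>\<^bsub>N\<^esub> t) = c \<odot>\<^bsub>N\<^esub> t" using sided_module_smult_smult(1)[OF N b ka(2)] t by blast
        have "b \<odot>\<^bsub>N\<^esub> x = b \<odot>\<^bsub>N\<^esub> k \<oplus>\<^bsub>N\<^esub> c \<odot>\<^bsub>N\<^esub> t" using ka b KN t ND(3,5) c(2) by simp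
        then show ?thesis using KL[OF b ka(1)] c(1) by blast
      qed
    qed
    \<comment> \<open>The head of the list is the coefficient of the new generator \<open>t\<close>,
      the tail a code for the remaining part.\<close>
    define e' where "e' xs = e (tl xs) \<oplus>\<^bsub>N\<^esub> hd xs \<odot>\<^bsub>N\<^esub> t" for xs
    have "?K \<subseteq> range e'"
    proof
      fix x assume "x \<in> ?K"
      then obtain k a where ka: "k \<in> K" "x = k \<oplus>\<^bsub>N\<^esub> a \<odot>\<^bsub>N\<^esub> t" by blast
      then obtain xs where "k = e xs" using K(3) by blast
      then have "x = e' (a # xs)" using ka by (simp add: e'_def)
      then show "x \<in> range e'" by blast
    qed
    moreover have "insert t T \<subseteq> ?K" using tK KK K(2) by blast
    ultimately show ?case using sub by blast
  qed
  then obtain K and e :: "'l list \<Rightarrow> 'n" where K: "submodule K L N" "T \<subseteq> K" "K \<subseteq> range e" by blast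
  have "carrier N \<subseteq> range e" using T(3)[OF K(1,2)] K(3) by simp
  \<comment> \<open>\<open>e\<close> decodes lists to elements; choosing one code for each element
    gives an injection.\<close>
  then have "inj_on (inv_into UNIV e) (carrier N)" by (metis inj_on_inv_into inj_on_subset)
  then show thesis by (rule that)
qed

end

section \<open>The dual of a module over an Artin algebra\<close>

locale artin_duality = artin_envelope R J i + artinian_algebra R L \<eta>
  for R :: "'r ring" (structure) and J :: "('r, 'e) module" and i and L :: "'l ring" and \<eta>
begin

abbreviation D :: "('l, 'n) module \<Rightarrow> ('l, 'n \<Rightarrow> 'e) module"
  where "D \<equiv> D_obj R J \<eta>"

abbreviation scalars :: "('l, 'n) module \<Rightarrow> ('r, 'n) module"
  where "scalars \<equiv> restrict_scalars \<eta>"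

lemma D_carrierD:
  assumes "f \<in> carrier (D N)"
  shows "x \<in> carrier N \<Longrightarrow> f x \<in> carrier J"
    "x \<in> carrier N \<Longrightarrow> y \<in> carrier N \<Longrightarrow> f (x \<oplus>\<^bsub>N\<^esub> y) = f x \<oplus>\<^bsub>J\<^esub> f y"
    "r \<in> carrier R \<Longrightarrow> x \<in> carrier N \<Longrightarrow> f (\<eta> r \<odot>\<^bsub>N\<^esub> x) = r \<odot>\<^bsub>J\<^esub> f x"
    "x \<notin> carrier N \<Longrightarrow> f x = undefined"
  using mod_homD[of f R "scalars N" J] assms by (auto simp: D_obj_simps)

lemma D_carrierI:
  assumes "\<And>x. x \<in> carrier N \<Longrightarrow> f x \<in> carrier J"
    "\<And>x y. x \<in> carrier N \<Longrightarrow> y \<in> carrier N \<Longrightarrow> f (x \<oplus>\<^bsub>N\<^esub> y) = f x \<oplus>\<^bsub>J\<^esub> f y"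
    "\<And>r x. r \<in> carrier R \<Longrightarrow> x \<in> carrier N \<Longrightarrow> f (\<eta> r \<odot>\<^bsub>N\<^esub> x) = r \<odot>\<^bsub>J\<^esub> f x"
    "\<And>x. x \<notin> carrier N \<Longrightarrow> f x = undefined"
  shows "f \<in> carrier (D N)"
  unfolding D_obj_simps by (rule mod_homI) (use assms in auto)

lemma D_carrier_eqI:
  assumes "f \<in> carrier (D N)" "g \<in> carrier (D N)" "\<And>x. x \<in> carrier N \<Longrightarrow> f x = g x"
  shows "f = g"
  using assms D_carrierD(4) by (metis ext)

lemma D_abelian_group:
  assumes "sided_module L N"
  shows "abelian_group (D N)"
proof -
  interpret D: module R "dual (scalars N)" by (rule dual_module[OF restrict_module[OF assms]])
  show ?thesis
    by (rule abelian_group_cong[OF D.abelian_group_axioms]) (simp_all add: D_obj_def restrict_scalars_ident)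
qed

lemma D_smult_closed:
  assumes N: "sided_module L N" and "a \<in> carrier L" "f \<in> carrier (D N)"
  shows "a \<odot>\<^bsub>D N\<^esub> f \<in> carrier (D N)"
  using D_carrierD(1-3)[OF assms(3)] assms(2) sided_moduleD(3,5)[OF N] \<eta>_closed smult_central[OF N]
    abelian_groupE(1)[OF sided_moduleD(2)[OF N]]
  by (intro D_carrierI) (auto simp: D_obj_simps)

lemma D_smult_distr:
  assumes N: "sided_module L N" and a: "a \<in> carrier L" "b \<in> carrier L"
    and f: "f \<in> carrier (D N)" "g \<in> carrier (D N)"
  shows "(a \<oplus>\<^bsub>L\<^esub> b) \<odot>\<^bsub>D N\<^esub> f = a \<odot>\<^bsub>D N\<^esub> f \<oplus>\<^bsub>D N\<^esub> b \<odot>\<^bsub>D N\<^esub> f"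
    "a \<odot>\<^bsub>D N\<^esub> (f \<oplus>\<^bsub>D N\<^esub> g) = a \<odot>\<^bsub>D N\<^esub> f \<oplus>\<^bsub>D N\<^esub> a \<odot>\<^bsub>D N\<^esub> g"
  using D_carrierD[OF f(1)] D_carrierD[OF f(2)] a sided_moduleD(3-5)[OF N]
  by (auto simp: D_obj_simps fun_eq_iff restrict_def)

lemma D_smult_one:
  assumes "sided_module L N" "f \<in> carrier (D N)"
  shows "\<one>\<^bsub>L\<^esub> \<odot>\<^bsub>D N\<^esub> f = f"
  using D_carrierD(4)[OF assms(2)] sided_moduleD(6)[OF assms(1)]
  by (auto simp: D_obj_simps fun_eq_iff restrict_def)

text \<open>Scalars act on functionals by precomposition, which reverses their order; so the dual
  changes sides.\<close>

lemma D_right_module: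
  assumes "left_module L N"
  shows "right_module L (D N)"
proof -
  have N: "sided_module L N" using assms by (simp add: sided_module_def)
  interpret N: left_module L N by fact
  have "(a \<otimes>\<^bsub>L\<^esub> b) \<odot>\<^bsub>D N\<^esub> f = b \<odot>\<^bsub>D N\<^esub> (a \<odot>\<^bsub>D N\<^esub> f)"
    if "a \<in> carrier L" "b \<in> carrier L" for a b f
    using that N.smult_closed N.smult_assoc by (auto simp: D_obj_simps fun_eq_iff restrict_def)
  then show ?thesis
    using D_smult_distr[OF N] D_smult_closed[OF N] D_smult_one[OF N]
    by (intro right_module.intro right_module_axioms.intro L_ring D_abelian_group N)
qed

lemma D_left_module:
  assumes "right_module L N"
  shows "left_module L (D N)"
proof -
  have N: "sided_module L N" using assms by (simp add: sided_module_def)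
  interpret N: right_module L N by fact
  have "(a \<otimes>\<^bsub>L\<^esub> b) \<odot>\<^bsub>D N\<^esub> f = a \<odot>\<^bsub>D N\<^esub> (b \<odot>\<^bsub>D N\<^esub> f)"
    if "a \<in> carrier L" "b \<in> carrier L" for a b f
    using that N.smult_closed N.smult_assoc_right by (auto simp: D_obj_simps fun_eq_iff restrict_def)
  then show ?thesis
    using D_smult_distr[OF N] D_smult_closed[OF N] D_smult_one[OF N]
    by (intro left_module.intro left_module_axioms.intro L_ring D_abelian_group N)
qed

lemma D_sided:
  assumes "sided_module L N"
  shows "sided_module L (D N)"
  using assms D_left_module D_right_module unfolding sided_module_def by blast

lemma D_fin_gen:
  assumes N: "sided_module L N" and fg: "fin_gen L N"
  shows "fin_gen L (D N)"
proof -
  have "fin_gen R (dual (scalars N))"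
    by (rule dual_fin_gen[OF restrict_module[OF N]]) (simp add: fin_gen_restrict N fg)
  then show ?thesis
    using fin_gen_restrict[OF D_sided[OF N]] by (simp add: restrict_scalars_D_obj)
qed

lemma D_separates:
  assumes N: "sided_module L N" and fg: "fin_gen L N" and xy: "x \<in> carrier N" "y \<in> carrier N"
    and eq: "\<And>f. f \<in> carrier (D N) \<Longrightarrow> f x = f y"
  shows "x = y"
  by (rule functionals_separate[OF restrict_module[OF N]])
    (use xy eq fg in \<open>simp_all add: fin_gen_restrict[OF N] D_obj_simps\<close>)

lemma D_functional_is_evaluation:
  assumes N: "sided_module L N" and fg: "fin_gen L N"
    and F: "\<And>f. f \<in> carrier (D N) \<Longrightarrow> F f \<in> carrier J"
      "\<And>f g. f \<in> carrier (D N) \<Longrightarrow> g \<in> carrier (D N) \<Longrightarrow> F (f \<oplus>\<^bsub>D N\<^esub> g) = F f \<oplus>\<^bsub>J\<^esub> F g"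
      "\<And>r f. r \<in> carrier R \<Longrightarrow> f \<in> carrier (D N) \<Longrightarrow> F (\<eta> r \<odot>\<^bsub>D N\<^esub> f) = r \<odot>\<^bsub>J\<^esub> F f"
  obtains x where "x \<in> carrier N" "\<And>f. f \<in> carrier (D N) \<Longrightarrow> F f = f x"
proof -
  have "lin_on R (dual (scalars N)) J (mod_hom R (scalars N) J) F"
    using F unfolding lin_on_def D_obj_simps restrict_scalars_ident by simp
  then show thesis
    using functional_is_evaluation[OF restrict_module[OF N]] fin_gen_restrict[OF N] fg that
    unfolding D_obj_simps restrict_scalars_simps by metis
qed

lemma D_map_apply: "g \<in> carrier (D N') \<Longrightarrow> x \<in> carrier N \<Longrightarrow> D_map R J \<eta> N N' h g x = g (h x)"
  by (simp add: D_map_def compose_def)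

lemma D_map_closed:
  assumes N: "sided_module L N" and h: "h \<in> mod_hom L N N'" and g: "g \<in> carrier (D N')"
  shows "D_map R J \<eta> N N' h g \<in> carrier (D N)"
  using mod_homD(1-3)[OF mod_hom_restrict[OF h]] D_carrierD(1-3)[OF g] g
    abelian_groupE(1)[OF sided_moduleD(2)[OF N]] sided_moduleD(3)[OF N] \<eta>_closed
  by (intro D_carrierI) (auto simp: D_map_def compose_def)

lemma D_map_hom:
  assumes N: "sided_module L N" and N': "sided_module L N'" and h: "h \<in> mod_hom L N N'"
  shows "D_map R J \<eta> N N' h \<in> mod_hom L (D N') (D N)"
proof (rule mod_homI)
  interpret N': abelian_group "D N'" by (rule D_abelian_group) fact
  interpret N: abelian_group "D N" by (rule D_abelian_group) fact
  note app = D_map_apply and closed = D_map_closed[OF N h]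
  note hD = mod_homD[OF h]
  show "D_map R J \<eta> N N' h f \<in> carrier (D N)" if "f \<in> carrier (D N')" for f by (rule closed) fact
  show "D_map R J \<eta> N N' h (f \<oplus>\<^bsub>D N'\<^esub> g) = D_map R J \<eta> N N' h f \<oplus>\<^bsub>D N\<^esub> D_map R J \<eta> N N' h g"
    if "f \<in> carrier (D N')" "g \<in> carrier (D N')" for f g
    by (rule D_carrier_eqI[of _ N])
      (use that hD(1) in \<open>simp_all add: closed app N'.a_closed N.a_closed\<close>, simp add: D_obj_simps app that)
  show "D_map R J \<eta> N N' h (a \<odot>\<^bsub>D N'\<^esub> f) = a \<odot>\<^bsub>D N\<^esub> D_map R J \<eta> N N' h f"
    if "a \<in> carrier L" "f \<in> carrier (D N')" for a f
    by (rule D_carrier_eqI[of _ N])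
      (use that hD(1) in \<open>simp_all add: closed app D_smult_closed N N'\<close>,
       use sided_moduleD(3)[OF N] hD in \<open>simp add: D_obj_simps app that\<close>)
qed (simp add: D_map_def)

text \<open>Faithfulness of \<open>D\<close>: if all functionals agree on \<open>h x\<close> and
  \<open>k x\<close>, the two points are equal.\<close>

lemma D_map_inj:
  assumes N': "sided_module L N'" "fin_gen L N'"
    and h: "h \<in> mod_hom L N N'" "k \<in> mod_hom L N N'" and eq: "D_map R J \<eta> N N' h = D_map R J \<eta> N N' k"
  shows "h = k"
proof (rule mod_hom_eqI[OF h])
  fix x assume x: "x \<in> carrier N"
  show "h x = k x"
  proof (rule D_separates[OF N'])
    show "h x \<in> carrier N'" "k x \<in> carrier N'" using mod_homD(1)[OF h(1) x] mod_homD(1)[OF h(2) x] .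
    show "g (h x) = g (k x)" if "g \<in> carrier (D N')" for g
      using D_map_apply[OF that x, of h] D_map_apply[OF that x, of k] eq by simp
  qed
qed

text \<open>Fullness of \<open>D\<close>. For fixed \<open>x\<close>, the map
  \<open>g \<mapsto> \<phi> g x\<close> is a functional on \<open>D N'\<close>, hence evaluation at
  some point \<open>k x\<close> of \<open>N'\<close>. Linearity of \<open>k\<close> is tested on
  functionals, since these separate points.\<close>

lemma D_map_surj:
  assumes N: "sided_module L N" and N': "sided_module L N'" "fin_gen L N'"
    and \<phi>: "\<phi> \<in> mod_hom L (D N') (D N)"
  obtains h where "h \<in> mod_hom L N N'" "D_map R J \<eta> N N' h = \<phi>"
proof -
  note ND = sided_moduleD[OF N] and ND' = sided_moduleD[OF N'(1)] and \<phi>D = mod_homD[OF \<phi>]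
  interpret N: abelian_group N by (rule ND(2))
  interpret N': abelian_group N' by (rule ND'(2))
  have "\<exists>y\<in>carrier N'. \<forall>g\<in>carrier (D N'). \<phi> g x = g y" if x: "x \<in> carrier N" for x
  proof (rule D_functional_is_evaluation[OF N', of "\<lambda>g. \<phi> g x"])
    fix f g r assume f: "f \<in> carrier (D N')"
    show "\<phi> f x \<in> carrier J" using D_carrierD(1)[OF \<phi>D(1)[OF f] x] .
    show "\<phi> (f \<oplus>\<^bsub>D N'\<^esub> g) x = \<phi> f x \<oplus>\<^bsub>J\<^esub> \<phi> g x" if "g \<in> carrier (D N')"
      using \<phi>D(2)[OF f that] x by (simp add: D_obj_simps)
    show "\<phi> (\<eta> r \<odot>\<^bsub>D N'\<^esub> f) x = r \<odot>\<^bsub>J\<^esub> \<phi> f x" if "r \<in> carrier R"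
      using \<phi>D(3)[OF \<eta>_closed[OF that] f] x D_carrierD(3)[OF \<phi>D(1)[OF f] that x] by (simp add: D_obj_simps)
  qed blast
  then obtain k where k: "\<And>x. x \<in> carrier N \<Longrightarrow> k x \<in> carrier N'"
    "\<And>x g. x \<in> carrier N \<Longrightarrow> g \<in> carrier (D N') \<Longrightarrow> \<phi> g x = g (k x)" by metis
  have "restrict k (carrier N) \<in> mod_hom L N N'"
  proof (rule mod_homI)
    fix x assume x: "x \<in> carrier N"
    show "restrict k (carrier N) x \<in> carrier N'" using x k by simp
    show "restrict k (carrier N) (x \<oplus>\<^bsub>N\<^esub> y) = restrict k (carrier N) x \<oplus>\<^bsub>N'\<^esub> restrict k (carrier N) y"
      if y: "y \<in> carrier N" for y
    proof -
      have "k (x \<oplus>\<^bsub>N\<^esub> y) = k x \<oplus>\<^bsub>N'\<^esub> k y"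
      proof (rule D_separates[OF N'])
        show "g (k (x \<oplus>\<^bsub>N\<^esub> y)) = g (k x \<oplus>\<^bsub>N'\<^esub> k y)" if "g \<in> carrier (D N')" for g
          using k(2)[OF N.a_closed[OF x y] that] k(2)[OF x that] k(2)[OF y that]
            D_carrierD(2)[OF \<phi>D(1)[OF that] x y] D_carrierD(2)[OF that k(1)[OF x] k(1)[OF y]] by simp
      qed (use k x y in auto)
      then show ?thesis using x y by simp
    qed
    show "restrict k (carrier N) (a \<odot>\<^bsub>N\<^esub> x) = a \<odot>\<^bsub>N'\<^esub> restrict k (carrier N) x" if a: "a \<in> carrier L" for a
    proof -
      have "k (a \<odot>\<^bsub>N\<^esub> x) = a \<odot>\<^bsub>N'\<^esub> k x"
      proof (rule D_separates[OF N'])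
        fix g assume g: "g \<in> carrier (D N')"
        have "g (k (a \<odot>\<^bsub>N\<^esub> x)) = (a \<odot>\<^bsub>D N\<^esub> \<phi> g) x"
          using k(2)[OF ND(3)[OF a x] g] x by (simp add: D_obj_simps)
        also have "\<dots> = (a \<odot>\<^bsub>D N'\<^esub> g) (k x)"
          using \<phi>D(3)[OF a g] k(2)[OF x D_smult_closed[OF N'(1) a g]] by simp
        also have "\<dots> = g (a \<odot>\<^bsub>N'\<^esub> k x)" using k(1)[OF x] by (simp add: D_obj_simps)
        finally show "g (k (a \<odot>\<^bsub>N\<^esub> x)) = g (a \<odot>\<^bsub>N'\<^esub> k x)" .
      qed (use k(1) ND(3) ND'(3) a x in auto)
      then show ?thesis using x a ND(3) by simp
    qed
  qed simp
  moreover have "D_map R J \<eta> N N' (restrict k (carrier N)) = \<phi>"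
  proof
    fix g show "D_map R J \<eta> N N' (restrict k (carrier N)) g = \<phi> g"
    proof (cases "g \<in> carrier (D N')")
      case True
      then show ?thesis
        using calculation \<phi>D(1)[OF True] k by (intro D_carrier_eqI[of _ N]) (auto simp: D_map_closed[OF N] D_map_apply)
    qed (simp add: D_map_def \<phi>D(4))
  qed
  ultimately show thesis by (rule that)
qed

text \<open>The operations of \<open>P\<close> are conjugated by \<open>c\<close>. This serves to
  bring \<open>D Z\<close>, whose elements are functions, back to the type that carries the objects
  on which \<open>D\<close> is defined.\<close>

lemma transport:
  fixes P :: "('l, 'p) module" and c :: "'p \<Rightarrow> 'n"
  assumes P: "sided_module L P" and fg: "fin_gen L P" and inj: "inj_on c (carrier P)"
  obtains N :: "('l, 'n) module" and \<kappa> where "fin_gen L N" "right_module L P \<Longrightarrow> right_module L N"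
    "left_module L P \<Longrightarrow> left_module L N"
    "\<kappa> \<in> mod_hom L N P" "bij_betw \<kappa> (carrier N) (carrier P)"
proof -
  define d where "d = the_inv_into (carrier P) c"
  have d: "d (c x) = x" if "x \<in> carrier P" for x
    unfolding d_def by (rule the_inv_into_f_f[OF inj that])
  define N :: "('l, 'n) module" where "N = \<lparr>carrier = c ` carrier P, mult = undefined, one = undefined,
    ring.zero = c \<zero>\<^bsub>P\<^esub>, add = (\<lambda>x y. c (d x \<oplus>\<^bsub>P\<^esub> d y)), smult = (\<lambda>a x. c (a \<odot>\<^bsub>P\<^esub> d x))\<rparr>"
  have simps: "carrier N = c ` carrier P" "\<zero>\<^bsub>N\<^esub> = c \<zero>\<^bsub>P\<^esub>" "x \<oplus>\<^bsub>N\<^esub> y = c (d x \<oplus>\<^bsub>P\<^esub> d y)"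
    "a \<odot>\<^bsub>N\<^esub> x = c (a \<odot>\<^bsub>P\<^esub> d x)" for x y a by (simp_all add: N_def)
  note PD = sided_moduleD[OF P]
  interpret P: abelian_group P by (rule PD(2))
  have ab: "abelian_group N"
  proof (rule abelian_groupI)
    show "\<exists>y\<in>carrier N. y \<oplus>\<^bsub>N\<^esub> x = \<zero>\<^bsub>N\<^esub>" if "x \<in> carrier N" for x
    proof -
      obtain p where p: "p \<in> carrier P" "x = c p" using \<open>x \<in> carrier N\<close> by (auto simp: simps)
      then show ?thesis
        by (intro bexI[of _ "c (\<ominus>\<^bsub>P\<^esub> p)"]) (auto simp: simps d P.l_neg)
    qed
  qed (auto simp: simps d P.a_ac)
  have axioms: "a \<in> carrier L \<Longrightarrow> x \<in> carrier N \<Longrightarrow> a \<odot>\<^bsub>N\<^esub> x \<in> carrier N"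
    "a \<in> carrier L \<Longrightarrow> b \<in> carrier L \<Longrightarrow> x \<in> carrier N \<Longrightarrow> (a \<oplus>\<^bsub>L\<^esub> b) \<odot>\<^bsub>N\<^esub> x = a \<odot>\<^bsub>N\<^esub> x \<oplus>\<^bsub>N\<^esub> b \<odot>\<^bsub>N\<^esub> x"
    "a \<in> carrier L \<Longrightarrow> x \<in> carrier N \<Longrightarrow> y \<in> carrier N \<Longrightarrow> a \<odot>\<^bsub>N\<^esub> (x \<oplus>\<^bsub>N\<^esub> y) = a \<odot>\<^bsub>N\<^esub> x \<oplus>\<^bsub>N\<^esub> a \<odot>\<^bsub>N\<^esub> y"
    "x \<in> carrier N \<Longrightarrow> \<one>\<^bsub>L\<^esub> \<odot>\<^bsub>N\<^esub> x = x" for a b x y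
    by (auto simp: simps d PD(3-6))
  have right: "right_module L N" if "right_module L P"
  proof (intro right_module.intro right_module_axioms.intro L_ring ab)
    show "(a \<otimes>\<^bsub>L\<^esub> b) \<odot>\<^bsub>N\<^esub> x = b \<odot>\<^bsub>N\<^esub> (a \<odot>\<^bsub>N\<^esub> x)" if "a \<in> carrier L" "b \<in> carrier L" "x \<in> carrier N" for a b x
      using that right_module.smult_assoc_right[OF \<open>right_module L P\<close>] by (auto simp: simps d PD(3))
  qed (use axioms in auto)
  have left: "left_module L N" if "left_module L P"
  proof (intro left_module.intro left_module_axioms.intro L_ring ab)
    show "(a \<otimes>\<^bsub>L\<^esub> b) \<odot>\<^bsub>N\<^esub> x = a \<odot>\<^bsub>N\<^esub> (b \<odot>\<^bsub>N\<^esub> x)" if "a \<in> carrier L" "b \<in> carrier L" "x \<in> carrier N" for a b x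
      using that left_module.smult_assoc[OF \<open>left_module L P\<close>] by (auto simp: simps d PD(3))
  qed (use axioms in auto)
  have N: "sided_module L N" using left right P by (auto simp: sided_module_def)
  have "restrict c (carrier P) \<in> mod_hom L P N"
    by (rule mod_homI) (auto simp: simps d PD(3))
  then have fgN: "fin_gen L N" by (rule fin_gen_bij[OF N P _ _ fg]) (simp add: simps)
  have "restrict d (carrier N) \<in> mod_hom L N P"
    by (rule mod_homI) (auto simp: simps d PD(3) inj_on_eq_iff[OF inj])
  moreover have "bij_betw (restrict d (carrier N)) (carrier N) (carrier P)"
    unfolding bij_betw_def inj_on_def by (auto simp: simps d image_iff)
  ultimately show thesis using that fgN right left by blast
qed

text \<open>\<open>\<theta>\<close> is the canonical map of \<open>Z\<close> into its double dual,
  with \<open>D Z\<close> replaced by its copy \<open>N\<close>. It is injective because functionals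
  separate points and surjective because functionals on the dual are evaluations.\<close>

lemma dual_of_dual:
  assumes Z: "sided_module L Z" "fin_gen L Z" and N: "sided_module L N"
    and \<kappa>: "\<kappa> \<in> mod_hom L N (D Z)" "bij_betw \<kappa> (carrier N) (carrier (D Z))"
  obtains \<theta> where "\<theta> \<in> mod_hom L Z (D N)" "bij_betw \<theta> (carrier Z) (carrier (D N))"
proof -
  note ZD = sided_moduleD[OF Z(1)] and ND = sided_moduleD[OF N] and \<kappa>D = mod_homD[OF \<kappa>(1)]
  interpret Z: abelian_group Z by (rule ZD(2))
  interpret N: abelian_group N by (rule ND(2))
  interpret DN: abelian_group "D N" by (rule D_abelian_group) fact
  define \<theta> where "\<theta> = (\<lambda>z\<in>carrier Z. \<lambda>n\<in>carrier N. \<kappa> n z)"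
  have app: "\<theta> z n = \<kappa> n z" if "z \<in> carrier Z" "n \<in> carrier N" for z n
    using that by (simp add: \<theta>_def)
  have closed: "\<theta> z \<in> carrier (D N)" if z: "z \<in> carrier Z" for z
  proof (rule D_carrierI)
    fix n assume n: "n \<in> carrier N"
    show "\<theta> z n \<in> carrier J" using app[OF z n] D_carrierD(1)[OF \<kappa>D(1)[OF n] z] by simp
    show "\<theta> z (n \<oplus>\<^bsub>N\<^esub> n') = \<theta> z n \<oplus>\<^bsub>J\<^esub> \<theta> z n'" if "n' \<in> carrier N" for n'
      using \<kappa>D(2)[OF n that] z n that by (simp add: app D_obj_simps)
    show "\<theta> z (\<eta> r \<odot>\<^bsub>N\<^esub> n) = r \<odot>\<^bsub>J\<^esub> \<theta> z n" if "r \<in> carrier R" for r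
      using \<kappa>D(3)[OF \<eta>_closed[OF that] n] z n ND(3)[OF \<eta>_closed[OF that] n]
        D_carrierD(3)[OF \<kappa>D(1)[OF n] that z] by (simp add: app D_obj_simps)
  qed (simp add: \<theta>_def z)
  have "\<theta> \<in> mod_hom L Z (D N)"
  proof (rule mod_homI)
    fix z assume z: "z \<in> carrier Z"
    show "\<theta> z \<in> carrier (D N)" by (rule closed) fact
    show "\<theta> (z \<oplus>\<^bsub>Z\<^esub> z') = \<theta> z \<oplus>\<^bsub>D N\<^esub> \<theta> z'" if z': "z' \<in> carrier Z" for z'
    proof (rule D_carrier_eqI[of _ N])
      fix n assume n: "n \<in> carrier N"
      show "\<theta> (z \<oplus>\<^bsub>Z\<^esub> z') n = (\<theta> z \<oplus>\<^bsub>D N\<^esub> \<theta> z') n"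
        using D_carrierD(2)[OF \<kappa>D(1)[OF n] z z'] z z' n by (simp add: app D_obj_simps)
    qed (use closed z z' in auto)
    show "\<theta> (a \<odot>\<^bsub>Z\<^esub> z) = a \<odot>\<^bsub>D N\<^esub> \<theta> z" if a: "a \<in> carrier L" for a
    proof (rule D_carrier_eqI[of _ N])
      fix n assume n: "n \<in> carrier N"
      show "\<theta> (a \<odot>\<^bsub>Z\<^esub> z) n = (a \<odot>\<^bsub>D N\<^esub> \<theta> z) n"
        using \<kappa>D(3)[OF a n] z n ZD(3)[OF a z] ND(3)[OF a n] by (simp add: app D_obj_simps)
    qed (use closed z a ZD(3) D_smult_closed[OF N] in auto)
  qed (simp add: \<theta>_def)
  moreover have "inj_on \<theta> (carrier Z)"
  proof (rule inj_onI)
    fix z z' assume z: "z \<in> carrier Z" "z' \<in> carrier Z" "\<theta> z = \<theta> z'"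
    show "z = z'"
    proof (rule D_separates[OF Z z(1,2)])
      fix f assume "f \<in> carrier (D Z)"
      then obtain n where "n \<in> carrier N" "f = \<kappa> n" using \<kappa>(2) unfolding bij_betw_def by auto
      then show "f z = f z'" using z app by metis
    qed
  qed
  moreover have "\<exists>z\<in>carrier Z. \<theta> z = G" if G: "G \<in> carrier (D N)" for G
  proof -
    \<comment> \<open>Carried over to \<open>D Z\<close> by the inverse of \<open>\<kappa>\<close>,
      the functional \<open>G\<close> becomes evaluation at some \<open>z\<close>.\<close>
    define inv_\<kappa> where "inv_\<kappa> = the_inv_into (carrier N) \<kappa>"
    have inv1: "inv_\<kappa> (\<kappa> n) = n" if "n \<in> carrier N" for n
      unfolding inv_\<kappa>_def using the_inv_into_f_f \<kappa>(2) that unfolding bij_betw_def by metis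
    have surj: "\<exists>n\<in>carrier N. f = \<kappa> n" if "f \<in> carrier (D Z)" for f
      using \<kappa>(2) that unfolding bij_betw_def by auto
    show ?thesis
    proof (rule D_functional_is_evaluation[OF Z, of "\<lambda>f. G (inv_\<kappa> f)"])
      fix f g r assume "f \<in> carrier (D Z)"
      then obtain n where n: "n \<in> carrier N" "f = \<kappa> n" using surj by blast
      show "G (inv_\<kappa> f) \<in> carrier J" using n inv1 D_carrierD(1)[OF G] by simp
      show "G (inv_\<kappa> (\<eta> r \<odot>\<^bsub>D Z\<^esub> f)) = r \<odot>\<^bsub>J\<^esub> G (inv_\<kappa> f)" if r: "r \<in> carrier R"
        using n inv1 D_carrierD(3)[OF G r n(1)] \<kappa>D(3)[OF \<eta>_closed[OF r] n(1)] inv1[OF ND(3)[OF \<eta>_closed[OF r] n(1)]] by simp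
      assume "g \<in> carrier (D Z)"
      then obtain m where m: "m \<in> carrier N" "g = \<kappa> m" using surj by blast
      show "G (inv_\<kappa> (f \<oplus>\<^bsub>D Z\<^esub> g)) = G (inv_\<kappa> f) \<oplus>\<^bsub>J\<^esub> G (inv_\<kappa> g)"
        using n m inv1 D_carrierD(2)[OF G n(1) m(1)] \<kappa>D(2)[OF n(1) m(1)] inv1[OF N.a_closed[OF n(1) m(1)]] by simp
    next
      fix z assume z: "z \<in> carrier Z" "\<And>f. f \<in> carrier (D Z) \<Longrightarrow> G (inv_\<kappa> f) = f z"
      have "\<theta> z = G"
      proof (rule D_carrier_eqI[OF closed[OF z(1)] G])
        show "\<theta> z n = G n" if "n \<in> carrier N" for n
          using z(2)[OF \<kappa>D(1)[OF that]] inv1[OF that] app[OF z(1) that] by simp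
      qed
      then show ?thesis using z(1) by blast
    qed
  qed
  then have "\<theta> ` carrier Z = carrier (D N)" using closed by blast
  ultimately show thesis using that unfolding bij_betw_def by blast
qed

end

section \<open>The tensor product as a module\<close>

text \<open>The group \<open>tensor\<close> in additive notation, as a ring record, so that the
  theory of \<open>abelian_group\<close> applies to it; the multiplicative fields are left
  unspecified.\<close>

definition tensor_group ::
  "'a ring \<Rightarrow> ('a, 'u, 'c) module_scheme \<Rightarrow> ('a, 'm, 'd) module_scheme \<Rightarrow> (('u \<times> 'm) \<Rightarrow>\<^sub>0 int) set ring"
  where "tensor_group A U M = \<lparr>carrier = carrier (tensor A U M), mult = undefined, one = undefined,
    ring.zero = \<one>\<^bsub>tensor A U M\<^esub>, add = (\<otimes>\<^bsub>tensor A U M\<^esub>)\<rparr>"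

text \<open>With \<open>U\<close> read as a right module, the last clause is the usual
  \<open>\<beta> (u a) m = \<beta> u (a m)\<close>.\<close>

definition balanced ::
  "'a ring \<Rightarrow> ('a, 'u, 'c) module_scheme \<Rightarrow> ('a, 'm, 'd) module_scheme \<Rightarrow> ('v, 'e) ring_scheme \<Rightarrow>
    ('u \<Rightarrow> 'm \<Rightarrow> 'v) \<Rightarrow> bool"
  where "balanced A U M V \<beta> \<longleftrightarrow>
    (\<forall>u\<in>carrier U. \<forall>m\<in>carrier M. \<beta> u m \<in> carrier V) \<and>
    (\<forall>u\<in>carrier U. \<forall>u'\<in>carrier U. \<forall>m\<in>carrier M. \<beta> (u \<oplus>\<^bsub>U\<^esub> u') m = \<beta> u m \<oplus>\<^bsub>V\<^esub> \<beta> u' m) \<and>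
    (\<forall>u\<in>carrier U. \<forall>m\<in>carrier M. \<forall>m'\<in>carrier M. \<beta> u (m \<oplus>\<^bsub>M\<^esub> m') = \<beta> u m \<oplus>\<^bsub>V\<^esub> \<beta> u m') \<and>
    (\<forall>a\<in>carrier A. \<forall>u\<in>carrier U. \<forall>m\<in>carrier M. \<beta> (a \<odot>\<^bsub>U\<^esub> u) m = \<beta> u (a \<odot>\<^bsub>M\<^esub> m))"

lemma image_eq_singleton: "(\<And>x. x \<in> S \<Longrightarrow> f x = y) \<Longrightarrow> c \<in> S \<Longrightarrow> f ` S = {y}"
  by auto

text \<open>Closure under the actions is all that the group structure asks of them, so the locale
  serves both \<open>U \<otimes>\<^sub>A M\<close> for right modules and
  \<open>M \<otimes>\<^sub>B Y\<close> for left modules over the triangular ring.\<close>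

locale tensor_product =
  fixes A :: "'a ring" and U :: "('a, 'u, 'c) module_scheme" and M :: "('a, 'm, 'd) module_scheme"
  assumes U: "abelian_group U" and M: "abelian_group M"
    and smult_U: "a \<in> carrier A \<Longrightarrow> u \<in> carrier U \<Longrightarrow> a \<odot>\<^bsub>U\<^esub> u \<in> carrier U"
    and smult_M: "a \<in> carrier A \<Longrightarrow> m \<in> carrier M \<Longrightarrow> a \<odot>\<^bsub>M\<^esub> m \<in> carrier M"
begin

abbreviation F :: "(('u \<times> 'm) \<Rightarrow>\<^sub>0 int) monoid"
  where "F \<equiv> free_Abelian_group (carrier U \<times> carrier M)"

abbreviation K :: "(('u \<times> 'm) \<Rightarrow>\<^sub>0 int) set"
  where "K \<equiv> tensor_kernel A U M"

abbreviation T :: "(('u \<times> 'm) \<Rightarrow>\<^sub>0 int) set ring"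
  where "T \<equiv> tensor_group A U M"

abbreviation pure :: "'u \<Rightarrow> 'm \<Rightarrow> (('u \<times> 'm) \<Rightarrow>\<^sub>0 int) set"
  where "pure \<equiv> pure_tensor A U M"

lemma frag_minus_closed: "x \<in> carrier F \<Longrightarrow> y \<in> carrier F \<Longrightarrow> x - y \<in> carrier F"
  using keys_diff[of x y] by auto

lemma frag_add_closed: "x \<in> carrier F \<Longrightarrow> y \<in> carrier F \<Longrightarrow> x + y \<in> carrier F"
  using keys_add[of x y] by auto

lemma relations_closed: "tensor_relations A U M \<subseteq> carrier F"
proof -
  interpret U: abelian_group U by (rule U)
  interpret M: abelian_group M by (rule M)
  have f: "frag_of (u, m) \<in> carrier F" if "u \<in> carrier U" "m \<in> carrier M" for u m
    using that by simp
  show ?thesis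
    unfolding tensor_relations_def
    by (auto simp del: carrier_free_Abelian_group_iff
        intro!: frag_minus_closed f U.a_closed M.a_closed smult_U smult_M)
qed

lemma kernel_subgroup: "subgroup K F"
  unfolding tensor_kernel_def using relations_closed
  by (rule group.generate_is_subgroup[OF group_free_Abelian_group])

lemma kernel_normal: "K \<lhd> F"
  by (rule comm_group.subgroup_imp_normal[OF abelian_free_Abelian_group kernel_subgroup])

lemma tensor_comm_group: "comm_group (tensor A U M)"
  unfolding tensor_def by (rule comm_group.abelian_FactGroup[OF abelian_free_Abelian_group kernel_subgroup])

lemma T_abelian_group: "abelian_group T"
proof (rule comm_group_abelian_groupI)
  have "add_monoid T = tensor A U M" by (rule monoid.equality) (simp_all add: tensor_group_def)
  then show "comm_group (add_monoid T)" using tensor_comm_group by simp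
qed

lemma T_carrier: "carrier T = (\<lambda>c. K #>\<^bsub>F\<^esub> c) ` carrier F"
  by (auto simp: tensor_group_def tensor_def FactGroup_def RCOSETS_def)

lemma T_zero: "\<zero>\<^bsub>T\<^esub> = K #>\<^bsub>F\<^esub> 0"
proof -
  interpret normal K F by (rule kernel_normal)
  have "K #>\<^bsub>F\<^esub> 0 = K" using coset_join2[of 0 K] kernel_subgroup subgroup.one_closed[OF kernel_subgroup] by simp
  then show ?thesis by (simp add: tensor_group_def tensor_def FactGroup_def)
qed

lemma T_add: "c \<in> carrier F \<Longrightarrow> d \<in> carrier F \<Longrightarrow> (K #>\<^bsub>F\<^esub> c) \<oplus>\<^bsub>T\<^esub> (K #>\<^bsub>F\<^esub> d) = K #>\<^bsub>F\<^esub> (c + d)"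
  using normal.rcos_sum[OF kernel_normal, of c d]
  by (simp add: tensor_group_def tensor_def FactGroup_def)

lemma pure_closed: "u \<in> carrier U \<Longrightarrow> m \<in> carrier M \<Longrightarrow> pure u m \<in> carrier T"
  by (auto simp: T_carrier pure_tensor_def)

lemma coset_eq: "c \<in> carrier F \<Longrightarrow> d \<in> carrier F \<Longrightarrow> c - d \<in> K \<Longrightarrow> K #>\<^bsub>F\<^esub> c = K #>\<^bsub>F\<^esub> d"
proof -
  assume *: "c \<in> carrier F" "d \<in> carrier F" "c - d \<in> K"
  interpret normal K F by (rule kernel_normal)
  have "c = (c - d) \<otimes>\<^bsub>F\<^esub> d" by simp
  then have "c \<in> K #>\<^bsub>F\<^esub> d" using *(3) unfolding r_coset_def by blast
  then show ?thesis using repr_independence[OF _ *(2) kernel_subgroup] by simp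
qed

lemma T_induct [consumes 1, case_names zero pure add minus]:
  assumes "t \<in> carrier T" and "P \<zero>\<^bsub>T\<^esub>"
    and "\<And>u m. u \<in> carrier U \<Longrightarrow> m \<in> carrier M \<Longrightarrow> P (pure u m)"
    and "\<And>x y. x \<in> carrier T \<Longrightarrow> y \<in> carrier T \<Longrightarrow> P x \<Longrightarrow> P y \<Longrightarrow> P (x \<oplus>\<^bsub>T\<^esub> y)"
    and "\<And>x. x \<in> carrier T \<Longrightarrow> P x \<Longrightarrow> P (\<ominus>\<^bsub>T\<^esub> x)"
  shows "P t"
proof -
  interpret T: abelian_group T by (rule T_abelian_group)
  have inT: "K #>\<^bsub>F\<^esub> c \<in> carrier T" if "c \<in> carrier F" for c using that T_carrier by blast
  have neg: "\<ominus>\<^bsub>T\<^esub> (K #>\<^bsub>F\<^esub> c) = K #>\<^bsub>F\<^esub> (- c)" if c: "c \<in> carrier F" for c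
  proof -
    have "(K #>\<^bsub>F\<^esub> (- c)) \<oplus>\<^bsub>T\<^esub> (K #>\<^bsub>F\<^esub> c) = \<zero>\<^bsub>T\<^esub>"
      using T_add[of "- c" c] c by (simp add: T_zero)
    then show ?thesis using T.minus_equality inT c by (metis carrier_free_Abelian_group_iff keys_minus)
  qed
  have "P (K #>\<^bsub>F\<^esub> c)" if "Poly_Mapping.keys c \<subseteq> carrier U \<times> carrier M" for c
    using that
  proof (induction c rule: free_Abelian_group_induct[consumes 1, case_names zero diff frag])
    case zero
    then show ?case using assms(2) by (simp add: T_zero)
  next
    case (diff x y)
    have "P (\<ominus>\<^bsub>T\<^esub> (K #>\<^bsub>F\<^esub> y))" using assms(5) inT diff by simp
    then have "P ((K #>\<^bsub>F\<^esub> x) \<oplus>\<^bsub>T\<^esub> \<ominus>\<^bsub>T\<^esub> (K #>\<^bsub>F\<^esub> y))" using assms(4) inT diff by simp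
    then show ?case using neg[of y] T_add[of x "- y"] diff by simp
  next
    case (frag a)
    then show ?case using assms(3)[of "fst a" "snd a"] by (auto simp: pure_tensor_def)
  qed
  then show ?thesis using assms(1) T_carrier by auto
qed

lemma balanced_pure: "balanced A U M T pure"
proof -
  interpret U: abelian_group U by (rule U)
  interpret M: abelian_group M by (rule M)
  have rel: "x \<in> K" if "x \<in> tensor_relations A U M" for x
    using that unfolding tensor_kernel_def by (rule generate.incl)
  have f: "frag_of (u, m) \<in> carrier F" if "u \<in> carrier U" "m \<in> carrier M" for u m
    using that by simp
  have f2: "frag_of p + frag_of q \<in> carrier F" if "frag_of p \<in> carrier F" "frag_of q \<in> carrier F" for p q
    using that keys_add[of "frag_of p" "frag_of q"] by auto
  show ?thesis
    unfolding balanced_def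
  proof (intro conjI ballI)
    show "pure u m \<in> carrier T" if "u \<in> carrier U" "m \<in> carrier M" for u m
      by (rule pure_closed) fact+
    show "pure (u \<oplus>\<^bsub>U\<^esub> u') m = pure u m \<oplus>\<^bsub>T\<^esub> pure u' m"
      if "u \<in> carrier U" "u' \<in> carrier U" "m \<in> carrier M" for u u' m
    proof -
      have "frag_of (u \<oplus>\<^bsub>U\<^esub> u', m) - (frag_of (u, m) + frag_of (u', m)) \<in> K"
        using that by (intro rel) (auto simp: tensor_relations_def diff_diff_eq)
      then show ?thesis
        unfolding pure_tensor_def T_add[OF f[OF that(1,3)] f[OF that(2,3)]]
        by (intro coset_eq f f2 U.a_closed that)
    qed
    show "pure u (m \<oplus>\<^bsub>M\<^esub> m') = pure u m \<oplus>\<^bsub>T\<^esub> pure u m'"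
      if "u \<in> carrier U" "m \<in> carrier M" "m' \<in> carrier M" for u m m'
    proof -
      have "frag_of (u, m \<oplus>\<^bsub>M\<^esub> m') - (frag_of (u, m) + frag_of (u, m')) \<in> K"
        using that by (intro rel) (auto simp: tensor_relations_def diff_diff_eq)
      then show ?thesis
        unfolding pure_tensor_def T_add[OF f[OF that(1,2)] f[OF that(1,3)]]
        by (intro coset_eq f f2 M.a_closed that)
    qed
    show "pure (a \<odot>\<^bsub>U\<^esub> u) m = pure u (a \<odot>\<^bsub>M\<^esub> m)"
      if "a \<in> carrier A" "u \<in> carrier U" "m \<in> carrier M" for a u m
    proof -
      have "frag_of (a \<odot>\<^bsub>U\<^esub> u, m) - frag_of (u, a \<odot>\<^bsub>M\<^esub> m) \<in> K"
        using that by (intro rel) (auto simp: tensor_relations_def)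
      then show ?thesis
        unfolding pure_tensor_def by (intro coset_eq f smult_U smult_M that)
    qed
  qed
qed

text \<open>The sum in \<open>tensor_lift\<close> is the homomorphism \<open>h\<close> provided by
  the universal property of the free abelian group. As \<open>h\<close> kills the relations, it is
  constant on each coset of the kernel, and \<open>the_elem\<close> is applied to a
  singleton.\<close>

lemma tensor_lift:
  assumes V: "abelian_group V" and \<beta>: "balanced A U M V \<beta>"
  shows "t \<in> carrier T \<Longrightarrow> tensor_lift V \<beta> t \<in> carrier V"
    "t \<in> carrier T \<Longrightarrow> t' \<in> carrier T \<Longrightarrow>
      tensor_lift V \<beta> (t \<oplus>\<^bsub>T\<^esub> t') = tensor_lift V \<beta> t \<oplus>\<^bsub>V\<^esub> tensor_lift V \<beta> t'"
    "u \<in> carrier U \<Longrightarrow> m \<in> carrier M \<Longrightarrow> tensor_lift V \<beta> (pure u m) = \<beta> u m"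
proof -
  interpret U: abelian_group U by (rule U)
  interpret M: abelian_group M by (rule M)
  interpret V: abelian_group V by (rule V)
  note \<beta>D = \<beta>[unfolded balanced_def]
  have im: "(\<lambda>p. \<beta> (fst p) (snd p)) ` (carrier U \<times> carrier M) \<subseteq> carrier (add_monoid V)" using \<beta>D by auto
  obtain h where h: "h \<in> hom F (add_monoid V)"
    and h_of: "\<And>p. p \<in> carrier U \<times> carrier M \<Longrightarrow> h (frag_of p) = \<beta> (fst p) (snd p)"
    by (rule comm_group.free_Abelian_group_universal[OF V.a_comm_group im]) (rule that)
  interpret h: group_hom F "add_monoid V" h
    using h by (intro group_hom.intro group_hom_axioms.intro) (auto simp: V.a_group)
  have h_add: "h (c + d) = h c \<oplus>\<^bsub>V\<^esub> h d" if "c \<in> carrier F" "d \<in> carrier F" for c d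
    using h.hom_mult[OF that] by simp
  have h_closed: "h c \<in> carrier V" if "c \<in> carrier F" for c using h.hom_closed[OF that] by simp
  have h_minus: "h (c - d) = h c \<ominus>\<^bsub>V\<^esub> h d" if "c \<in> carrier F" "d \<in> carrier F" for c d
  proof -
    have "- d \<in> carrier F" "h (- d) = \<ominus>\<^bsub>V\<^esub> h d"
      using that h.hom_inv[OF that(2)] by (simp_all add: a_inv_def)
    then show ?thesis using h_add[OF that(1), of "- d"] by (simp add: a_minus_def)
  qed
  \<comment> \<open>Identifies \<open>h\<close> with the explicit sum. Membership in the free group
    is carried along because additivity of \<open>h\<close> requires it.\<close>
  have h_sum: "h (\<Sum>p\<in>S. frag_cmul (k p) (frag_of p)) = (\<Oplus>\<^bsub>V\<^esub>p\<in>S. [k p] \<cdot>\<^bsub>V\<^esub> \<beta> (fst p) (snd p)) \<and>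
      (\<Sum>p\<in>S. frag_cmul (k p) (frag_of p)) \<in> carrier F"
    if "finite S" "S \<subseteq> carrier U \<times> carrier M" for S and k :: "'u \<times> 'm \<Rightarrow> int"
    using that
  proof (induction S rule: finite_induct)
    case empty
    then show ?case using h.hom_one by simp
  next
    case (insert p S)
    have p: "frag_cmul (k p) (frag_of p) \<in> carrier F" using insert.prems keys_cmul[of "k p" "frag_of p"] by auto
    have "h (frag_cmul (k p) (frag_of p)) = [k p] \<cdot>\<^bsub>V\<^esub> h (frag_of p)"
      using group_hom.hom_int_pow[OF h.group_hom_axioms, of "frag_of p" "k p"] insert.prems by (simp add: add_pow_def)
    also have "\<dots> = [k p] \<cdot>\<^bsub>V\<^esub> \<beta> (fst p) (snd p)" using h_of insert.prems by simp
    finally have hp: "h (frag_cmul (k p) (frag_of p)) = [k p] \<cdot>\<^bsub>V\<^esub> \<beta> (fst p) (snd p)" .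
    have clos: "(\<lambda>p. [k p] \<cdot>\<^bsub>V\<^esub> \<beta> (fst p) (snd p)) \<in> S \<rightarrow> carrier V"
      "[k p] \<cdot>\<^bsub>V\<^esub> \<beta> (fst p) (snd p) \<in> carrier V"
      using insert.prems \<beta>D by (auto intro!: V.add.int_pow_closed)
    have IH: "h (\<Sum>p\<in>S. frag_cmul (k p) (frag_of p)) = (\<Oplus>\<^bsub>V\<^esub>p\<in>S. [k p] \<cdot>\<^bsub>V\<^esub> \<beta> (fst p) (snd p))"
      "(\<Sum>p\<in>S. frag_cmul (k p) (frag_of p)) \<in> carrier F"
      using insert.IH insert.prems by auto
    have "frag_cmul (k p) (frag_of p) + (\<Sum>p\<in>S. frag_cmul (k p) (frag_of p)) \<in> carrier F"
      by (rule frag_add_closed[OF p IH(2)])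
    then show ?case
      using h_add[OF p IH(2)] hp IH(1) insert.hyps V.finsum_insert[OF insert.hyps clos] by simp
  qed
  have h_eq: "(\<Oplus>\<^bsub>V\<^esub>p\<in>Poly_Mapping.keys c. [Poly_Mapping.lookup c p] \<cdot>\<^bsub>V\<^esub> \<beta> (fst p) (snd p)) = h c"
    if "c \<in> carrier F" for c
    using h_sum[of "Poly_Mapping.keys c" "Poly_Mapping.lookup c"] that frag_expansion[of c]
    by (simp add: frag_extend_def)
  have f: "frag_of (u, m) \<in> carrier F" if "u \<in> carrier U" "m \<in> carrier M" for u m
    using that by simp
  \<comment> \<open>The shape left by the two additivity relations after \<open>h\<close> is
    expanded.\<close>
  have cancel: "p \<oplus>\<^bsub>V\<^esub> (q \<oplus>\<^bsub>V\<^esub> (\<ominus>\<^bsub>V\<^esub> p \<oplus>\<^bsub>V\<^esub> \<ominus>\<^bsub>V\<^esub> q)) = \<zero>\<^bsub>V\<^esub>"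
    if "p \<in> carrier V" "q \<in> carrier V" for p q
    using that by (simp add: V.a_lcomm[of q "\<ominus>\<^bsub>V\<^esub> p"] V.r_neg)
  have h_rel: "h x = \<zero>\<^bsub>V\<^esub>" if "x \<in> tensor_relations A U M" for x
    using that \<beta>D smult_U smult_M unfolding tensor_relations_def
    by (auto simp: h_minus f frag_minus_closed h_of V.r_neg a_minus_def V.a_assoc cancel simp del: carrier_free_Abelian_group_iff)
  have h_ker: "h x = \<zero>\<^bsub>V\<^esub>" if "x \<in> K" for x
  proof -
    have "K \<subseteq> kernel F (add_monoid V) h"
      unfolding tensor_kernel_def
      by (rule group.generate_subgroup_incl[OF group_free_Abelian_group _ h.subgroup_kernel])
        (use h_rel relations_closed in \<open>auto simp: kernel_def simp del: carrier_free_Abelian_group_iff\<close>)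
    then show ?thesis using that by (auto simp: kernel_def)
  qed
  have KF: "K \<subseteq> carrier F" by (rule subgroup.subset[OF kernel_subgroup])
  have lift: "tensor_lift V \<beta> (K #>\<^bsub>F\<^esub> c) = h c" if c: "c \<in> carrier F" for c
  proof -
    have "(\<Oplus>\<^bsub>V\<^esub>p\<in>Poly_Mapping.keys d. [Poly_Mapping.lookup d p] \<cdot>\<^bsub>V\<^esub> \<beta> (fst p) (snd p)) = h c"
      if d: "d \<in> K #>\<^bsub>F\<^esub> c" for d
    proof -
      obtain k where k: "k \<in> K" "d = k + c" using d by (auto simp: r_coset_def)
      have kF: "k \<in> carrier F" using k(1) KF by blast
      have "d \<in> carrier F" unfolding k(2) by (rule frag_add_closed[OF kF c])
      then have "(\<Oplus>\<^bsub>V\<^esub>p\<in>Poly_Mapping.keys d. [Poly_Mapping.lookup d p] \<cdot>\<^bsub>V\<^esub> \<beta> (fst p) (snd p)) = h d" by (rule h_eq)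
      also have "\<dots> = h c" using h_add[OF kF c] h_ker[OF k(1)] h_closed[OF c] k(2) by simp
      finally show ?thesis .
    qed
    moreover have "c \<in> K #>\<^bsub>F\<^esub> c"
      using group.rcos_self[OF group_free_Abelian_group c kernel_subgroup] .
    ultimately have "(\<lambda>c. \<Oplus>\<^bsub>V\<^esub>p\<in>Poly_Mapping.keys c. [Poly_Mapping.lookup c p] \<cdot>\<^bsub>V\<^esub> \<beta> (fst p) (snd p)) ` (K #>\<^bsub>F\<^esub> c) = {h c}"
      by (intro image_eq_singleton)
    then show ?thesis by (simp add: tensor_lift_def)
  qed
  have TE: "\<exists>c\<in>carrier F. t = K #>\<^bsub>F\<^esub> c" if "t \<in> carrier T" for t using that T_carrier by blast
  show "tensor_lift V \<beta> t \<in> carrier V" if "t \<in> carrier T"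
    using TE[OF that] lift h_closed by auto
  show "tensor_lift V \<beta> (t \<oplus>\<^bsub>T\<^esub> t') = tensor_lift V \<beta> t \<oplus>\<^bsub>V\<^esub> tensor_lift V \<beta> t'"
    if "t \<in> carrier T" "t' \<in> carrier T"
  proof -
    obtain c c' where c: "c \<in> carrier F" "t = K #>\<^bsub>F\<^esub> c" "c' \<in> carrier F" "t' = K #>\<^bsub>F\<^esub> c'"
      using TE[OF \<open>t \<in> carrier T\<close>] TE[OF \<open>t' \<in> carrier T\<close>] by blast
    have "c + c' \<in> carrier F" by (rule frag_add_closed[OF c(1,3)])
    then show ?thesis using c lift h_add T_add by simp
  qed
  show "tensor_lift V \<beta> (pure u m) = \<beta> u m" if "u \<in> carrier U" "m \<in> carrier M"
    using lift[OF f[OF that]] h_of[of "(u, m)"] that by (simp add: pure_tensor_def)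
qed

end

section \<open>The base ring action on the tensor product\<close>

locale tensor_module = artinian_algebra R A \<eta> + tensor_product A U M
  for R :: "'r ring" and A :: "'a ring" and \<eta> and U :: "('a, 'u) module" and M :: "('a, 'm, 'd) module_scheme" +
  fixes M\<^sub>R :: "('r, 'm) module"
  assumes sided_U: "sided_module A U"
    and M\<^sub>R: "module R M\<^sub>R" "carrier M\<^sub>R = carrier M" "add M\<^sub>R = add M"
      "\<And>r m. r \<odot>\<^bsub>M\<^sub>R\<^esub> m = \<eta> r \<odot>\<^bsub>M\<^esub> m"
begin

abbreviation U\<^sub>R :: "('r, 'u) module"
  where "U\<^sub>R \<equiv> restrict_scalars \<eta> U"

text \<open>\<open>R\<close> acts through the left factor; that the image of \<open>\<eta>\<close>
  is central makes this action respect the balancing over \<open>A\<close>.\<close>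

definition T\<^sub>R :: "('r, (('u \<times> 'm) \<Rightarrow>\<^sub>0 int) set) module"
  where "T\<^sub>R = \<lparr>carrier = carrier T, mult = undefined, one = undefined, ring.zero = \<zero>\<^bsub>T\<^esub>, add = add T,
    smult = (\<lambda>r. tensor_lift T (\<lambda>u m. pure (\<eta> r \<odot>\<^bsub>U\<^esub> u) m))\<rparr>"

lemma T\<^sub>R_simps [simp]: "carrier T\<^sub>R = carrier T" "\<zero>\<^bsub>T\<^sub>R\<^esub> = \<zero>\<^bsub>T\<^esub>" "x \<oplus>\<^bsub>T\<^sub>R\<^esub> y = x \<oplus>\<^bsub>T\<^esub> y"
  by (simp_all add: T\<^sub>R_def)

lemma pureD:
  "u \<in> carrier U \<Longrightarrow> u' \<in> carrier U \<Longrightarrow> m \<in> carrier M \<Longrightarrow> pure (u \<oplus>\<^bsub>U\<^esub> u') m = pure u m \<oplus>\<^bsub>T\<^esub> pure u' m"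
  "u \<in> carrier U \<Longrightarrow> m \<in> carrier M \<Longrightarrow> m' \<in> carrier M \<Longrightarrow> pure u (m \<oplus>\<^bsub>M\<^esub> m') = pure u m \<oplus>\<^bsub>T\<^esub> pure u m'"
  "a \<in> carrier A \<Longrightarrow> u \<in> carrier U \<Longrightarrow> m \<in> carrier M \<Longrightarrow> pure (a \<odot>\<^bsub>U\<^esub> u) m = pure u (a \<odot>\<^bsub>M\<^esub> m)"
  using balanced_pure unfolding balanced_def by auto

lemma balanced_smult:
  assumes r: "r \<in> carrier R"
  shows "balanced A U M T (\<lambda>u m. pure (\<eta> r \<odot>\<^bsub>U\<^esub> u) m)"
  unfolding balanced_def
proof (intro conjI ballI)
  note UD = sided_moduleD(3,5)[OF sided_U] and \<eta>r = \<eta>_closed[OF r]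
  fix a u u' m m' assume u: "u \<in> carrier U"
  { fix m assume m: "m \<in> carrier M"
    show "pure (\<eta> r \<odot>\<^bsub>U\<^esub> u) m \<in> carrier T" by (rule pure_closed[OF UD(1)[OF \<eta>r u] m]) }
  { fix u' m assume "u' \<in> carrier U" "m \<in> carrier M"
    then show "pure (\<eta> r \<odot>\<^bsub>U\<^esub> (u \<oplus>\<^bsub>U\<^esub> u')) m = pure (\<eta> r \<odot>\<^bsub>U\<^esub> u) m \<oplus>\<^bsub>T\<^esub> pure (\<eta> r \<odot>\<^bsub>U\<^esub> u') m"
      using u \<eta>r UD by (simp add: pureD(1)) }
  { fix m m' assume "m \<in> carrier M" "m' \<in> carrier M"
    then show "pure (\<eta> r \<odot>\<^bsub>U\<^esub> u) (m \<oplus>\<^bsub>M\<^esub> m') = pure (\<eta> r \<odot>\<^bsub>U\<^esub> u) m \<oplus>\<^bsub>T\<^esub> pure (\<eta> r \<odot>\<^bsub>U\<^esub> u) m'"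
      using u \<eta>r UD by (simp add: pureD(2)) }
next
  note UD = sided_moduleD(3,5)[OF sided_U] and \<eta>r = \<eta>_closed[OF r]
  fix a u m assume a: "a \<in> carrier A" and u: "u \<in> carrier U" and m: "m \<in> carrier M"
  show "pure (\<eta> r \<odot>\<^bsub>U\<^esub> (a \<odot>\<^bsub>U\<^esub> u)) m = pure (\<eta> r \<odot>\<^bsub>U\<^esub> u) (a \<odot>\<^bsub>M\<^esub> m)"
    using smult_central[OF sided_U r a u] pureD(3)[OF a UD(1)[OF \<eta>r u] m] by simp
qed

lemma smult_T:
  assumes r: "r \<in> carrier R"
  shows "t \<in> carrier T \<Longrightarrow> r \<odot>\<^bsub>T\<^sub>R\<^esub> t \<in> carrier T"
    "t \<in> carrier T \<Longrightarrow> t' \<in> carrier T \<Longrightarrow> r \<odot>\<^bsub>T\<^sub>R\<^esub> (t \<oplus>\<^bsub>T\<^esub> t') = r \<odot>\<^bsub>T\<^sub>R\<^esub> t \<oplus>\<^bsub>T\<^esub> r \<odot>\<^bsub>T\<^sub>R\<^esub> t'"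
    "u \<in> carrier U \<Longrightarrow> m \<in> carrier M \<Longrightarrow> r \<odot>\<^bsub>T\<^sub>R\<^esub> pure u m = pure (\<eta> r \<odot>\<^bsub>U\<^esub> u) m"
  using tensor_lift[OF T_abelian_group balanced_smult[OF r]] by (simp_all add: T\<^sub>R_def)

text \<open>The substitute for computing with representatives: the module axioms and all linearity
  statements on the tensor product are reduced to pure tensors by it.\<close>

lemma T_additive_eqI:
  assumes V: "abelian_group V"
    and f: "\<And>t. t \<in> carrier T \<Longrightarrow> f t \<in> carrier V"
      "\<And>t t'. t \<in> carrier T \<Longrightarrow> t' \<in> carrier T \<Longrightarrow> f (t \<oplus>\<^bsub>T\<^esub> t') = f t \<oplus>\<^bsub>V\<^esub> f t'"
    and g: "\<And>t. t \<in> carrier T \<Longrightarrow> g t \<in> carrier V"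
      "\<And>t t'. t \<in> carrier T \<Longrightarrow> t' \<in> carrier T \<Longrightarrow> g (t \<oplus>\<^bsub>T\<^esub> t') = g t \<oplus>\<^bsub>V\<^esub> g t'"
    and eq: "\<And>u m. u \<in> carrier U \<Longrightarrow> m \<in> carrier M \<Longrightarrow> f (pure u m) = g (pure u m)"
    and t: "t \<in> carrier T"
  shows "f t = g t"
proof -
  interpret V: abelian_group V by (rule V)
  interpret T: abelian_group T by (rule T_abelian_group)
  have h_zero: "h \<zero>\<^bsub>T\<^esub> = \<zero>\<^bsub>V\<^esub>" and h_minus: "x \<in> carrier T \<Longrightarrow> h (\<ominus>\<^bsub>T\<^esub> x) = \<ominus>\<^bsub>V\<^esub> h x"
    if "\<And>t. t \<in> carrier T \<Longrightarrow> h t \<in> carrier V"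
      "\<And>t t'. t \<in> carrier T \<Longrightarrow> t' \<in> carrier T \<Longrightarrow> h (t \<oplus>\<^bsub>T\<^esub> t') = h t \<oplus>\<^bsub>V\<^esub> h t'" for h x
  proof -
    show z: "h \<zero>\<^bsub>T\<^esub> = \<zero>\<^bsub>V\<^esub>" using that(2)[of "\<zero>\<^bsub>T\<^esub>" "\<zero>\<^bsub>T\<^esub>"] that(1)[of "\<zero>\<^bsub>T\<^esub>"] by simp
    show "h (\<ominus>\<^bsub>T\<^esub> x) = \<ominus>\<^bsub>V\<^esub> h x" if x: "x \<in> carrier T"
    proof -
      have "h (\<ominus>\<^bsub>T\<^esub> x) \<oplus>\<^bsub>V\<^esub> h x = h (\<ominus>\<^bsub>T\<^esub> x \<oplus>\<^bsub>T\<^esub> x)"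
        using \<open>\<And>t t'. t \<in> carrier T \<Longrightarrow> t' \<in> carrier T \<Longrightarrow> h (t \<oplus>\<^bsub>T\<^esub> t') = h t \<oplus>\<^bsub>V\<^esub> h t'\<close> x by simp
      also have "\<dots> = \<zero>\<^bsub>V\<^esub>" using z x by (simp add: T.l_neg)
      finally show ?thesis
        using \<open>\<And>t. t \<in> carrier T \<Longrightarrow> h t \<in> carrier V\<close> x V.minus_equality by (metis T.a_inv_closed)
    qed
  qed
  show ?thesis
    using t
  proof (induction t rule: T_induct)
    case zero
    show ?case using h_zero[of f, OF f] h_zero[of g, OF g] by simp
  next
    case (minus x)
    then show ?case using h_minus[of f, OF f] h_minus[of g, OF g] by simp
  qed (use eq f g in simp_all)
qed

lemma T\<^sub>R_module: "module R T\<^sub>R"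
proof (rule moduleI)
  interpret T: abelian_group T by (rule T_abelian_group)
  interpret R: cring R by (rule R_cring)
  note UD = sided_moduleD[OF sided_U]
  interpret UR: module R "U\<^sub>R" by (rule restrict_module[OF sided_U])
  show "cring R" by (rule R_cring)
  show "abelian_group T\<^sub>R" by (rule abelian_group_cong[OF T_abelian_group]) (simp_all add: T\<^sub>R_def)
  fix r s t assume r: "r \<in> carrier R" and "t \<in> carrier T\<^sub>R"
  then have t: "t \<in> carrier T" by simp
  show "r \<odot>\<^bsub>T\<^sub>R\<^esub> t \<in> carrier T\<^sub>R" using smult_T(1)[OF r t] by simp
  show "r \<odot>\<^bsub>T\<^sub>R\<^esub> (t \<oplus>\<^bsub>T\<^sub>R\<^esub> t') = r \<odot>\<^bsub>T\<^sub>R\<^esub> t \<oplus>\<^bsub>T\<^sub>R\<^esub> r \<odot>\<^bsub>T\<^sub>R\<^esub> t'" if "t' \<in> carrier T\<^sub>R" for t'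
    using smult_T(2)[OF r t] that by simp
next
  interpret T: abelian_group T by (rule T_abelian_group)
  interpret UR: module R "U\<^sub>R" by (rule restrict_module[OF sided_U])
  note UD = sided_moduleD[OF sided_U]
  fix r s t assume r: "r \<in> carrier R" and s: "s \<in> carrier R" and "t \<in> carrier T\<^sub>R"
  then have t: "t \<in> carrier T" by simp
  note UR = UR.smult_l_distr[OF r s, unfolded restrict_scalars_simps]
    UR.smult_assoc1[OF r s, unfolded restrict_scalars_simps] UD(3)[OF \<eta>_closed[OF r]] UD(3)[OF \<eta>_closed[OF s]]
  show "(r \<oplus>\<^bsub>R\<^esub> s) \<odot>\<^bsub>T\<^sub>R\<^esub> t = r \<odot>\<^bsub>T\<^sub>R\<^esub> t \<oplus>\<^bsub>T\<^sub>R\<^esub> s \<odot>\<^bsub>T\<^sub>R\<^esub> t"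
    unfolding T\<^sub>R_simps
    by (rule T_additive_eqI[OF T_abelian_group _ _ _ _ _ t])
      (use r s UR in \<open>simp_all add: smult_T pureD T.a_ac\<close>)
  show "(r \<otimes>\<^bsub>R\<^esub> s) \<odot>\<^bsub>T\<^sub>R\<^esub> t = r \<odot>\<^bsub>T\<^sub>R\<^esub> (s \<odot>\<^bsub>T\<^sub>R\<^esub> t)"
    by (rule T_additive_eqI[OF T_abelian_group _ _ _ _ _ t])
      (use r s UR in \<open>simp_all add: smult_T pureD\<close>)
next
  fix t assume "t \<in> carrier T\<^sub>R"
  then have t: "t \<in> carrier T" by simp
  interpret UR: module R "U\<^sub>R" by (rule restrict_module[OF sided_U])
  show "\<one>\<^bsub>R\<^esub> \<odot>\<^bsub>T\<^sub>R\<^esub> t = t"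
    by (rule T_additive_eqI[OF T_abelian_group _ _ _ _ _ t])
      (use UR.smult_one in \<open>simp_all add: smult_T\<close>)
qed

lemma tensor_lift_linear:
  assumes V: "module R V" and \<beta>: "balanced A U M V \<beta>"
    and lin: "\<And>r u m. r \<in> carrier R \<Longrightarrow> u \<in> carrier U \<Longrightarrow> m \<in> carrier M \<Longrightarrow> \<beta> (\<eta> r \<odot>\<^bsub>U\<^esub> u) m = r \<odot>\<^bsub>V\<^esub> \<beta> u m"
  shows "lin_on R T\<^sub>R V (carrier T) (tensor_lift V \<beta>)"
proof -
  interpret V: module R V by (rule V)
  note lift = tensor_lift[OF V.abelian_group_axioms \<beta>]
  have "tensor_lift V \<beta> (r \<odot>\<^bsub>T\<^sub>R\<^esub> t) = r \<odot>\<^bsub>V\<^esub> tensor_lift V \<beta> t" if r: "r \<in> carrier R" and t: "t \<in> carrier T" for r t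
    by (rule T_additive_eqI[OF V.abelian_group_axioms _ _ _ _ _ t])
      (use r lift \<eta>_closed sided_moduleD(3)[OF sided_U] in \<open>simp_all add: smult_T V.smult_r_distr lin\<close>)
  then show ?thesis using lift by (simp add: lin_on_def)
qed

text \<open>A submodule containing the pure tensors of generators contains \<open>pure u m\<close>
  for \<open>u\<close> a generator and every \<open>m\<close>, and then for every \<open>u\<close>.
  Finiteness is what allows functionals to separate the points of the tensor product.\<close>

lemma T\<^sub>R_fin_gen:
  assumes fg: "fin_gen R U\<^sub>R" "fin_gen R M\<^sub>R"
  shows "fin_gen R T\<^sub>R"
proof -
  interpret T: module R T\<^sub>R by (rule T\<^sub>R_module)
  interpret UR: module R "U\<^sub>R" by (rule restrict_module[OF sided_U])
  interpret MR: module R "M\<^sub>R" by (rule M\<^sub>R)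
  obtain P where P: "finite P" "P \<subseteq> carrier U" "\<And>H. submodule H R U\<^sub>R \<Longrightarrow> P \<subseteq> H \<Longrightarrow> H = carrier U"
    using fg(1) unfolding fin_gen_def restrict_scalars_simps by metis
  obtain Q where Q: "finite Q" "Q \<subseteq> carrier M" "\<And>H. submodule H R M\<^sub>R \<Longrightarrow> Q \<subseteq> H \<Longrightarrow> H = carrier M"
    using fg(2) unfolding fin_gen_def M\<^sub>R(2) by metis
  let ?S = "(\<lambda>(u, m). pure u m) ` (P \<times> Q)"
  have S: "pure u m \<in> ?S" if "u \<in> P" "m \<in> Q" for u m using that by auto
  have zero_U: "pure \<zero>\<^bsub>U\<^esub> m = \<zero>\<^bsub>T\<^esub>" if m: "m \<in> carrier M" for m
  proof -
    have 0: "\<zero>\<^bsub>U\<^esub> \<in> carrier U" using UR.M.zero_closed by simp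
    show ?thesis
      using smult_T(3)[OF T.R.zero_closed 0 m] T.smult_l_null[of "pure \<zero>\<^bsub>U\<^esub> m"]
        pure_closed[OF 0 m] UR.smult_l_null[OF UR.M.zero_closed] by simp
  qed
  have zero_M: "pure u \<zero>\<^bsub>M\<^sub>R\<^esub> = \<zero>\<^bsub>T\<^esub>" if u: "u \<in> carrier U" for u
  proof -
    have 0: "\<zero>\<^bsub>M\<^sub>R\<^esub> \<in> carrier M" using MR.M.zero_closed M\<^sub>R by simp
    have "pure u \<zero>\<^bsub>M\<^sub>R\<^esub> = pure u (\<eta> \<zero>\<^bsub>R\<^esub> \<odot>\<^bsub>M\<^esub> \<zero>\<^bsub>M\<^sub>R\<^esub>)" using MR.smult_l_null[OF MR.M.zero_closed] M\<^sub>R(4) by simp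
    also have "\<dots> = \<zero>\<^bsub>R\<^esub> \<odot>\<^bsub>T\<^sub>R\<^esub> pure u \<zero>\<^bsub>M\<^sub>R\<^esub>"
      using smult_T(3)[OF T.R.zero_closed u 0] pureD(3)[OF \<eta>_closed[OF T.R.zero_closed] u 0] by simp
    also have "\<dots> = \<zero>\<^bsub>T\<^esub>" using T.smult_l_null pure_closed[OF u 0] by simp
    finally show ?thesis .
  qed
  have "H = carrier T" if H: "submodule H R T\<^sub>R" "?S \<subseteq> H" for H
  proof -
    note HD = T.submoduleD[OF H(1), unfolded T\<^sub>R_simps]
    have PM: "pure u m \<in> H" if u: "u \<in> P" and m: "m \<in> carrier M" for u m
    proof -
      have uU: "u \<in> carrier U" using u P(2) by blast
      have "submodule {m \<in> carrier M. pure u m \<in> H} R M\<^sub>R"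
      proof (rule MR.submodule_if_closed)
        show "\<zero>\<^bsub>M\<^sub>R\<^esub> \<in> {m \<in> carrier M. pure u m \<in> H}" using zero_M[OF uU] HD(2) MR.M.zero_closed M\<^sub>R(2) by simp
        show "m \<oplus>\<^bsub>M\<^sub>R\<^esub> m' \<in> {m \<in> carrier M. pure u m \<in> H}"
          if "m \<in> {m \<in> carrier M. pure u m \<in> H}" "m' \<in> {m \<in> carrier M. pure u m \<in> H}" for m m'
          using that HD(3) pureD(2)[OF uU] abelian_groupE(1)[OF M] M\<^sub>R(3) by simp
        show "r \<odot>\<^bsub>M\<^sub>R\<^esub> m \<in> {m \<in> carrier M. pure u m \<in> H}"
          if "r \<in> carrier R" "m \<in> {m \<in> carrier M. pure u m \<in> H}" for r m
          using that HD(4)[of r "pure u m"] smult_T(3)[of r u m] pureD(3)[OF \<eta>_closed uU] uU smult_M[OF \<eta>_closed] M\<^sub>R(4) by simp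
      qed (simp add: M\<^sub>R)
      then have "{m \<in> carrier M. pure u m \<in> H} = carrier M" by (rule Q(3)) (use S u H(2) Q(2) in auto)
      then show ?thesis using m by blast
    qed
    have UM: "pure u m \<in> H" if u: "u \<in> carrier U" and m: "m \<in> carrier M" for u m
    proof -
      have "submodule {u \<in> carrier U. pure u m \<in> H} R U\<^sub>R"
      proof (rule UR.submodule_if_closed)
        show "\<zero>\<^bsub>U\<^sub>R\<^esub> \<in> {u \<in> carrier U. pure u m \<in> H}" using zero_U[OF m] HD(2) UR.M.zero_closed by simp
        show "u \<oplus>\<^bsub>U\<^sub>R\<^esub> u' \<in> {u \<in> carrier U. pure u m \<in> H}"
          if "u \<in> {u \<in> carrier U. pure u m \<in> H}" "u' \<in> {u \<in> carrier U. pure u m \<in> H}" for u u'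
          using that HD(3) pureD(1)[OF _ _ m] abelian_groupE(1)[OF U] by simp
        show "r \<odot>\<^bsub>U\<^sub>R\<^esub> u \<in> {u \<in> carrier U. pure u m \<in> H}"
          if "r \<in> carrier R" "u \<in> {u \<in> carrier U. pure u m \<in> H}" for r u
          using that HD(4)[of r "pure u m"] smult_T(3)[of r u m] m smult_U[OF \<eta>_closed] by simp
      qed auto
      then have "{u \<in> carrier U. pure u m \<in> H} = carrier U" by (rule P(3)) (use PM m P(2) in auto)
      then show ?thesis using u by blast
    qed
    have "t \<in> H" if "t \<in> carrier T" for t
      using that
    proof (induction t rule: T_induct)
      case (minus x)
      have "a_inv T\<^sub>R = a_inv T" by (simp add: a_inv_def m_inv_def fun_eq_iff)
      then show ?case using T.submoduleE(3)[OF H(1) minus(2)] by simp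
    qed (use HD UM in simp_all)
    then show ?thesis using HD(1) by blast
  qed
  moreover have "finite ?S" using P Q by simp
  moreover have "?S \<subseteq> carrier T" using P(2) Q(2) pure_closed by (auto simp: subset_iff)
  ultimately show ?thesis unfolding fin_gen_def T\<^sub>R_simps by (intro exI[of _ ?S]) auto
qed

end

section \<open>Modules over the triangular algebra\<close>

locale triangular_algebra = artin_envelope R J i
  for R :: "'r ring" (structure) and J :: "('r, 'e) module" and i +
  fixes A :: "'a ring" and B :: "'b ring" and M :: "('a, 'm, 'b) bimodule"
    and \<eta>\<^sub>A :: "'r \<Rightarrow> 'a" and \<eta>\<^sub>B :: "'r \<Rightarrow> 'b"
  assumes algebra_A: "artin_algebra R A \<eta>\<^sub>A"
    and bimodule: "is_bimodule A B M"
    and algebra_\<Lambda>: "artin_algebra R (triangular A M B) (triangular_unit M \<eta>\<^sub>A \<eta>\<^sub>B)"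
begin

abbreviation \<Lambda> :: "('a \<times> 'm \<times> 'b) ring"
  where "\<Lambda> \<equiv> triangular A M B"

abbreviation \<eta> :: "'r \<Rightarrow> 'a \<times> 'm \<times> 'b"
  where "\<eta> \<equiv> triangular_unit M \<eta>\<^sub>A \<eta>\<^sub>B"

sublocale artin_duality R J i \<Lambda> \<eta>
  by (intro artin_duality.intro artinian_algebra.intro artin_envelope_axioms algebra_\<Lambda>)

sublocale A: artinian_algebra R A \<eta>\<^sub>A
  by (rule artinian_algebra.intro[OF algebra_A])

sublocale M: left_module A M
  using bimodule by (simp add: is_bimodule_def)

sublocale Mr: right_module B "right_part M"
  using bimodule by (simp add: is_bimodule_def)

lemma right_part_simps [simp]:
  "carrier (right_part M) = carrier M" "\<zero>\<^bsub>right_part M\<^esub> = \<zero>\<^bsub>M\<^esub>" "add (right_part M) = add M"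
  "b \<odot>\<^bsub>right_part M\<^esub> x = rsmult M x b"
  by (simp_all add: right_part_def)

lemma triangular_simps [simp]:
  "carrier \<Lambda> = carrier A \<times> carrier M \<times> carrier B"
  "(a, m, b) \<otimes>\<^bsub>\<Lambda>\<^esub> (a', m', b') =
    (a \<otimes>\<^bsub>A\<^esub> a', a \<odot>\<^bsub>M\<^esub> m' \<oplus>\<^bsub>M\<^esub> rsmult M m b', b \<otimes>\<^bsub>B\<^esub> b')"
  "(a, m, b) \<oplus>\<^bsub>\<Lambda>\<^esub> (a', m', b') = (a \<oplus>\<^bsub>A\<^esub> a', m \<oplus>\<^bsub>M\<^esub> m', b \<oplus>\<^bsub>B\<^esub> b')"
  "\<one>\<^bsub>\<Lambda>\<^esub> = (\<one>\<^bsub>A\<^esub>, \<zero>\<^bsub>M\<^esub>, \<one>\<^bsub>B\<^esub>)" "\<zero>\<^bsub>\<Lambda>\<^esub> = (\<zero>\<^bsub>A\<^esub>, \<zero>\<^bsub>M\<^esub>, \<zero>\<^bsub>B\<^esub>)"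
  "\<eta> r = (\<eta>\<^sub>A r, \<zero>\<^bsub>M\<^esub>, \<eta>\<^sub>B r)"
  by (simp_all add: triangular_def triangular_unit_def)

lemma M_zero [simp]:
  "a \<in> carrier A \<Longrightarrow> a \<odot>\<^bsub>M\<^esub> \<zero>\<^bsub>M\<^esub> = \<zero>\<^bsub>M\<^esub>" "x \<in> carrier M \<Longrightarrow> \<zero>\<^bsub>A\<^esub> \<odot>\<^bsub>M\<^esub> x = \<zero>\<^bsub>M\<^esub>"
  "b \<in> carrier B \<Longrightarrow> rsmult M \<zero>\<^bsub>M\<^esub> b = \<zero>\<^bsub>M\<^esub>" "x \<in> carrier M \<Longrightarrow> rsmult M x \<zero>\<^bsub>B\<^esub> = \<zero>\<^bsub>M\<^esub>"
proof -
  show "a \<odot>\<^bsub>M\<^esub> \<zero>\<^bsub>M\<^esub> = \<zero>\<^bsub>M\<^esub>" if "a \<in> carrier A"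
    using M.smult_r_distr[OF that M.N.zero_closed M.N.zero_closed] M.smult_closed[OF that M.N.zero_closed] by simp
  show "\<zero>\<^bsub>A\<^esub> \<odot>\<^bsub>M\<^esub> x = \<zero>\<^bsub>M\<^esub>" if "x \<in> carrier M"
    using M.smult_l_distr[OF M.A.zero_closed M.A.zero_closed that] M.smult_closed[OF M.A.zero_closed that] by simp
  show "rsmult M \<zero>\<^bsub>M\<^esub> b = \<zero>\<^bsub>M\<^esub>" if "b \<in> carrier B"
    using Mr.smult_r_distr[OF that Mr.N.zero_closed Mr.N.zero_closed] Mr.smult_closed[OF that Mr.N.zero_closed] by simp
  show "rsmult M x \<zero>\<^bsub>B\<^esub> = \<zero>\<^bsub>M\<^esub>" if "x \<in> carrier M"
    using Mr.smult_l_distr[OF Mr.A.zero_closed Mr.A.zero_closed, of x] Mr.smult_closed[OF Mr.A.zero_closed, of x] that by simp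
qed

lemma rsmult_closed [simp]: "x \<in> carrier M \<Longrightarrow> b \<in> carrier B \<Longrightarrow> rsmult M x b \<in> carrier M"
  using Mr.smult_closed[of b x] by simp

lemma rsmult_one [simp]: "x \<in> carrier M \<Longrightarrow> rsmult M x \<one>\<^bsub>B\<^esub> = x"
  using Mr.smult_one[of x] by simp

abbreviation e\<^sub>1 :: "'a \<times> 'm \<times> 'b" where "e\<^sub>1 \<equiv> (\<one>\<^bsub>A\<^esub>, \<zero>\<^bsub>M\<^esub>, \<zero>\<^bsub>B\<^esub>)"
abbreviation e\<^sub>2 :: "'a \<times> 'm \<times> 'b" where "e\<^sub>2 \<equiv> (\<zero>\<^bsub>A\<^esub>, \<zero>\<^bsub>M\<^esub>, \<one>\<^bsub>B\<^esub>)"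
abbreviation \<alpha> :: "'a \<Rightarrow> 'a \<times> 'm \<times> 'b" where "\<alpha> a \<equiv> (a, \<zero>\<^bsub>M\<^esub>, \<zero>\<^bsub>B\<^esub>)"
abbreviation \<mu> :: "'m \<Rightarrow> 'a \<times> 'm \<times> 'b" where "\<mu> m \<equiv> (\<zero>\<^bsub>A\<^esub>, m, \<zero>\<^bsub>B\<^esub>)"
abbreviation \<beta> :: "'b \<Rightarrow> 'a \<times> 'm \<times> 'b" where "\<beta> b \<equiv> (\<zero>\<^bsub>A\<^esub>, \<zero>\<^bsub>M\<^esub>, b)"

abbreviation U :: "('a \<times> 'm \<times> 'b, 'n) module \<Rightarrow> ('a, 'n) module"
  where "U \<equiv> A_component A M B"
abbreviation V :: "('a \<times> 'm \<times> 'b, 'n) module \<Rightarrow> ('b, 'n) module"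
  where "V \<equiv> B_component A M B"

lemma component_simps [simp]:
  "carrier (U N) = (\<lambda>x. e\<^sub>1 \<odot>\<^bsub>N\<^esub> x) ` carrier N" "\<zero>\<^bsub>U N\<^esub> = \<zero>\<^bsub>N\<^esub>" "add (U N) = add N" "a \<odot>\<^bsub>U N\<^esub> x = \<alpha> a \<odot>\<^bsub>N\<^esub> x"
  "carrier (V N) = (\<lambda>x. e\<^sub>2 \<odot>\<^bsub>N\<^esub> x) ` carrier N" "\<zero>\<^bsub>V N\<^esub> = \<zero>\<^bsub>N\<^esub>" "add (V N) = add N" "b \<odot>\<^bsub>V N\<^esub> x = \<beta> b \<odot>\<^bsub>N\<^esub> x"
  by (simp_all add: A_component_def B_component_def)

lemma M_smult_closed [simp]: "a \<in> carrier A \<Longrightarrow> x \<in> carrier M \<Longrightarrow> a \<odot>\<^bsub>M\<^esub> x \<in> carrier M"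
  by (rule M.smult_closed)

lemma M_smult_one [simp]: "x \<in> carrier M \<Longrightarrow> \<one>\<^bsub>A\<^esub> \<odot>\<^bsub>M\<^esub> x = x"
  by (rule M.smult_one)

lemma abelian_group_image:
  assumes N: "sided_module \<Lambda> N" and e: "e \<in> carrier \<Lambda>"
    and W: "carrier W = (\<lambda>x. e \<odot>\<^bsub>N\<^esub> x) ` carrier N" "\<zero>\<^bsub>W\<^esub> = \<zero>\<^bsub>N\<^esub>" "add W = add N"
  shows "abelian_group W"
proof -
  note ND = sided_moduleD[OF N]
  interpret N: abelian_group N by (rule ND(2))
  show ?thesis
  proof (rule abelian_groupI)
    show "x \<oplus>\<^bsub>W\<^esub> y \<in> carrier W" if "x \<in> carrier W" "y \<in> carrier W" for x y
    proof -
      obtain p q where p: "p \<in> carrier N" "x = e \<odot>\<^bsub>N\<^esub> p" "q \<in> carrier N" "y = e \<odot>\<^bsub>N\<^esub> q"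
        using \<open>x \<in> carrier W\<close> \<open>y \<in> carrier W\<close> unfolding W by blast
      then have "x \<oplus>\<^bsub>W\<^esub> y = e \<odot>\<^bsub>N\<^esub> (p \<oplus>\<^bsub>N\<^esub> q)" using ND(5)[OF e p(1,3)] W by simp
      then show ?thesis unfolding W using p by blast
    qed
    show "\<zero>\<^bsub>W\<^esub> \<in> carrier W"
      unfolding W using sided_module_zero(1)[OF N e] N.zero_closed by (metis image_eqI)
    show "\<exists>y\<in>carrier W. y \<oplus>\<^bsub>W\<^esub> x = \<zero>\<^bsub>W\<^esub>" if "x \<in> carrier W" for x
    proof -
      obtain p where p: "p \<in> carrier N" "x = e \<odot>\<^bsub>N\<^esub> p" using \<open>x \<in> carrier W\<close> unfolding W by blast
      then have "e \<odot>\<^bsub>N\<^esub> (\<ominus>\<^bsub>N\<^esub> p) \<oplus>\<^bsub>N\<^esub> x = \<zero>\<^bsub>N\<^esub>"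
        using ND(5)[OF e, of "\<ominus>\<^bsub>N\<^esub> p" p] sided_module_zero(1)[OF N e] by (simp add: N.l_neg)
      then show ?thesis unfolding W using p(1) by blast
    qed
  qed (use W ND(3)[OF e] in \<open>auto simp: N.a_ac\<close>)
qed

lemma component_abelian_group:
  assumes "sided_module \<Lambda> N"
  shows "abelian_group (U N)" "abelian_group (V N)"
  by (rule abelian_group_image[OF assms, of "e\<^sub>1"] abelian_group_image[OF assms, of "e\<^sub>2"]; simp)+

end

context triangular_algebra
begin

lemma \<eta>\<^sub>B_closed: "r \<in> carrier R \<Longrightarrow> \<eta>\<^sub>B r \<in> carrier B"
  using \<eta>_closed by simp

lemma mem_image_idempotent:
  assumes N: "sided_module \<Lambda> N" and e: "e \<in> carrier \<Lambda>" "e \<otimes>\<^bsub>\<Lambda>\<^esub> e = e"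
  shows "x \<in> (\<lambda>x. e \<odot>\<^bsub>N\<^esub> x) ` carrier N \<longleftrightarrow> x \<in> carrier N \<and> e \<odot>\<^bsub>N\<^esub> x = x"
  using sided_module_smult_smult(3)[OF N e(1,1), unfolded e(2)] sided_moduleD(3)[OF N e(1)] by force

lemma component_iff:
  assumes "sided_module \<Lambda> N"
  shows "u \<in> carrier (U N) \<longleftrightarrow> u \<in> carrier N \<and> e\<^sub>1 \<odot>\<^bsub>N\<^esub> u = u"
    "u \<in> carrier (V N) \<longleftrightarrow> u \<in> carrier N \<and> e\<^sub>2 \<odot>\<^bsub>N\<^esub> u = u"
  unfolding component_simps by (rule mem_image_idempotent[OF assms]; simp)+

text \<open>\<open>restrict_scalars\<close> takes plain module records, so the
  \<open>R\<close>-module underlying the bimodule gets a record of its own.\<close>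

definition M\<^sub>R :: "('r, 'm) module"
  where "M\<^sub>R = \<lparr>carrier = carrier M, mult = undefined, one = undefined, ring.zero = \<zero>\<^bsub>M\<^esub>, add = add M,
    smult = (\<lambda>r m. \<eta>\<^sub>A r \<odot>\<^bsub>M\<^esub> m)\<rparr>"

lemma M\<^sub>R_simps [simp]:
  "carrier M\<^sub>R = carrier M" "add M\<^sub>R = add M" "\<zero>\<^bsub>M\<^sub>R\<^esub> = \<zero>\<^bsub>M\<^esub>" "r \<odot>\<^bsub>M\<^sub>R\<^esub> m = \<eta>\<^sub>A r \<odot>\<^bsub>M\<^esub> m"
  by (simp_all add: M\<^sub>R_def)

lemma M\<^sub>R_module: "module R M\<^sub>R"
  by (intro moduleI R_cring abelian_group_cong[OF M.N.abelian_group_axioms])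
    (simp_all add: A.\<eta>_closed A.\<eta>_add A.\<eta>_mult A.\<eta>_one M.smult_l_distr M.smult_r_distr M.smult_assoc)

text \<open>Finiteness of \<open>M\<close> is hidden in the hypothesis on the triangular algebra:
  taking the middle entry is an \<open>R\<close>-linear map of \<open>\<Lambda>\<close> onto
  \<open>M\<close>.\<close>

lemma M\<^sub>R_fin_gen: "fin_gen R M\<^sub>R"
proof (rule fin_gen_image[OF module_algebra M\<^sub>R_module, of "\<lambda>(a, m, b). m"])
  show "lin_on R (algebra_module \<eta> \<Lambda>) M\<^sub>R (carrier (algebra_module \<eta> \<Lambda>)) (\<lambda>(a, m, b). m)"
    unfolding lin_on_def algebra_module_simps by (auto simp: A.\<eta>_closed \<eta>\<^sub>B_closed)
  show "(\<lambda>(a, m, b). m) ` carrier (algebra_module \<eta> \<Lambda>) = carrier M\<^sub>R"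
    using M.A.one_closed Mr.A.one_closed by (force simp: algebra_module_simps image_iff)
  show "fin_gen R (algebra_module \<eta> \<Lambda>)" using algebra_\<Lambda> by (simp add: artin_algebra_def)
qed

text \<open>\<open>\<eta> r\<close> is central and its product with \<open>e\<^sub>1\<close> is
  \<open>\<alpha> (\<eta>\<^sub>A r)\<close>, so the \<open>R\<close>-structures that
  \<open>U N\<close> receives through \<open>\<Lambda>\<close> and through \<open>A\<close>
  coincide.\<close>

lemma \<eta>_on_U:
  assumes N: "sided_module \<Lambda> N" and r: "r \<in> carrier R" and u: "u \<in> carrier (U N)"
  shows "\<eta> r \<odot>\<^bsub>N\<^esub> u = \<alpha> (\<eta>\<^sub>A r) \<odot>\<^bsub>N\<^esub> u"
proof -
  have u': "u \<in> carrier N" "e\<^sub>1 \<odot>\<^bsub>N\<^esub> u = u" using u component_iff[OF N] by auto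
  have "\<eta> r \<odot>\<^bsub>N\<^esub> (e\<^sub>1 \<odot>\<^bsub>N\<^esub> u) = (\<eta> r \<otimes>\<^bsub>\<Lambda>\<^esub> e\<^sub>1) \<odot>\<^bsub>N\<^esub> u"
    by (rule sided_module_smult_smult(3)[OF N \<eta>_closed[OF r] _ u'(1) \<eta>_central[OF r], symmetric]) simp_all
  then show ?thesis using u' r A.\<eta>_closed \<eta>\<^sub>B_closed by simp
qed

section \<open>Right modules: monic structure maps and epic duals\<close>

context
  fixes N :: "('a \<times> 'm \<times> 'b, 'n) module"
  assumes right: "right_module \<Lambda> N"
begin

lemma right_sided: "sided_module \<Lambda> N"
  using right by (simp add: sided_module_def)

lemma right_smult_smult:
  "a \<in> carrier \<Lambda> \<Longrightarrow> b \<in> carrier \<Lambda> \<Longrightarrow> x \<in> carrier N \<Longrightarrow> a \<odot>\<^bsub>N\<^esub> (b \<odot>\<^bsub>N\<^esub> x) = (b \<otimes>\<^bsub>\<Lambda>\<^esub> a) \<odot>\<^bsub>N\<^esub> x"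
  using right_module.smult_assoc_right[OF right] by simp

lemma right_smult_closed: "a \<in> carrier \<Lambda> \<Longrightarrow> x \<in> carrier N \<Longrightarrow> a \<odot>\<^bsub>N\<^esub> x \<in> carrier N"
  by (rule sided_moduleD(3)[OF right_sided])

lemma right_U_iff: "u \<in> (\<lambda>x. e\<^sub>1 \<odot>\<^bsub>N\<^esub> x) ` carrier N \<longleftrightarrow> u \<in> carrier N \<and> e\<^sub>1 \<odot>\<^bsub>N\<^esub> u = u"
  and right_V_iff: "u \<in> (\<lambda>x. e\<^sub>2 \<odot>\<^bsub>N\<^esub> x) ` carrier N \<longleftrightarrow> u \<in> carrier N \<and> e\<^sub>2 \<odot>\<^bsub>N\<^esub> u = u"
  using component_iff[OF right_sided] by auto

lemma U_right_module: "right_module A (U N)"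
proof (intro right_module.intro right_module_axioms.intro M.A.ring_axioms component_abelian_group right_sided)
  note ND = sided_moduleD[OF right_sided]
  fix a b x y assume a: "a \<in> carrier A" and "x \<in> carrier (U N)"
  then have x: "x \<in> carrier N" "e\<^sub>1 \<odot>\<^bsub>N\<^esub> x = x" using component_iff[OF right_sided] by auto
  show "a \<odot>\<^bsub>U N\<^esub> x \<in> carrier (U N)"
    using a x by (simp add: right_U_iff right_smult_closed right_smult_smult del: image_iff)
  show "a \<odot>\<^bsub>U N\<^esub> (x \<oplus>\<^bsub>U N\<^esub> y) = a \<odot>\<^bsub>U N\<^esub> x \<oplus>\<^bsub>U N\<^esub> a \<odot>\<^bsub>U N\<^esub> y" if "y \<in> carrier (U N)"
    using that component_iff[OF right_sided] a x ND(5)[of "\<alpha> a" x y] by simp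
next
  note ND = sided_moduleD[OF right_sided]
  fix a b x assume a: "a \<in> carrier A" and b: "b \<in> carrier A" and "x \<in> carrier (U N)"
  then have x: "x \<in> carrier N" "e\<^sub>1 \<odot>\<^bsub>N\<^esub> x = x" using component_iff[OF right_sided] by auto
  show "(a \<oplus>\<^bsub>A\<^esub> b) \<odot>\<^bsub>U N\<^esub> x = a \<odot>\<^bsub>U N\<^esub> x \<oplus>\<^bsub>U N\<^esub> b \<odot>\<^bsub>U N\<^esub> x"
    using a b x ND(4)[of "\<alpha> a" "\<alpha> b" x] by simp
  show "(a \<otimes>\<^bsub>A\<^esub> b) \<odot>\<^bsub>U N\<^esub> x = b \<odot>\<^bsub>U N\<^esub> (a \<odot>\<^bsub>U N\<^esub> x)"
    using a b x by (simp add: right_smult_smult)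
next
  fix x assume "x \<in> carrier (U N)"
  then show "\<one>\<^bsub>A\<^esub> \<odot>\<^bsub>U N\<^esub> x = x" using component_iff[OF right_sided] by simp
qed

interpretation T: tensor_module R A \<eta>\<^sub>A "U N" M M\<^sub>R
proof (intro tensor_module.intro tensor_product.intro tensor_module_axioms.intro A.artinian_algebra_axioms
    component_abelian_group right_sided M.N.abelian_group_axioms M\<^sub>R_module)
  show "sided_module A (U N)" using U_right_module by (simp add: sided_module_def)
  show "a \<odot>\<^bsub>U N\<^esub> u \<in> carrier (U N)" if "a \<in> carrier A" "u \<in> carrier (U N)" for a u
    by (rule right_module.smult_closed[OF U_right_module that])
qed (simp_all)

lemma psi_balanced: "balanced A (U N) M (V N) (\<lambda>u m. \<mu> m \<odot>\<^bsub>N\<^esub> u)"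
  unfolding balanced_def
proof (intro conjI ballI)
  note ND = sided_moduleD[OF right_sided]
  fix u assume "u \<in> carrier (U N)"
  then have u: "u \<in> carrier N" "e\<^sub>1 \<odot>\<^bsub>N\<^esub> u = u" using component_iff[OF right_sided] by auto
  fix m assume m: "m \<in> carrier M"
  show "\<mu> m \<odot>\<^bsub>N\<^esub> u \<in> carrier (V N)"
    using m u by (simp add: right_V_iff right_smult_closed right_smult_smult)
  show "\<mu> (m \<oplus>\<^bsub>M\<^esub> m') \<odot>\<^bsub>N\<^esub> u = \<mu> m \<odot>\<^bsub>N\<^esub> u \<oplus>\<^bsub>V N\<^esub> \<mu> m' \<odot>\<^bsub>N\<^esub> u" if "m' \<in> carrier M" for m'
    using m u ND(4)[of "\<mu> m" "\<mu> m'" u] that by simp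
next
  note ND = sided_moduleD[OF right_sided]
  fix u m assume "u \<in> carrier (U N)" and m: "m \<in> carrier M"
  then have u: "u \<in> carrier N" "e\<^sub>1 \<odot>\<^bsub>N\<^esub> u = u" using component_iff[OF right_sided] by auto
  show "\<mu> m \<odot>\<^bsub>N\<^esub> (u \<oplus>\<^bsub>U N\<^esub> u') = \<mu> m \<odot>\<^bsub>N\<^esub> u \<oplus>\<^bsub>V N\<^esub> \<mu> m \<odot>\<^bsub>N\<^esub> u'" if "u' \<in> carrier (U N)" for u'
    using that component_iff[OF right_sided] m u ND(5)[of "\<mu> m" u u'] by simp
  show "\<mu> m \<odot>\<^bsub>N\<^esub> (a \<odot>\<^bsub>U N\<^esub> u) = \<mu> (a \<odot>\<^bsub>M\<^esub> m) \<odot>\<^bsub>N\<^esub> u" if "a \<in> carrier A" for a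
    using that m u by (simp add: right_smult_smult)
qed

lemma right_psi:
  "t \<in> carrier T.T \<Longrightarrow> right_psi A M B N t \<in> carrier N"
  "t \<in> carrier T.T \<Longrightarrow> t' \<in> carrier T.T \<Longrightarrow>
    right_psi A M B N (t \<oplus>\<^bsub>T.T\<^esub> t') = right_psi A M B N t \<oplus>\<^bsub>N\<^esub> right_psi A M B N t'"
  "u \<in> carrier (U N) \<Longrightarrow> m \<in> carrier M \<Longrightarrow> right_psi A M B N (T.pure u m) = \<mu> m \<odot>\<^bsub>N\<^esub> u"
  using T.tensor_lift[OF component_abelian_group(2)[OF right_sided] psi_balanced] component_iff[OF right_sided]
  by (simp_all add: right_psi_def)

lemma right_psi_lin: "lin_on R T.T\<^sub>R (scalars N) (carrier T.T) (right_psi A M B N)"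
  unfolding lin_on_def
proof (intro conjI ballI)
  note ND = sided_moduleD[OF right_sided]
  fix r t assume r: "r \<in> carrier R" and t: "t \<in> carrier T.T"
  have "right_psi A M B N (r \<odot>\<^bsub>T.T\<^sub>R\<^esub> t) = \<eta> r \<odot>\<^bsub>N\<^esub> right_psi A M B N t"
  proof (rule T.T_additive_eqI[OF ND(2) _ _ _ _ _ t])
    fix u m assume u: "u \<in> carrier (U N)" and m: "m \<in> carrier M"
    have uN: "u \<in> carrier N" using u component_iff[OF right_sided] by simp
    have ru: "\<eta>\<^sub>A r \<odot>\<^bsub>U N\<^esub> u \<in> carrier (U N)"
      by (rule right_module.smult_closed[OF U_right_module A.\<eta>_closed[OF r] u])
    have "right_psi A M B N (r \<odot>\<^bsub>T.T\<^sub>R\<^esub> T.pure u m) = \<mu> m \<odot>\<^bsub>N\<^esub> (\<eta>\<^sub>A r \<odot>\<^bsub>U N\<^esub> u)"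
      using T.smult_T(3)[OF r u m] right_psi(3)[OF ru m] by simp
    also have "\<dots> = \<mu> m \<odot>\<^bsub>N\<^esub> (\<eta> r \<odot>\<^bsub>N\<^esub> u)" using \<eta>_on_U[OF right_sided r u] by simp
    also have "\<dots> = \<eta> r \<odot>\<^bsub>N\<^esub> (\<mu> m \<odot>\<^bsub>N\<^esub> u)"
      by (rule smult_central[OF right_sided r _ uN]) (simp add: m)
    finally show "right_psi A M B N (r \<odot>\<^bsub>T.T\<^sub>R\<^esub> T.pure u m) = \<eta> r \<odot>\<^bsub>N\<^esub> right_psi A M B N (T.pure u m)"
      using right_psi(3)[OF u m] by simp
  qed (simp_all add: right_psi T.smult_T r ND(3,5)[OF \<eta>_closed[OF r]] del: triangular_simps(6))
  then show "right_psi A M B N (r \<odot>\<^bsub>T.T\<^sub>R\<^esub> t) = r \<odot>\<^bsub>scalars N\<^esub> right_psi A M B N t" by simp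
qed (simp_all add: right_psi)

lemma U_fin_gen:
  assumes "fin_gen \<Lambda> N"
  shows "fin_gen R (restrict_scalars \<eta>\<^sub>A (U N))"
proof (rule fin_gen_image[OF restrict_module[OF right_sided] A.restrict_module[OF T.sided_U], of "\<lambda>x. e\<^sub>1 \<odot>\<^bsub>N\<^esub> x"])
  note ND = sided_moduleD[OF right_sided]
  show "lin_on R (scalars N) (restrict_scalars \<eta>\<^sub>A (U N)) (carrier (scalars N)) (\<lambda>x. e\<^sub>1 \<odot>\<^bsub>N\<^esub> x)"
    unfolding lin_on_def
  proof (intro conjI ballI)
    show "e\<^sub>1 \<odot>\<^bsub>N\<^esub> (r \<odot>\<^bsub>scalars N\<^esub> x) = r \<odot>\<^bsub>restrict_scalars \<eta>\<^sub>A (U N)\<^esub> (e\<^sub>1 \<odot>\<^bsub>N\<^esub> x)"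
      if "r \<in> carrier R" "x \<in> carrier (scalars N)" for r x
      using that \<eta>_on_U[OF right_sided that(1), of "e\<^sub>1 \<odot>\<^bsub>N\<^esub> x"] smult_central[OF right_sided that(1), of e\<^sub>1 x] by simp
  qed (use ND(5)[of e\<^sub>1] in simp_all)
  show "(\<lambda>x. e\<^sub>1 \<odot>\<^bsub>N\<^esub> x) ` carrier (scalars N) = carrier (restrict_scalars \<eta>\<^sub>A (U N))" by simp
  show "fin_gen R (scalars N)" using assms fin_gen_restrict[OF right_sided] by simp
qed

text \<open>
  The map \<open>g : M \<rightarrow> D U\<close> is read as a functional on \<open>U \<otimes>\<^sub>A M\<close>, transported along the monomorphism \<open>\<psi>\<close>
  and extended to \<open>N\<close>.
\<close>

lemma dual_epi_if_mono:
  assumes fg: "fin_gen \<Lambda> N" and mono: "inj_on (right_psi A M B N) (carrier T.T)"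
    and g: "g \<in> mod_hom A M (U (D N))"
  shows "\<exists>y\<in>carrier (V (D N)). \<forall>m\<in>carrier M. g m = \<mu> m \<odot>\<^bsub>D N\<^esub> y"
proof -
  note ND = sided_moduleD[OF right_sided]
  interpret N: module R "scalars N" by (rule restrict_module[OF right_sided])
  interpret TR: module R T.T\<^sub>R by (rule T.T\<^sub>R_module)
  have DN: "sided_module \<Lambda> (D N)" by (rule D_sided[OF right_sided])
  note gD = mod_homD[OF g]
  have gU: "g m \<in> carrier (D N)" "e\<^sub>1 \<odot>\<^bsub>D N\<^esub> g m = g m" if "m \<in> carrier M" for m
    using gD(1)[OF that] component_iff[OF DN] by auto
  note gmD = D_carrierD[OF gU(1)]
  \<comment> \<open>Only the values of \<open>g m\<close> on \<open>U N\<close> enter. They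
    determine \<open>g m\<close>, which is fixed by \<open>e\<^sub>1\<close>.\<close>
  let ?b = "\<lambda>u m. g m u"
  have UN: "u \<in> carrier N" if "u \<in> carrier (U N)" for u using that component_iff[OF right_sided] by simp
  have bal: "balanced A (U N) M J ?b"
    unfolding balanced_def
  proof (intro conjI ballI)
    fix u m assume u: "u \<in> carrier (U N)" and m: "m \<in> carrier M"
    show "g m u \<in> carrier J" using gmD(1)[OF m UN[OF u]] .
    show "g (m \<oplus>\<^bsub>M\<^esub> m') u = g m u \<oplus>\<^bsub>J\<^esub> g m' u" if "m' \<in> carrier M" for m'
      using gD(2)[OF m that] UN[OF u] by (simp add: D_obj_simps)
  next
    fix u m assume u: "u \<in> carrier (U N)" and m: "m \<in> carrier M"
    show "g m (u \<oplus>\<^bsub>U N\<^esub> u') = g m u \<oplus>\<^bsub>J\<^esub> g m u'" if "u' \<in> carrier (U N)" for u'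
      using gmD(2)[OF m UN[OF u] UN[OF that]] by simp
    show "g m (a \<odot>\<^bsub>U N\<^esub> u) = g (a \<odot>\<^bsub>M\<^esub> m) u" if "a \<in> carrier A" for a
      using gD(3)[OF that m] UN[OF u] by (simp add: D_obj_simps)
  qed
  let ?\<gamma> = "tensor_lift J ?b"
  note \<gamma> = T.tensor_lift[OF abelian_group_axioms bal]
  have \<gamma>_lin: "lin_on R T.T\<^sub>R J (carrier T.T) ?\<gamma>"
  proof (rule T.tensor_lift_linear[OF module_axioms bal])
    show "g m (\<eta>\<^sub>A r \<odot>\<^bsub>U N\<^esub> u) = r \<odot>\<^bsub>J\<^esub> g m u"
      if "r \<in> carrier R" "u \<in> carrier (U N)" "m \<in> carrier M" for r u m
      using gmD(3)[OF that(3,1) UN[OF that(2)]] \<eta>_on_U[OF right_sided that(1,2)] by simp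
  qed
  let ?\<psi> = "right_psi A M B N"
  have Tsub: "submodule (carrier T.T) R T.T\<^sub>R" using TR.carrier_is_submodule by simp
  have W: "submodule (?\<psi> ` carrier T.T) R (scalars N)"
    by (rule TR.submodule_image[OF Tsub right_psi_lin N.module_axioms])
  \<comment> \<open>On the image of \<open>\<psi>\<close> the functional is \<open>?\<gamma>\<close>
    after the inverse of \<open>\<psi>\<close>; this is where injectivity enters.\<close>
  define f where "f v = ?\<gamma> (the_inv_into (carrier T.T) ?\<psi> v)" for v
  have f: "f (?\<psi> t) = ?\<gamma> t" if "t \<in> carrier T.T" for t
    unfolding f_def using the_inv_into_f_f[OF mono that] by simp
  have "lin_on R (scalars N) J (?\<psi> ` carrier T.T) f"
    unfolding lin_on_def
  proof (intro conjI ballI; elim imageE; hypsubst)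
    fix t assume t: "t \<in> carrier T.T"
    show "f (?\<psi> t) \<in> carrier J" using f[OF t] \<gamma>(1)[OF t] by simp
    show "f (?\<psi> t \<oplus>\<^bsub>scalars N\<^esub> ?\<psi> t') = f (?\<psi> t) \<oplus>\<^bsub>J\<^esub> f (?\<psi> t')" if "t' \<in> carrier T.T" for t'
      using f[of "t \<oplus>\<^bsub>T.T\<^esub> t'"] TR.submoduleD(3)[OF Tsub t that] right_psi(2)[OF t that] \<gamma>(2)[OF t that] f[OF t] f[OF that]
      by simp
    show "f (r \<odot>\<^bsub>scalars N\<^esub> ?\<psi> t) = r \<odot>\<^bsub>J\<^esub> f (?\<psi> t)" if r: "r \<in> carrier R" for r
      using f[OF T.smult_T(1)[OF r t]] lin_onD(3)[OF right_psi_lin t r] lin_onD(3)[OF \<gamma>_lin t r] f[OF t] by simp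
  qed
  then obtain y\<^sub>0 where y\<^sub>0: "y\<^sub>0 \<in> carrier (D N)" "\<And>v. v \<in> ?\<psi> ` carrier T.T \<Longrightarrow> y\<^sub>0 v = f v"
    using extend_lin[OF N.module_axioms _ W, of f] fg fin_gen_restrict[OF right_sided] unfolding D_obj_simps by metis
  \<comment> \<open>The extension \<open>y\<^sub>0\<close> matters only on the second component of
    \<open>N\<close>, and the action of \<open>e\<^sub>2\<close> projects it into
    \<open>V (D N)\<close>.\<close>
  have y: "e\<^sub>2 \<odot>\<^bsub>D N\<^esub> y\<^sub>0 \<in> carrier (V (D N))" using y\<^sub>0(1) by simp
  have "g m = \<mu> m \<odot>\<^bsub>D N\<^esub> (e\<^sub>2 \<odot>\<^bsub>D N\<^esub> y\<^sub>0)" if m: "m \<in> carrier M" for m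
  proof (rule D_carrier_eqI[OF gU(1)[OF m]])
    show "\<mu> m \<odot>\<^bsub>D N\<^esub> (e\<^sub>2 \<odot>\<^bsub>D N\<^esub> y\<^sub>0) \<in> carrier (D N)"
      using m y\<^sub>0(1) by (intro D_smult_closed right_sided) simp_all
    fix n assume n: "n \<in> carrier N"
    have e1n: "e\<^sub>1 \<odot>\<^bsub>N\<^esub> n \<in> carrier (U N)" using n by simp
    have pure: "T.pure (e\<^sub>1 \<odot>\<^bsub>N\<^esub> n) m \<in> carrier T.T" by (rule T.pure_closed[OF e1n m])
    have "(\<mu> m \<odot>\<^bsub>D N\<^esub> (e\<^sub>2 \<odot>\<^bsub>D N\<^esub> y\<^sub>0)) n = y\<^sub>0 (e\<^sub>2 \<odot>\<^bsub>N\<^esub> (\<mu> m \<odot>\<^bsub>N\<^esub> n))"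
      using n m right_smult_closed by (simp add: D_obj_simps)
    \<comment> \<open>In the triangular ring both \<open>\<mu> m\<close> times
      \<open>e\<^sub>2\<close> and \<open>e\<^sub>1\<close> times \<open>\<mu> m\<close> are
      \<open>\<mu> m\<close>. On a right module the left factor acts first.\<close>
    also have "e\<^sub>2 \<odot>\<^bsub>N\<^esub> (\<mu> m \<odot>\<^bsub>N\<^esub> n) = \<mu> m \<odot>\<^bsub>N\<^esub> (e\<^sub>1 \<odot>\<^bsub>N\<^esub> n)"
      using n m by (simp add: right_smult_smult)
    also have "\<dots> = ?\<psi> (T.pure (e\<^sub>1 \<odot>\<^bsub>N\<^esub> n) m)" using right_psi(3)[OF e1n m] by simp
    also have "y\<^sub>0 \<dots> = g m (e\<^sub>1 \<odot>\<^bsub>N\<^esub> n)"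
      using y\<^sub>0(2) f[OF pure] pure \<gamma>(3)[OF e1n m] by simp
    also have "\<dots> = (e\<^sub>1 \<odot>\<^bsub>D N\<^esub> g m) n" using n by (simp add: D_obj_simps)
    also have "\<dots> = g m n" using gU(2)[OF m] by simp
    finally show "g m n = (\<mu> m \<odot>\<^bsub>D N\<^esub> (e\<^sub>2 \<odot>\<^bsub>D N\<^esub> y\<^sub>0)) n" by (rule sym)
  qed
  then show ?thesis using y by blast
qed

text \<open>A functional \<open>G\<close> on the tensor product gives a linear map \<open>g\<close>
  from \<open>M\<close> to \<open>U (D N)\<close>, and a preimage \<open>y\<close> of
  \<open>g\<close> satisfies \<open>G = y \<circ> \<psi>\<close>. So elements with the same image
  under \<open>\<psi>\<close> agree under all functionals and are equal.\<close>

lemma mono_if_dual_epi: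
  assumes fg: "fin_gen \<Lambda> N"
    and epi: "\<And>g. g \<in> mod_hom A M (U (D N)) \<Longrightarrow>
      \<exists>y\<in>carrier (V (D N)). \<forall>m\<in>carrier M. g m = \<mu> m \<odot>\<^bsub>D N\<^esub> y"
  shows "inj_on (right_psi A M B N) (carrier T.T)"
proof (rule inj_onI)
  note ND = sided_moduleD[OF right_sided]
  interpret N: abelian_group N by (rule ND(2))
  have DN: "sided_module \<Lambda> (D N)" by (rule D_sided[OF right_sided])
  let ?\<psi> = "right_psi A M B N"
  fix t t' assume t: "t \<in> carrier T.T" "t' \<in> carrier T.T" and eq: "?\<psi> t = ?\<psi> t'"
  show "t = t'"
  proof (rule functionals_separate[OF T.T\<^sub>R_module T.T\<^sub>R_fin_gen[OF U_fin_gen[OF fg] M\<^sub>R_fin_gen]])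
    show "t \<in> carrier T.T\<^sub>R" "t' \<in> carrier T.T\<^sub>R" using t by simp_all
    fix G assume G: "G \<in> mod_hom R T.T\<^sub>R J"
    note GD = mod_homD[OF G, unfolded T.T\<^sub>R_simps]
    have e1: "e\<^sub>1 \<odot>\<^bsub>N\<^esub> n \<in> carrier (U N)" if "n \<in> carrier N" for n using that by simp
    \<comment> \<open>\<open>G\<close> pairs \<open>M\<close> with \<open>U N\<close> only.
      Replacing \<open>n\<close> by its \<open>e\<^sub>1\<close>-part extends each
      \<open>g m\<close> to a functional on \<open>N\<close> that is fixed by
      \<open>e\<^sub>1\<close>.\<close>
    define g where "g = (\<lambda>m\<in>carrier M. \<lambda>n\<in>carrier N. G (T.pure (e\<^sub>1 \<odot>\<^bsub>N\<^esub> n) m))"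
    have g_app: "g m n = G (T.pure (e\<^sub>1 \<odot>\<^bsub>N\<^esub> n) m)" if "m \<in> carrier M" "n \<in> carrier N" for m n
      using that by (simp add: g_def)
    have gDN: "g m \<in> carrier (D N)" if m: "m \<in> carrier M" for m
    proof (rule D_carrierI)
      fix n assume n: "n \<in> carrier N"
      show "g m n \<in> carrier J" using GD(1) T.pure_closed[OF e1[OF n] m] g_app[OF m n] by simp
      show "g m (n \<oplus>\<^bsub>N\<^esub> n') = g m n \<oplus>\<^bsub>J\<^esub> g m n'" if n': "n' \<in> carrier N" for n'
        using GD(2)[OF T.pure_closed[OF e1[OF n] m] T.pure_closed[OF e1[OF n'] m]] T.pureD(1)[OF e1[OF n] e1[OF n'] m]
          g_app[OF m] n n' ND(5)[of e\<^sub>1 n n'] by simp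
      show "g m (\<eta> r \<odot>\<^bsub>N\<^esub> n) = r \<odot>\<^bsub>J\<^esub> g m n" if r: "r \<in> carrier R" for r
      proof -
        have "e\<^sub>1 \<odot>\<^bsub>N\<^esub> (\<eta> r \<odot>\<^bsub>N\<^esub> n) = \<eta>\<^sub>A r \<odot>\<^bsub>U N\<^esub> (e\<^sub>1 \<odot>\<^bsub>N\<^esub> n)"
          using smult_central[OF right_sided r, of e\<^sub>1 n] \<eta>_on_U[OF right_sided r e1[OF n]] n by simp
        then have "g m (\<eta> r \<odot>\<^bsub>N\<^esub> n) = G (r \<odot>\<^bsub>T.T\<^sub>R\<^esub> T.pure (e\<^sub>1 \<odot>\<^bsub>N\<^esub> n) m)"
          using g_app[OF m right_smult_closed[OF \<eta>_closed[OF r] n]] T.smult_T(3)[OF r e1[OF n] m] by simp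
        then show ?thesis using GD(3)[OF r T.pure_closed[OF e1[OF n] m]] g_app[OF m n] by simp
      qed
    qed (simp add: g_def m)
    have gU: "g m \<in> carrier (U (D N))" if m: "m \<in> carrier M" for m
    proof -
      have "e\<^sub>1 \<odot>\<^bsub>D N\<^esub> g m = g m"
      proof (rule D_carrier_eqI[OF _ gDN[OF m]])
        show "e\<^sub>1 \<odot>\<^bsub>D N\<^esub> g m \<in> carrier (D N)" by (rule D_smult_closed[OF right_sided _ gDN[OF m]]) simp
        show "(e\<^sub>1 \<odot>\<^bsub>D N\<^esub> g m) n = g m n" if n: "n \<in> carrier N" for n
          using n m g_app right_smult_closed[of e\<^sub>1 n] by (simp add: D_obj_simps right_smult_smult)
      qed
      then show ?thesis using component_iff(1)[OF DN] gDN[OF m] by blast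
    qed
    have "g \<in> mod_hom A M (U (D N))"
    proof (rule mod_homI)
      fix m assume m: "m \<in> carrier M"
      show "g m \<in> carrier (U (D N))" by (rule gU) fact
      show "g (m \<oplus>\<^bsub>M\<^esub> m') = g m \<oplus>\<^bsub>U (D N)\<^esub> g m'" if m': "m' \<in> carrier M" for m'
        using m m' GD(2) T.pure_closed e1 T.pureD(2)
        by (auto simp: g_def D_obj_simps fun_eq_iff restrict_def simp del: component_simps(1))
      show "g (a \<odot>\<^bsub>M\<^esub> m) = a \<odot>\<^bsub>U (D N)\<^esub> g m" if a: "a \<in> carrier A" for a
      proof
        fix n
        show "g (a \<odot>\<^bsub>M\<^esub> m) n = (a \<odot>\<^bsub>U (D N)\<^esub> g m) n"
        proof (cases "n \<in> carrier N")
          case n: True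
          have "g (a \<odot>\<^bsub>M\<^esub> m) n = G (T.pure (a \<odot>\<^bsub>U N\<^esub> (e\<^sub>1 \<odot>\<^bsub>N\<^esub> n)) m)"
            using g_app[of "a \<odot>\<^bsub>M\<^esub> m" n] a m n T.pureD(3)[OF a e1[OF n] m] by simp
          also have "a \<odot>\<^bsub>U N\<^esub> (e\<^sub>1 \<odot>\<^bsub>N\<^esub> n) = e\<^sub>1 \<odot>\<^bsub>N\<^esub> (\<alpha> a \<odot>\<^bsub>N\<^esub> n)"
            using a n by (simp add: right_smult_smult)
          also have "G (T.pure \<dots> m) = g m (\<alpha> a \<odot>\<^bsub>N\<^esub> n)"
            using g_app[OF m right_smult_closed[of "\<alpha> a" n]] a n by simp
          finally show ?thesis using n by (simp add: D_obj_simps)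
        qed (simp add: g_def D_obj_simps a m)
      qed
    qed (simp add: g_def)
    then obtain y where y: "y \<in> carrier (V (D N))" "\<And>m. m \<in> carrier M \<Longrightarrow> g m = \<mu> m \<odot>\<^bsub>D N\<^esub> y"
      using epi by blast
    have yD: "y \<in> carrier (D N)" using y(1) component_iff(2)[OF DN] by simp
    note yDD = D_carrierD[OF yD]
    have Gy: "G s = y (?\<psi> s)" if s: "s \<in> carrier T.T" for s
    proof (rule T.T_additive_eqI[OF abelian_group_axioms _ _ _ _ _ s])
      fix u m assume u: "u \<in> carrier (U N)" and m: "m \<in> carrier M"
      have u': "u \<in> carrier N" "e\<^sub>1 \<odot>\<^bsub>N\<^esub> u = u" using u component_iff[OF right_sided] by auto
      have "G (T.pure u m) = g m u" using g_app[OF m u'(1)] u'(2) by simp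
      also have "\<dots> = y (\<mu> m \<odot>\<^bsub>N\<^esub> u)" using y(2)[OF m] u'(1) by (simp add: D_obj_simps)
      finally show "G (T.pure u m) = y (?\<psi> (T.pure u m))" using right_psi(3)[OF u m] by simp
    qed (use GD yDD right_psi in simp_all)
    show "G t = G t'" using Gy t eq by simp
  qed
qed

end

end

section \<open>Left modules: the epimorphism condition\<close>

context triangular_algebra
begin

lemma V_left_smult_closed:
  assumes L: "left_module \<Lambda> L" and b: "b \<in> carrier B" and y: "y \<in> carrier (V L)"
  shows "\<beta> b \<odot>\<^bsub>L\<^esub> y \<in> carrier (V L)"
proof -
  have sided: "sided_module \<Lambda> L" using L by (simp add: sided_module_def)
  have "y \<in> carrier L" using y component_iff[OF sided] by simp
  then have "\<beta> b \<odot>\<^bsub>L\<^esub> y \<in> carrier L" "e\<^sub>2 \<odot>\<^bsub>L\<^esub> (\<beta> b \<odot>\<^bsub>L\<^esub> y) = \<beta> b \<odot>\<^bsub>L\<^esub> y"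
    using left_module.smult_assoc[OF L, of "e\<^sub>2" "\<beta> b" y] left_module.smult_closed[OF L, of "\<beta> b" y] b by simp_all
  then show ?thesis using component_iff[OF sided] by blast
qed

text \<open>Evaluates the tensor product away: on the left side only the action of
  \<open>\<mu> m\<close> on \<open>V L\<close> remains, in a form that can be compared with the
  action on \<open>D N\<close>.\<close>

lemma left_phi_adjoint_apply:
  assumes L: "left_module \<Lambda> L" and y: "y \<in> carrier (V L)" and m: "m \<in> carrier M"
  shows "left_phi_adjoint A M B L y m = \<mu> m \<odot>\<^bsub>L\<^esub> y"
proof -
  have sided: "sided_module \<Lambda> L" using L by (simp add: sided_module_def)
  note LD = sided_moduleD[OF sided] and assoc = left_module.smult_assoc[OF L]
  interpret T: tensor_product B "right_part M" "V L"
    using V_left_smult_closed[OF L]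
    by (intro tensor_product.intro component_abelian_group sided Mr.N.abelian_group_axioms) simp_all
  have "balanced B (right_part M) (V L) (U L) (\<lambda>m y. \<mu> m \<odot>\<^bsub>L\<^esub> y)"
    unfolding balanced_def
  proof (intro conjI ballI)
    fix m y assume "m \<in> carrier (right_part M)" and "y \<in> carrier (V L)"
    then have m: "m \<in> carrier M" and y: "y \<in> carrier L" "e\<^sub>2 \<odot>\<^bsub>L\<^esub> y = y"
      using component_iff[OF sided] by auto
    have "\<mu> m \<odot>\<^bsub>L\<^esub> y \<in> carrier L" "e\<^sub>1 \<odot>\<^bsub>L\<^esub> (\<mu> m \<odot>\<^bsub>L\<^esub> y) = \<mu> m \<odot>\<^bsub>L\<^esub> y"
      using assoc[of e\<^sub>1 "\<mu> m" y] LD(3)[of "\<mu> m" y] m y by simp_all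
    then show "\<mu> m \<odot>\<^bsub>L\<^esub> y \<in> carrier (U L)" using component_iff[OF sided] by blast
    show "\<mu> m \<odot>\<^bsub>L\<^esub> (y \<oplus>\<^bsub>V L\<^esub> y') = \<mu> m \<odot>\<^bsub>L\<^esub> y \<oplus>\<^bsub>U L\<^esub> \<mu> m \<odot>\<^bsub>L\<^esub> y'" if "y' \<in> carrier (V L)" for y'
      using that component_iff[OF sided] LD(5)[of "\<mu> m" y y'] m y by simp
  next
    fix m y assume "m \<in> carrier (right_part M)" and "y \<in> carrier (V L)"
    then have m: "m \<in> carrier M" and y: "y \<in> carrier L" using component_iff[OF sided] by auto
    show "\<mu> (m \<oplus>\<^bsub>right_part M\<^esub> m') \<odot>\<^bsub>L\<^esub> y = \<mu> m \<odot>\<^bsub>L\<^esub> y \<oplus>\<^bsub>U L\<^esub> \<mu> m' \<odot>\<^bsub>L\<^esub> y"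
      if "m' \<in> carrier (right_part M)" for m'
      using that LD(4)[of "\<mu> m" "\<mu> m'" y] m y by simp
    show "\<mu> (b \<odot>\<^bsub>right_part M\<^esub> m) \<odot>\<^bsub>L\<^esub> y = \<mu> m \<odot>\<^bsub>L\<^esub> (b \<odot>\<^bsub>V L\<^esub> y)" if "b \<in> carrier B" for b
      using that assoc[of "\<mu> m" "\<beta> b" y] m y by simp
  qed
  from T.tensor_lift(3)[OF component_abelian_group(1)[OF sided] this, of m y]
  show ?thesis using m y by (simp add: left_phi_adjoint_def left_phi_def)
qed

text \<open>Surjectivity of the adjoint structure map, expressed through the action alone. In this
  form it can be checked on a dual module and moved along isomorphisms.\<close>

definition epi_condition :: "('a \<times> 'm \<times> 'b, 'n) module \<Rightarrow> bool"
  where "epi_condition L \<longleftrightarrow> (\<forall>g\<in>mod_hom A M (U L). \<exists>y\<in>carrier (V L). \<forall>m\<in>carrier M. g m = \<mu> m \<odot>\<^bsub>L\<^esub> y)"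

lemma left_phi_adjoint_epi_iff:
  assumes L: "left_module \<Lambda> L"
  shows "left_phi_adjoint A M B L ` carrier (V L) = mod_hom A M (U L) \<longleftrightarrow> epi_condition L"
proof -
  have sided: "sided_module \<Lambda> L" using L by (simp add: sided_module_def)
  note LD = sided_moduleD[OF sided] and assoc = left_module.smult_assoc[OF L]
  note app = left_phi_adjoint_apply[OF L]
  have undef: "left_phi_adjoint A M B L y m = undefined" if "m \<notin> carrier M" for y m
    using that by (simp add: left_phi_adjoint_def)
  have hom: "left_phi_adjoint A M B L y \<in> mod_hom A M (U L)" if y: "y \<in> carrier (V L)" for y
  proof (rule mod_homI)
    have yL: "y \<in> carrier L" using y component_iff[OF sided] by simp
    fix m assume m: "m \<in> carrier M"
    have "\<mu> m \<odot>\<^bsub>L\<^esub> y \<in> carrier L" "e\<^sub>1 \<odot>\<^bsub>L\<^esub> (\<mu> m \<odot>\<^bsub>L\<^esub> y) = \<mu> m \<odot>\<^bsub>L\<^esub> y"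
      using assoc[of e\<^sub>1 "\<mu> m" y] LD(3)[of "\<mu> m" y] m yL by simp_all
    then show "left_phi_adjoint A M B L y m \<in> carrier (U L)"
      unfolding app[OF y m] using component_iff(1)[OF sided] by blast
    show "left_phi_adjoint A M B L y (m \<oplus>\<^bsub>M\<^esub> m') =
        left_phi_adjoint A M B L y m \<oplus>\<^bsub>U L\<^esub> left_phi_adjoint A M B L y m'" if "m' \<in> carrier M" for m'
      using app[OF y] LD(4)[of "\<mu> m" "\<mu> m'" y] m yL that by simp
    show "left_phi_adjoint A M B L y (a \<odot>\<^bsub>M\<^esub> m) = a \<odot>\<^bsub>U L\<^esub> left_phi_adjoint A M B L y m" if "a \<in> carrier A" for a
      using app[OF y] assoc[of "\<alpha> a" "\<mu> m" y] m yL that by simp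
  qed (rule undef)
  have eq: "g = left_phi_adjoint A M B L y \<longleftrightarrow> (\<forall>m\<in>carrier M. g m = \<mu> m \<odot>\<^bsub>L\<^esub> y)"
    if "g \<in> mod_hom A M (U L)" "y \<in> carrier (V L)" for g y
    using mod_hom_eqI[OF that(1) hom[OF that(2)]] app[OF that(2)] by auto
  show ?thesis
    unfolding epi_condition_def
  proof
    assume *: "left_phi_adjoint A M B L ` carrier (V L) = mod_hom A M (U L)"
    show "\<forall>g\<in>mod_hom A M (U L). \<exists>y\<in>carrier (V L). \<forall>m\<in>carrier M. g m = \<mu> m \<odot>\<^bsub>L\<^esub> y"
    proof
      fix g assume g: "g \<in> mod_hom A M (U L)"
      then obtain y where "y \<in> carrier (V L)" "g = left_phi_adjoint A M B L y" using * by blast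
      then show "\<exists>y\<in>carrier (V L). \<forall>m\<in>carrier M. g m = \<mu> m \<odot>\<^bsub>L\<^esub> y" using eq[OF g] by blast
    qed
  next
    assume *: "\<forall>g\<in>mod_hom A M (U L). \<exists>y\<in>carrier (V L). \<forall>m\<in>carrier M. g m = \<mu> m \<odot>\<^bsub>L\<^esub> y"
    show "left_phi_adjoint A M B L ` carrier (V L) = mod_hom A M (U L)"
    proof (intro equalityI subsetI)
      fix g assume g: "g \<in> mod_hom A M (U L)"
      then obtain y where "y \<in> carrier (V L)" "\<forall>m\<in>carrier M. g m = \<mu> m \<odot>\<^bsub>L\<^esub> y" using * by blast
      then show "g \<in> left_phi_adjoint A M B L ` carrier (V L)" using eq[OF g] by blast
    qed (use hom in auto)
  qed
qed

lemma mono_iff_dual_epi: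
  assumes "right_module \<Lambda> N" "fin_gen \<Lambda> N"
  shows "inj_on (right_psi A M B N) (carrier (tensor A (U N) M)) \<longleftrightarrow> epi_condition (D N)"
proof -
  have "carrier (tensor A (U N) M) = carrier (tensor_group A (U N) M)" by (simp add: tensor_group_def)
  then show ?thesis
    using dual_epi_if_mono[OF assms] mono_if_dual_epi[OF assms] unfolding epi_condition_def by metis
qed

text \<open>\<open>g\<close> followed by \<open>k\<close> has a preimage \<open>y\<close> in
  \<open>L\<close>, and \<open>h y\<close> is then a preimage of \<open>g\<close>. The equation
  \<open>h (k x) = x\<close> carries the argument, so the condition passes to retracts.\<close>

lemma epi_condition_iso:
  assumes L: "sided_module \<Lambda> L" and L': "sided_module \<Lambda> L'"
    and h: "h \<in> mod_hom \<Lambda> L L'" and k: "k \<in> mod_hom \<Lambda> L' L" and hk: "\<And>x. x \<in> carrier L' \<Longrightarrow> h (k x) = x"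
    and epi: "epi_condition L"
  shows "epi_condition L'"
  unfolding epi_condition_def
proof
  note hD = mod_homD[OF h] and kD = mod_homD[OF k]
  fix g assume g: "g \<in> mod_hom A M (U L')"
  note gD = mod_homD[OF g]
  have gL': "g m \<in> carrier L'" "e\<^sub>1 \<odot>\<^bsub>L'\<^esub> g m = g m" if "m \<in> carrier M" for m
    using gD(1)[OF that] component_iff[OF L'] by auto
  define g' where "g' = (\<lambda>m\<in>carrier M. k (g m))"
  have "g' \<in> mod_hom A M (U L)"
  proof (rule mod_homI)
    fix m assume m: "m \<in> carrier M"
    have "k (g m) = e\<^sub>1 \<odot>\<^bsub>L\<^esub> k (g m)" using kD(3)[of e\<^sub>1 "g m"] gL'[OF m] by simp
    then show "g' m \<in> carrier (U L)" using component_iff(1)[OF L] kD(1)[OF gL'(1)[OF m]] m by (metis g'_def restrict_apply')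
    show "g' (m \<oplus>\<^bsub>M\<^esub> m') = g' m \<oplus>\<^bsub>U L\<^esub> g' m'" if "m' \<in> carrier M" for m'
      using gD(2)[OF m that] kD(2)[OF gL'(1)[OF m] gL'(1)[OF that]] m that by (simp add: g'_def)
    show "g' (a \<odot>\<^bsub>M\<^esub> m) = a \<odot>\<^bsub>U L\<^esub> g' m" if "a \<in> carrier A" for a
      using gD(3)[OF that m] kD(3)[OF _ gL'(1)[OF m], of "\<alpha> a"] m that by (simp add: g'_def)
  qed (simp add: g'_def)
  then obtain y where y: "y \<in> carrier (V L)" "\<And>m. m \<in> carrier M \<Longrightarrow> g' m = \<mu> m \<odot>\<^bsub>L\<^esub> y"
    using epi unfolding epi_condition_def by blast
  have yL: "y \<in> carrier L" "e\<^sub>2 \<odot>\<^bsub>L\<^esub> y = y" using y(1) component_iff[OF L] by auto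
  have "h y = e\<^sub>2 \<odot>\<^bsub>L'\<^esub> h y" using hD(3)[of e\<^sub>2 y] yL by simp
  then have "h y \<in> carrier (V L')" using component_iff(2)[OF L'] hD(1)[OF yL(1)] by metis
  moreover have "g m = \<mu> m \<odot>\<^bsub>L'\<^esub> h y" if m: "m \<in> carrier M" for m
    using y(2)[OF m] hk[OF gL'(1)[OF m]] hD(3)[OF _ yL(1), of "\<mu> m"] m by (simp add: g'_def)
  ultimately show "\<exists>y\<in>carrier (V L'). \<forall>m\<in>carrier M. g m = \<mu> m \<odot>\<^bsub>L'\<^esub> y" by blast
qed

end

section \<open>Categories of modules\<close>

lemma module_category_simps [simp]:
  "Obj (module_category L Ob) = Ob" "Arr (module_category L Ob) = mod_hom L"
  "Ident (module_category L Ob) X = (\<lambda>x\<in>carrier X. x)"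
  "Comp (module_category L Ob) X Y Z g f = compose (carrier X) g f"
  by (simp_all add: module_category_def)

lemma opposite_simps [simp]:
  "Obj (opposite C) = Obj C" "Arr (opposite C) X Y = Arr C Y X" "Ident (opposite C) = Ident C"
  "Comp (opposite C) X Y Z g f = Comp C Z Y X f g"
  by (simp_all add: opposite_def)

lemma is_category_opposite: "is_category C \<Longrightarrow> is_category (opposite C)"
  unfolding is_category_def by simp

lemma mod_hom_ident: "sided_module L X \<Longrightarrow> (\<lambda>x\<in>carrier X. x) \<in> mod_hom L X X"
  using sided_moduleD(3)[of L X] abelian_groupE(1)[OF sided_moduleD(2), of L X] by (intro mod_homI) auto

lemma mod_hom_compose:
  assumes X: "sided_module L X" and f: "f \<in> mod_hom L X Y" and g: "g \<in> mod_hom L Y Z"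
  shows "compose (carrier X) g f \<in> mod_hom L X Z"
  using mod_homD[OF f] mod_homD[OF g] sided_moduleD(3)[OF X] abelian_groupE(1)[OF sided_moduleD(2)[OF X]]
  by (intro mod_homI) (auto simp: compose_def)

lemma is_category_module_category:
  assumes "\<And>X. X \<in> Ob \<Longrightarrow> sided_module L X"
  shows "is_category (module_category L Ob)"
  unfolding is_category_def module_category_simps
proof (intro conjI ballI)
  fix W X Y Z f g h
  assume "W \<in> Ob" and f: "f \<in> mod_hom L W X"
  show "compose (carrier W) h (compose (carrier W) g f) = compose (carrier W) (compose (carrier X) h g) f"
    using mod_homD(1)[OF f] by (auto simp: compose_def fun_eq_iff restrict_def)
next
  fix X Y f assume f: "f \<in> mod_hom L X Y"
  show "compose (carrier X) f (\<lambda>x\<in>carrier X. x) = f" "compose (carrier X) (\<lambda>y\<in>carrier Y. y) f = f"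
    using mod_homD(1,4)[OF f] by (auto simp: compose_def fun_eq_iff restrict_def)
qed (use assms mod_hom_ident mod_hom_compose in blast)+

lemma is_iso_arrow_module_category:
  assumes f: "f \<in> mod_hom L X Y" "bij_betw f (carrier X) (carrier Y)"
    and X: "sided_module L X" and Y: "sided_module L Y"
  obtains g where "g \<in> mod_hom L Y X" "\<And>x. x \<in> carrier X \<Longrightarrow> g (f x) = x" "\<And>y. y \<in> carrier Y \<Longrightarrow> f (g y) = y"
    "is_iso_arrow (module_category L Ob) X Y f"
proof -
  note fD = mod_homD[OF f(1)] and XD = sided_moduleD[OF X]
  have inj: "inj_on f (carrier X)" and surj: "f ` carrier X = carrier Y" using f(2) by (auto simp: bij_betw_def)
  define g where "g = (\<lambda>y\<in>carrier Y. the_inv_into (carrier X) f y)"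
  have gf: "g (f x) = x" if "x \<in> carrier X" for x
    using that fD(1) the_inv_into_f_f[OF inj that] by (simp add: g_def)
  have YE: "\<exists>x\<in>carrier X. y = f x" if "y \<in> carrier Y" for y using that surj by blast
  have fg: "f (g y) = y" if "y \<in> carrier Y" for y using YE[OF that] gf by auto
  have "g \<in> mod_hom L Y X"
  proof (rule mod_homI)
    fix y assume "y \<in> carrier Y"
    then obtain x where x: "x \<in> carrier X" "y = f x" using YE by blast
    show "g y \<in> carrier X" using gf x by simp
    show "g (y \<oplus>\<^bsub>Y\<^esub> y') = g y \<oplus>\<^bsub>X\<^esub> g y'" if y': "y' \<in> carrier Y" for y'
    proof -
      obtain x' where "x' \<in> carrier X" "y' = f x'" using YE[OF y'] by blast
      then show ?thesis
        using x fD(2)[OF x(1), of x'] gf[of "x \<oplus>\<^bsub>X\<^esub> x'"] gf abelian_groupE(1)[OF XD(2) x(1), of x'] by simp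
    qed
    show "g (a \<odot>\<^bsub>Y\<^esub> y) = a \<odot>\<^bsub>X\<^esub> g y" if "a \<in> carrier L" for a
      using x fD(3)[OF that x(1)] gf[OF XD(3)[OF that x(1)]] gf[OF x(1)] by simp
  qed (simp add: g_def)
  moreover have "is_iso_arrow (module_category L Ob) X Y f"
    unfolding is_iso_arrow_def module_category_simps
    using f(1) calculation gf fg by (auto simp: compose_def fun_eq_iff restrict_def intro!: bexI[of _ g])
  ultimately show thesis using that gf fg by blast
qed

text \<open>Chosen preimages \<open>G Z\<close> with isomorphisms \<open>s Z\<close> from
  \<open>F (G Z)\<close> to \<open>Z\<close> determine a quasi-inverse: an arrow is conjugated by
  these isomorphisms and lifted uniquely along \<open>Fm\<close>. Equations in \<open>C\<close> are
  verified after applying \<open>F\<close>.\<close>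

lemma is_equivalence_if_fully_faithful:
  assumes F: "is_functor C D F Fm"
    and ff: "\<And>X Y. X \<in> Obj C \<Longrightarrow> Y \<in> Obj C \<Longrightarrow> bij_betw (Fm X Y) (Arr C X Y) (Arr D (F X) (F Y))"
    and ess: "\<And>Z. Z \<in> Obj D \<Longrightarrow> \<exists>X\<in>Obj C. \<exists>s. is_iso_arrow D (F X) Z s"
  shows "is_equivalence C D F Fm"
proof -
  have cat: "is_category C" "is_category D" using F by (auto simp: is_functor_def)
  have Fo: "F X \<in> Obj D" if "X \<in> Obj C" for X using F that by (simp add: is_functor_def)
  have Fa: "Fm X Y f \<in> Arr D (F X) (F Y)" if "X \<in> Obj C" "Y \<in> Obj C" "f \<in> Arr C X Y" for X Y f
    using F that unfolding is_functor_def by blast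
  have Fid: "Fm X X (Ident C X) = Ident D (F X)" if "X \<in> Obj C" for X using F that by (simp add: is_functor_def)
  have Fc: "Fm X Z (Comp C X Y Z g f) = Comp D (F X) (F Y) (F Z) (Fm Y Z g) (Fm X Y f)"
    if "X \<in> Obj C" "Y \<in> Obj C" "Z \<in> Obj C" "f \<in> Arr C X Y" "g \<in> Arr C Y Z" for X Y Z f g
    using F that unfolding is_functor_def by blast
  have Cid: "Ident C X \<in> Arr C X X" if "X \<in> Obj C" for X
    using cat(1) that unfolding is_category_def by blast
  have Cc: "Comp C X Y Z g f \<in> Arr C X Z"
    if "X \<in> Obj C" "Y \<in> Obj C" "Z \<in> Obj C" "f \<in> Arr C X Y" "g \<in> Arr C Y Z" for X Y Z f g
    using cat(1) that unfolding is_category_def by blast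
  have Dc: "Comp D X Y Z g f \<in> Arr D X Z"
    if "X \<in> Obj D" "Y \<in> Obj D" "Z \<in> Obj D" "f \<in> Arr D X Y" "g \<in> Arr D Y Z" for X Y Z f g
    using cat(2) that unfolding is_category_def by blast
  have Dr: "Comp D X X Y f (Ident D X) = f" and Dl: "Comp D X Y Y (Ident D Y) f = f"
    if "X \<in> Obj D" "Y \<in> Obj D" "f \<in> Arr D X Y" for X Y f
    using cat(2) that unfolding is_category_def by blast+
  have Da: "Comp D W Y Z h (Comp D W X Y g f) = Comp D W X Z (Comp D X Y Z h g) f"
    if "W \<in> Obj D" "X \<in> Obj D" "Y \<in> Obj D" "Z \<in> Obj D" "f \<in> Arr D W X" "g \<in> Arr D X Y" "h \<in> Arr D Y Z"
    for W X Y Z f g h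
    using cat(2) that unfolding is_category_def by blast
  define l where "l X Y = the_inv_into (Arr C X Y) (Fm X Y)" for X Y
  have l: "l X Y h \<in> Arr C X Y" "Fm X Y (l X Y h) = h"
    if "X \<in> Obj C" "Y \<in> Obj C" "h \<in> Arr D (F X) (F Y)" for X Y h
    using ff[OF that(1,2)] that(3) the_inv_into_into[of "Fm X Y" "Arr C X Y" h] f_the_inv_into_f[of "Fm X Y" "Arr C X Y" h]
    unfolding l_def bij_betw_def by auto
  have faithful: "f = g" if "X \<in> Obj C" "Y \<in> Obj C" "f \<in> Arr C X Y" "g \<in> Arr C X Y" "Fm X Y f = Fm X Y g" for X Y f g
    using ff[OF that(1,2)] that(3-5) unfolding bij_betw_def inj_on_def by blast
  have "\<forall>Z\<in>Obj D. \<exists>X s s'. X \<in> Obj C \<and> s \<in> Arr D (F X) Z \<and> s' \<in> Arr D Z (F X) \<and>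
      Comp D (F X) Z (F X) s' s = Ident D (F X) \<and> Comp D Z (F X) Z s s' = Ident D Z"
    using ess unfolding is_iso_arrow_def by blast
  then obtain G s s' where G: "\<And>Z. Z \<in> Obj D \<Longrightarrow> G Z \<in> Obj C"
    and s: "\<And>Z. Z \<in> Obj D \<Longrightarrow> s Z \<in> Arr D (F (G Z)) Z" "\<And>Z. Z \<in> Obj D \<Longrightarrow> s' Z \<in> Arr D Z (F (G Z))"
    and ss: "\<And>Z. Z \<in> Obj D \<Longrightarrow> Comp D (F (G Z)) Z (F (G Z)) (s' Z) (s Z) = Ident D (F (G Z))"
      "\<And>Z. Z \<in> Obj D \<Longrightarrow> Comp D Z (F (G Z)) Z (s Z) (s' Z) = Ident D Z" by metis
  \<comment> \<open>The arrow \<open>g\<close> conjugated by the chosen isomorphisms, now between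
    objects in the image of \<open>F\<close>.\<close>
  define m where "m Z W g = Comp D (F (G Z)) W (F (G W)) (s' W) (Comp D (F (G Z)) Z W g (s Z))" for Z W g
  have m: "m Z W g \<in> Arr D (F (G Z)) (F (G W))" if "Z \<in> Obj D" "W \<in> Obj D" "g \<in> Arr D Z W" for Z W g
    unfolding m_def using that G Fo s by (intro Dc) auto
  define Gm where "Gm Z W g = l (G Z) (G W) (m Z W g)" for Z W g
  have Gm: "Gm Z W g \<in> Arr C (G Z) (G W)" "Fm (G Z) (G W) (Gm Z W g) = m Z W g"
    if "Z \<in> Obj D" "W \<in> Obj D" "g \<in> Arr D Z W" for Z W g
    unfolding Gm_def using l[OF G[OF that(1)] G[OF that(2)] m[OF that]] by auto
  \<comment> \<open>The naturality square of \<open>s\<close>: composing with \<open>s W\<close>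
    undoes \<open>s' W\<close>.\<close>
  have cancel: "Comp D (F (G Z)) (F (G W)) W (s W) (m Z W g) = Comp D (F (G Z)) Z W g (s Z)"
    if "Z \<in> Obj D" "W \<in> Obj D" "g \<in> Arr D Z W" for Z W g
  proof -
    let ?h = "Comp D (F (G Z)) Z W g (s Z)"
    have h: "?h \<in> Arr D (F (G Z)) W" using that G Fo s by (intro Dc) auto
    have "Comp D (F (G Z)) (F (G W)) W (s W) (m Z W g) =
        Comp D (F (G Z)) W W (Comp D W (F (G W)) W (s W) (s' W)) ?h"
      unfolding m_def using that G Fo s h by (intro Da) auto
    then show ?thesis using ss(2) Dl h that G Fo by simp
  qed
  have "is_functor D C G Gm"
    unfolding is_functor_def
  proof (intro conjI ballI cat)
    fix Z assume Z: "Z \<in> Obj D"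
    show "G Z \<in> Obj C" by (rule G[OF Z])
    have idZ: "Ident D Z \<in> Arr D Z Z" using cat(2) Z unfolding is_category_def by blast
    show "Gm Z Z (Ident D Z) = Ident C (G Z)"
    proof (rule faithful[OF G[OF Z] G[OF Z] Gm(1)[OF Z Z idZ] Cid[OF G[OF Z]]])
      show "Fm (G Z) (G Z) (Gm Z Z (Ident D Z)) = Fm (G Z) (G Z) (Ident C (G Z))"
        unfolding Gm(2)[OF Z Z idZ] Fid[OF G[OF Z]] m_def
        using Dl[OF Fo[OF G[OF Z]] Z s(1)[OF Z]] ss(1)[OF Z] by simp
    qed
  next
    fix Z W g assume "Z \<in> Obj D" "W \<in> Obj D" "g \<in> Arr D Z W"
    then show "Gm Z W g \<in> Arr C (G Z) (G W)" by (rule Gm)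
  next
    fix Z W X f g assume Z: "Z \<in> Obj D" and W: "W \<in> Obj D" and X: "X \<in> Obj D"
      and f: "f \<in> Arr D Z W" and g: "g \<in> Arr D W X"
    have gf: "Comp D Z W X g f \<in> Arr D Z X" by (rule Dc[OF Z W X f g])
    show "Gm Z X (Comp D Z W X g f) = Comp C (G Z) (G W) (G X) (Gm W X g) (Gm Z W f)"
    proof (rule faithful[OF G[OF Z] G[OF X] Gm(1)[OF Z X gf]])
      show "Comp C (G Z) (G W) (G X) (Gm W X g) (Gm Z W f) \<in> Arr C (G Z) (G X)"
        by (rule Cc[OF G[OF Z] G[OF W] G[OF X] Gm(1)[OF Z W f] Gm(1)[OF W X g]])
      note o = Fo[OF G[OF Z]] Fo[OF G[OF W]] Fo[OF G[OF X]]
      have gs: "Comp D (F (G W)) W X g (s W) \<in> Arr D (F (G W)) X" by (rule Dc[OF o(2) W X s(1)[OF W] g])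
      have "Fm (G Z) (G X) (Comp C (G Z) (G W) (G X) (Gm W X g) (Gm Z W f)) =
          Comp D (F (G Z)) (F (G W)) (F (G X)) (m W X g) (m Z W f)"
        unfolding Fc[OF G[OF Z] G[OF W] G[OF X] Gm(1)[OF Z W f] Gm(1)[OF W X g]] Gm(2)[OF Z W f] Gm(2)[OF W X g] ..
      also have "\<dots> = Comp D (F (G Z)) X (F (G X)) (s' X)
          (Comp D (F (G Z)) (F (G W)) X (Comp D (F (G W)) W X g (s W)) (m Z W f))"
        unfolding m_def[of W X g] by (rule Da[OF o(1,2) X o(3) m[OF Z W f] gs s(2)[OF X], symmetric])
      also have "Comp D (F (G Z)) (F (G W)) X (Comp D (F (G W)) W X g (s W)) (m Z W f) =
          Comp D (F (G Z)) W X g (Comp D (F (G Z)) (F (G W)) W (s W) (m Z W f))"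
        by (rule Da[OF o(1,2) W X m[OF Z W f] s(1)[OF W] g, symmetric])
      also have "\<dots> = Comp D (F (G Z)) Z X (Comp D Z W X g f) (s Z)"
        unfolding cancel[OF Z W f] by (rule Da[OF o(1) Z W X s(1)[OF Z] f g])
      finally show "Fm (G Z) (G X) (Gm Z X (Comp D Z W X g f)) =
          Fm (G Z) (G X) (Comp C (G Z) (G W) (G X) (Gm W X g) (Gm Z W f))"
        unfolding Gm(2)[OF Z X gf] m_def[of Z X] by simp
    qed
  qed
  moreover have "natural_iso D D (\<lambda>Z. F (G Z)) (\<lambda>Z W g. Fm (G Z) (G W) (Gm Z W g)) (\<lambda>Z. Z) (\<lambda>Z W g. g) s"
    unfolding natural_iso_def is_iso_arrow_def
  proof (intro conjI ballI)
    fix Z assume Z: "Z \<in> Obj D"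
    show "s Z \<in> Arr D (F (G Z)) Z" by (rule s(1)[OF Z])
    show "\<exists>g\<in>Arr D Z (F (G Z)). Comp D (F (G Z)) Z (F (G Z)) g (s Z) = Ident D (F (G Z)) \<and>
        Comp D Z (F (G Z)) Z (s Z) g = Ident D Z"
      using s(2)[OF Z] ss[OF Z] by blast
  qed (simp add: cancel Gm(2))
  \<comment> \<open>The components are lifted from \<open>s (F X)\<close> by fullness; faithfulness
    reduces their equations to those of \<open>s\<close>.\<close>
  moreover have "natural_iso C C (\<lambda>X. G (F X)) (\<lambda>X Y f. Gm (F X) (F Y) (Fm X Y f)) (\<lambda>X. X) (\<lambda>X Y f. f)
      (\<lambda>X. l (G (F X)) X (s (F X)))"
    unfolding natural_iso_def is_iso_arrow_def
  proof (intro conjI ballI)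
    fix X assume X: "X \<in> Obj C"
    note FX = Fo[OF X] and GX = G[OF Fo[OF X]]
    note t = l[OF GX X s(1)[OF FX]] and t' = l[OF X GX s(2)[OF FX]]
    show "l (G (F X)) X (s (F X)) \<in> Arr C (G (F X)) X" by (rule t)
    show "\<exists>g\<in>Arr C X (G (F X)). Comp C (G (F X)) X (G (F X)) g (l (G (F X)) X (s (F X))) = Ident C (G (F X)) \<and>
        Comp C X (G (F X)) X (l (G (F X)) X (s (F X))) g = Ident C X"
    proof (intro bexI[OF _ t'(1)] conjI)
      show "Comp C (G (F X)) X (G (F X)) (l X (G (F X)) (s' (F X))) (l (G (F X)) X (s (F X))) = Ident C (G (F X))"
        by (rule faithful[OF GX GX Cc[OF GX X GX t(1) t'(1)] Cid[OF GX]])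
          (simp add: Fc[OF GX X GX t(1) t'(1)] t(2) t'(2) Fid[OF GX] ss(1)[OF FX])
      show "Comp C X (G (F X)) X (l (G (F X)) X (s (F X))) (l X (G (F X)) (s' (F X))) = Ident C X"
        by (rule faithful[OF X X Cc[OF X GX X t'(1) t(1)] Cid[OF X]])
          (simp add: Fc[OF X GX X t'(1) t(1)] t(2) t'(2) Fid[OF X] ss(2)[OF FX])
    qed
  next
    fix X Y f assume X: "X \<in> Obj C" and Y: "Y \<in> Obj C" and f: "f \<in> Arr C X Y"
    note FX = Fo[OF X] and GX = G[OF Fo[OF X]] and FY = Fo[OF Y] and GY = G[OF Fo[OF Y]] and Ff = Fa[OF X Y f]
    note tX = l[OF GX X s(1)[OF FX]] and tY = l[OF GY Y s(1)[OF FY]] and Gf = Gm[OF FX FY Ff]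
    show "Comp C (G (F X)) (G (F Y)) Y (l (G (F Y)) Y (s (F Y))) (Gm (F X) (F Y) (Fm X Y f)) =
        Comp C (G (F X)) X Y f (l (G (F X)) X (s (F X)))"
      by (rule faithful[OF GX Y Cc[OF GX GY Y Gf(1) tY(1)] Cc[OF GX X Y tX(1) f]])
        (simp add: Fc[OF GX GY Y Gf(1) tY(1)] Fc[OF GX X Y tX(1) f] tX(2) tY(2) Gf(2) cancel[OF FX FY Ff])
  qed
  ultimately show ?thesis using F unfolding is_equivalence_def by blast
qed

section \<open>Contravariant functoriality of \<open>D\<close>\<close>

context artin_duality
begin

lemma D_map_ident:
  assumes "sided_module L X"
  shows "D_map R J \<eta> X X (\<lambda>x\<in>carrier X. x) = (\<lambda>f\<in>carrier (D X). f)"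
proof
  fix f
  show "D_map R J \<eta> X X (\<lambda>x\<in>carrier X. x) f = (\<lambda>f\<in>carrier (D X). f) f"
  proof (cases "f \<in> carrier (D X)")
    case f: True
    have "D_map R J \<eta> X X (\<lambda>x\<in>carrier X. x) f = f"
      by (rule D_carrier_eqI[OF D_map_closed[OF assms mod_hom_ident[OF assms] f] f]) (simp add: D_map_apply f)
    then show ?thesis using f by simp
  qed (simp add: D_map_def)
qed

lemma D_map_compose:
  assumes X: "sided_module L X" and Y: "sided_module L Y"
    and f: "f \<in> mod_hom L X Y" and g: "g \<in> mod_hom L Y Z"
  shows "D_map R J \<eta> X Z (compose (carrier X) g f) =
    compose (carrier (D Z)) (D_map R J \<eta> X Y f) (D_map R J \<eta> Y Z g)"
proof
  fix z
  show "D_map R J \<eta> X Z (compose (carrier X) g f) z =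
      compose (carrier (D Z)) (D_map R J \<eta> X Y f) (D_map R J \<eta> Y Z g) z"
  proof (cases "z \<in> carrier (D Z)")
    case z: True
    note gz = D_map_closed[OF Y g z]
    have "D_map R J \<eta> X Z (compose (carrier X) g f) z = D_map R J \<eta> X Y f (D_map R J \<eta> Y Z g z)"
    proof (rule D_carrier_eqI)
      show "D_map R J \<eta> X Z (compose (carrier X) g f) z \<in> carrier (D X)"
        by (rule D_map_closed[OF X mod_hom_compose[OF X f g] z])
      show "D_map R J \<eta> X Y f (D_map R J \<eta> Y Z g z) \<in> carrier (D X)" by (rule D_map_closed[OF X f gz])
      show "D_map R J \<eta> X Z (compose (carrier X) g f) z x = D_map R J \<eta> X Y f (D_map R J \<eta> Y Z g z) x"
        if x: "x \<in> carrier X" for x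
        using mod_homD(1)[OF f x] x by (simp add: D_map_apply z gz compose_def)
    qed
    then show ?thesis using z by (simp add: compose_def)
  qed (simp add: D_map_def compose_def)
qed

end

theorem proposition4p1:
  fixes R :: "'r ring" and A :: "'a ring" and B :: "'b ring"
    and M :: "('a, 'm, 'b) bimodule"
    and \<eta>\<^sub>A :: "'r \<Rightarrow> 'a" and \<eta>\<^sub>B :: "'r \<Rightarrow> 'b"
    and J :: "('r, 'e) module" and i :: "'r set \<Rightarrow> 'e"
    and \<iota> :: "('a \<times> 'm \<times> 'b) list \<Rightarrow> 'n"
  assumes "artin_algebra R A \<eta>\<^sub>A" and "artin_algebra R B \<eta>\<^sub>B"
    and "is_bimodule A B M"
    and "artin_algebra R (triangular A M B) (triangular_unit M \<eta>\<^sub>A \<eta>\<^sub>B)"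
    and "injective_envelope R (top_module R) J i"
    and universe: "inj \<iota>" \<comment> \<open>\<open>'n\<close> is large enough to carry a copy of every finitely generated \<open>\<Lambda>\<close>-module\<close>
  shows "is_duality
    (mono_category_right A M B :: (('a \<times> 'm \<times> 'b, 'n) module, 'n \<Rightarrow> 'n) category)
    (epi_category A M B :: (('a \<times> 'm \<times> 'b, 'n \<Rightarrow> 'e) module, ('n \<Rightarrow> 'e) \<Rightarrow> ('n \<Rightarrow> 'e)) category)
    (D_obj R J (triangular_unit M \<eta>\<^sub>A \<eta>\<^sub>B))
    (D_map R J (triangular_unit M \<eta>\<^sub>A \<eta>\<^sub>B))"
proof -
  have "module R J" using assms(5) by (simp add: injective_envelope_def injective_module_def)
  then interpret triangular_algebra R J i A B M \<eta>\<^sub>A \<eta>\<^sub>B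
    using assms
    by (intro triangular_algebra.intro triangular_algebra_axioms.intro artin_envelope.intro
        artin_envelope_axioms.intro) (simp_all add: artin_algebra_def)
  let ?C = "mono_category_right A M B :: (('a \<times> 'm \<times> 'b, 'n) module, 'n \<Rightarrow> 'n) category"
  let ?E = "epi_category A M B :: (('a \<times> 'm \<times> 'b, 'n \<Rightarrow> 'e) module, ('n \<Rightarrow> 'e) \<Rightarrow> ('n \<Rightarrow> 'e)) category"
  let ?Dm = "D_map R J \<eta>"
  \<comment> \<open>Both classes of objects are described by \<open>epi_condition\<close>, applied
    to \<open>D X\<close> on one side and to \<open>Z\<close> on the other. That \<open>D\<close>
    maps the first class into the second is then immediate.\<close>
  have C_obj: "X \<in> Obj ?C \<longleftrightarrow> right_module \<Lambda> X \<and> fin_gen \<Lambda> X \<and> epi_condition (D X)" for X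
    using mono_iff_dual_epi[of X] by (auto simp: mono_category_right_def)
  have E_obj: "Z \<in> Obj ?E \<longleftrightarrow> left_module \<Lambda> Z \<and> fin_gen \<Lambda> Z \<and> epi_condition Z" for Z
    using left_phi_adjoint_epi_iff[of Z] by (auto simp: epi_category_def)
  have C_sided: "sided_module \<Lambda> X" "fin_gen \<Lambda> X" if "X \<in> Obj ?C" for X
    using that C_obj by (auto simp: sided_module_def)
  have E_sided: "sided_module \<Lambda> Z" "fin_gen \<Lambda> Z" if "Z \<in> Obj ?E" for Z
    using that E_obj by (auto simp: sided_module_def)
  have C_simps: "Arr ?C = mod_hom \<Lambda>" "Ident ?C X = (\<lambda>x\<in>carrier X. x)"
    "Comp ?C X Y Z g f = compose (carrier X) g f" for X Y Z g f
    by (simp_all add: mono_category_right_def)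
  have E_simps: "Arr ?E = mod_hom \<Lambda>" "Ident ?E Z = (\<lambda>x\<in>carrier Z. x)"
    "Comp ?E W Y Z g f = compose (carrier W) g f" for W Y Z g f
    by (simp_all add: epi_category_def)
  have D_in_E: "D X \<in> Obj ?E" if "X \<in> Obj ?C" for X
    unfolding E_obj using that[unfolded C_obj] D_left_module[of X] D_fin_gen[OF C_sided[OF that]] by blast
  have "is_category ?C"
    unfolding mono_category_right_def by (rule is_category_module_category) (auto simp: sided_module_def)
  then have "is_category (opposite ?C)" by (rule is_category_opposite)
  moreover have "is_category ?E"
    unfolding epi_category_def by (rule is_category_module_category) (auto simp: sided_module_def)
  ultimately have "is_functor (opposite ?C) ?E D (\<lambda>X Y. ?Dm Y X)"
    unfolding is_functor_def opposite_simps C_simps E_simps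
    by (intro conjI ballI D_in_E D_map_hom D_map_ident D_map_compose C_sided)
  \<comment> \<open>\<open>D\<close> is a covariant functor on the opposite category, where an arrow
    from \<open>X\<close> to \<open>Y\<close> is a module map from \<open>Y\<close> to
    \<open>X\<close>.\<close>
  moreover have "bij_betw (?Dm Y X) (mod_hom \<Lambda> Y X) (mod_hom \<Lambda> (D X) (D Y))"
    if X: "X \<in> Obj ?C" and Y: "Y \<in> Obj ?C" for X Y
    unfolding bij_betw_def
  proof (intro conjI inj_onI equalityI subsetI)
    show "h = k" if "h \<in> mod_hom \<Lambda> Y X" "k \<in> mod_hom \<Lambda> Y X" "?Dm Y X h = ?Dm Y X k" for h k
      by (rule D_map_inj[OF C_sided[OF X] that])
    show "\<phi> \<in> mod_hom \<Lambda> (D X) (D Y)" if "\<phi> \<in> ?Dm Y X ` mod_hom \<Lambda> Y X" for \<phi>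
      using that D_map_hom[OF C_sided(1)[OF Y] C_sided(1)[OF X]] by blast
    show "\<phi> \<in> ?Dm Y X ` mod_hom \<Lambda> Y X" if \<phi>: "\<phi> \<in> mod_hom \<Lambda> (D X) (D Y)" for \<phi>
      by (rule D_map_surj[OF C_sided(1)[OF Y] C_sided[OF X] \<phi>]) blast
  qed
  moreover have "\<exists>X\<in>Obj ?C. \<exists>s. is_iso_arrow ?E (D X) Z s" if Z: "Z \<in> Obj ?E" for Z
  proof -
    note ZS = E_sided[OF Z]
    have DZ: "right_module \<Lambda> (D Z)" "sided_module \<Lambda> (D Z)" "fin_gen \<Lambda> (D Z)"
      using Z[unfolded E_obj] D_right_module[of Z] D_sided[OF ZS(1)] D_fin_gen[OF ZS] by blast+
    \<comment> \<open>\<open>D Z\<close> is a right module on the type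
      \<open>('n \<Rightarrow> 'e) \<Rightarrow> 'e\<close>. Coding its elements by lists and
      embedding the lists by \<open>\<iota>\<close> produces the copy \<open>X\<close> on
      \<open>'n\<close>.\<close>
    obtain c :: "(('n \<Rightarrow> 'e) \<Rightarrow> 'e) \<Rightarrow> ('a \<times> 'm \<times> 'b) list" where c: "inj_on c (carrier (D Z))"
      by (rule coded_by_lists[OF DZ(2,3)])
    have "inj_on (\<iota> \<circ> c) (carrier (D Z))"
      by (rule comp_inj_on[OF c]) (rule inj_on_subset[OF universe], simp)
    then obtain X :: "('a \<times> 'm \<times> 'b, 'n) module" and \<kappa> where X: "fin_gen \<Lambda> X" "right_module \<Lambda> X"
      and \<kappa>: "\<kappa> \<in> mod_hom \<Lambda> X (D Z)" "bij_betw \<kappa> (carrier X) (carrier (D Z))"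
      using transport[OF DZ(2,3)] DZ(1) by metis
    have XS: "sided_module \<Lambda> X" using X(2) by (simp add: sided_module_def)
    obtain \<theta> where \<theta>: "\<theta> \<in> mod_hom \<Lambda> Z (D X)" "bij_betw \<theta> (carrier Z) (carrier (D X))"
      by (rule dual_of_dual[OF ZS XS \<kappa>])
    obtain s where s: "s \<in> mod_hom \<Lambda> (D X) Z" "\<And>z. z \<in> carrier Z \<Longrightarrow> s (\<theta> z) = z"
      "\<And>f. f \<in> carrier (D X) \<Longrightarrow> \<theta> (s f) = f"
      using is_iso_arrow_module_category[OF \<theta> ZS(1) D_sided[OF XS]] by metis
    \<comment> \<open>Whether \<open>X\<close> has a monic structure map is decided by its dual,
      which is isomorphic to \<open>Z\<close>.\<close>
    have "epi_condition (D X)"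
    proof (rule epi_condition_iso[OF ZS(1) D_sided[OF XS] \<theta>(1) s(1)])
      show "epi_condition Z" using Z[unfolded E_obj] by blast
    qed (rule s(3))
    then have "X \<in> Obj ?C" using X by (simp add: C_obj)
    moreover have "is_iso_arrow ?E (D X) Z s"
      unfolding is_iso_arrow_def E_simps
      using s \<theta>(1) mod_homD(1) by (auto simp: compose_def fun_eq_iff restrict_def intro!: bexI[of _ \<theta>])
    ultimately show ?thesis by blast
  qed
  ultimately show ?thesis
    unfolding is_duality_def
    by (intro is_equivalence_if_fully_faithful) (simp_all add: C_simps E_simps)
qed

end
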